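(* Let $A$ be an Artin algebra and let $X$ be an indecomposable non-projective $A$-module. Then the following are equivalent: (1) $\mathrm{Ext}_A^{1}(X,A)=\mathrm{Ext}_A^{2}(X,A)=0$. (2) $\mathrm{Tr}(X)$ is reflexive. (3) $X$ is $\tau$-perfect, that is, $\tau(X) \cong \nu\,\Omega^{2}(X)$.
   Context: Modules are finitely generated right modules unless otherwise stated; left $A$-modules are right $A^{op}$-modules. $D$ is the standard duality of the Artin algebra $A$ between right and left modules. $(-)^*=\mathrm{Hom}_A(-,A)$. A module $M$ is reflexive if the natural evaluation map $M\to M^{**}$ is an isomorphism (similarly for left modules). For a minimal projective presentation $P_1\xrightarrow{g}P_0\to X\to 0$, the Auslander-Bridger transpose is $\mathrm{Tr}(X)=\mathrm{coker}(g^*:P_0^*\to P_1^* )$. $\Omega$ is the syzygy (kernel of a projective cover) and $\Omega^2=\Omega\Omega$. $\tau=D\,\mathrm{Tr}$ is the Auslander-Reiten translate, and $\nu=D(-)^*$ is the Nakayama functor. *)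

theory Defs
  imports "HOL-Algebra.Module" "HOL-Algebra.Ideal" "HOL-Algebra.Elementary_Groups"
begin

section \<open>Right modules over a ring\<close>

text \<open>The locale \<^locale>\<open>module\<close> of HOL-Algebra needs a commutative ring of scalars. Here
  \<open>a \<odot>\<^bsub>M\<^esub> x\<close> stands for the right action \<open>x \<cdot> a\<close>, hence the reversed order in
  \<open>smult_assoc\<close>. The fields \<open>mult\<close> and \<open>one\<close> of a module record are never used.\<close>

locale right_module = R?: ring R + M?: abelian_group M
    for R :: "('a, 'r) ring_scheme" (structure)
    and M :: "('a, 'm, 'e) module_scheme" (structure) +
  assumes smult_closed [simp, intro]:
      "\<lbrakk>a \<in> carrier R; x \<in> carrier M\<rbrakk> \<Longrightarrow> a \<odot>\<^bsub>M\<^esub> x \<in> carrier M"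
    and smult_l_distr:
      "\<lbrakk>a \<in> carrier R; b \<in> carrier R; x \<in> carrier M\<rbrakk> \<Longrightarrow>
        (a \<oplus>\<^bsub>R\<^esub> b) \<odot>\<^bsub>M\<^esub> x = a \<odot>\<^bsub>M\<^esub> x \<oplus>\<^bsub>M\<^esub> b \<odot>\<^bsub>M\<^esub> x"
    and smult_r_distr:
      "\<lbrakk>a \<in> carrier R; x \<in> carrier M; y \<in> carrier M\<rbrakk> \<Longrightarrow>
        a \<odot>\<^bsub>M\<^esub> (x \<oplus>\<^bsub>M\<^esub> y) = a \<odot>\<^bsub>M\<^esub> x \<oplus>\<^bsub>M\<^esub> a \<odot>\<^bsub>M\<^esub> y"
    and smult_assoc:
      "\<lbrakk>a \<in> carrier R; b \<in> carrier R; x \<in> carrier M\<rbrakk> \<Longrightarrow>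
        (a \<otimes>\<^bsub>R\<^esub> b) \<odot>\<^bsub>M\<^esub> x = b \<odot>\<^bsub>M\<^esub> (a \<odot>\<^bsub>M\<^esub> x)"
    and smult_one [simp]: "x \<in> carrier M \<Longrightarrow> \<one>\<^bsub>R\<^esub> \<odot>\<^bsub>M\<^esub> x = x"

definition opp_ring :: "('a, 'r) ring_scheme \<Rightarrow> ('a, 'r) ring_scheme" where
  "opp_ring A = A\<lparr>mult := \<lambda>x y. y \<otimes>\<^bsub>A\<^esub> x\<rparr>"

definition regular_module :: "('a, 'r) ring_scheme \<Rightarrow> ('a, 'a) module" where
  "regular_module A =
    \<lparr>carrier = carrier A, mult = mult A, one = one A, zero = zero A, add = add A,
     smult = (\<lambda>a x. x \<otimes>\<^bsub>A\<^esub> a)\<rparr>"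

definition fg_module :: "('a, 'r) ring_scheme \<Rightarrow> ('a, 'm, 'e) module_scheme \<Rightarrow> bool" where
  "fg_module A M \<longleftrightarrow> right_module A M \<and>
    (\<exists>S. finite S \<and> S \<subseteq> carrier M \<and> (\<forall>N. submodule N A M \<and> S \<subseteq> N \<longrightarrow> N = carrier M))"

definition indecomposable :: "('a, 'r) ring_scheme \<Rightarrow> ('a, 'm, 'e) module_scheme \<Rightarrow> bool" where
  "indecomposable A M \<longleftrightarrow> carrier M \<noteq> {\<zero>\<^bsub>M\<^esub>} \<and>
    (\<forall>N N'. submodule N A M \<and> submodule N' A M \<and>
        N \<inter> N' = {\<zero>\<^bsub>M\<^esub>} \<and> N <+>\<^bsub>M\<^esub> N' = carrier M \<longrightarrow>
      N = {\<zero>\<^bsub>M\<^esub>} \<or> N' = {\<zero>\<^bsub>M\<^esub>})"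

text \<open>Homomorphisms are extensional, so that distinct elements of a Hom set are distinct maps.\<close>

definition Hom :: "('a, 'r) ring_scheme \<Rightarrow> ('a, 'm, 'e) module_scheme \<Rightarrow>
    ('a, 'n, 'f) module_scheme \<Rightarrow> ('m \<Rightarrow> 'n) set" where
  "Hom A M N = {f \<in> carrier M \<rightarrow>\<^sub>E carrier N.
    (\<forall>x\<in>carrier M. \<forall>y\<in>carrier M. f (x \<oplus>\<^bsub>M\<^esub> y) = f x \<oplus>\<^bsub>N\<^esub> f y) \<and>
    (\<forall>a\<in>carrier A. \<forall>x\<in>carrier M. f (a \<odot>\<^bsub>M\<^esub> x) = a \<odot>\<^bsub>N\<^esub> f x)}"

definition module_iso :: "('a, 'r) ring_scheme \<Rightarrow> ('a, 'm, 'e) module_scheme \<Rightarrow>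
    ('a, 'n, 'f) module_scheme \<Rightarrow> ('m \<Rightarrow> 'n) set" where
  "module_iso A M N = {f \<in> Hom A M N. bij_betw f (carrier M) (carrier N)}"

definition isomorphic :: "('a, 'r) ring_scheme \<Rightarrow> ('a, 'm, 'e) module_scheme \<Rightarrow>
    ('a, 'n, 'f) module_scheme \<Rightarrow> bool" where
  "isomorphic A M N \<longleftrightarrow> module_iso A M N \<noteq> {}"

definition quotient_module :: "('a, 'm, 'e) module_scheme \<Rightarrow> 'm set \<Rightarrow> ('a, 'm set) module" where
  "quotient_module M N =
    \<lparr>carrier = a_rcosets\<^bsub>M\<^esub> N, mult = undefined, one = undefined,
     zero = N, add = set_add M,
     smult = (\<lambda>a C. \<Union>x\<in>C. N +>\<^bsub>M\<^esub> (a \<odot>\<^bsub>M\<^esub> x))\<rparr>"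


section \<open>Projective modules, projective covers and syzygies\<close>

text \<open>Up to isomorphism, the modules with elements of type \<open>(nat \<Rightarrow> 'a) set\<close> include all
  quotients of the modules \<open>A\<^sup>n\<close> and thus all finitely generated ones. For a finitely generated
  module it is therefore no restriction to test the lifting property on this type only.\<close>

definition fg_projective :: "('a, 'r) ring_scheme \<Rightarrow> ('a, 'm, 'e) module_scheme \<Rightarrow> bool" where
  "fg_projective A P \<longleftrightarrow> fg_module A P \<and>
    (\<forall>(M :: ('a, (nat \<Rightarrow> 'a) set) module) (N :: ('a, (nat \<Rightarrow> 'a) set) module) g f.
      right_module A M \<and> right_module A N \<and>
      g \<in> Hom A M N \<and> g ` carrier M = carrier N \<and> f \<in> Hom A P N \<longrightarrow>
      (\<exists>h\<in>Hom A P M. \<forall>x\<in>carrier P. g (h x) = f x))"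

definition projective_cover :: "('a, 'r) ring_scheme \<Rightarrow> ('a, 'm, 'e) module_scheme \<Rightarrow>
    ('a, 'p, 'f) module_scheme \<Rightarrow> ('p \<Rightarrow> 'm) \<Rightarrow> bool" where
  "projective_cover A X P p \<longleftrightarrow> fg_projective A P \<and>
    p \<in> Hom A P X \<and> p ` carrier P = carrier X \<and>
    (\<forall>N. submodule N A P \<and> N <+>\<^bsub>P\<^esub> a_kernel P X p = carrier P \<longrightarrow> N = carrier P)"

text \<open>A finitely generated projective module is a direct summand of some \<open>A\<^sup>n\<close>, hence isomorphic
  to a module on the type \<open>nat \<Rightarrow> 'a\<close>. So over an Artin algebra every finitely generated module
  has a projective cover of the following type. It is unique up to isomorphism.\<close>

definition proj_cover :: "('a, 'r) ring_scheme \<Rightarrow> ('a, 'm, 'e) module_scheme \<Rightarrow>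
    ('a, nat \<Rightarrow> 'a) module \<times> ((nat \<Rightarrow> 'a) \<Rightarrow> 'm)" where
  "proj_cover A X = (SOME (P, p). projective_cover A X P p)"

definition syzygy :: "('a, 'r) ring_scheme \<Rightarrow> ('a, 'm, 'e) module_scheme \<Rightarrow>
    ('a, nat \<Rightarrow> 'a) module" where
  "syzygy A X = (case proj_cover A X of (P, p) \<Rightarrow> P\<lparr>carrier := a_kernel P X p\<rparr>)"


section \<open>Ext\<close>

definition projective_resolution :: "('a, 'r) ring_scheme \<Rightarrow> ('a, 'm, 'e) module_scheme \<Rightarrow>
    (nat \<Rightarrow> ('a, 'p, 'f) module_scheme) \<Rightarrow> (nat \<Rightarrow> 'p \<Rightarrow> 'p) \<Rightarrow> ('p \<Rightarrow> 'm) \<Rightarrow> bool" where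
  "projective_resolution A X P d e \<longleftrightarrow>
    (\<forall>n. fg_projective A (P n)) \<and>
    (\<forall>n. d n \<in> Hom A (P (Suc n)) (P n)) \<and>
    e \<in> Hom A (P 0) X \<and> e ` carrier (P 0) = carrier X \<and>
    a_kernel (P 0) X e = d 0 ` carrier (P (Suc 0)) \<and>
    (\<forall>n. a_kernel (P (Suc n)) (P n) (d n) = d (Suc n) ` carrier (P (Suc (Suc n))))"

definition Hom_group :: "('a, 'r) ring_scheme \<Rightarrow> ('a, 'm, 'e) module_scheme \<Rightarrow>
    ('a, 'n, 'f) module_scheme \<Rightarrow> ('m \<Rightarrow> 'n) monoid" where
  "Hom_group A M N =
    \<lparr>carrier = Hom A M N, mult = (\<lambda>f g. \<lambda>x\<in>carrier M. f x \<oplus>\<^bsub>N\<^esub> g x),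
     one = (\<lambda>x\<in>carrier M. \<zero>\<^bsub>N\<^esub>)\<rparr>"

definition cocycles :: "('a, 'r) ring_scheme \<Rightarrow> (nat \<Rightarrow> ('a, 'p, 'f) module_scheme) \<Rightarrow>
    (nat \<Rightarrow> 'p \<Rightarrow> 'p) \<Rightarrow> ('a, 'n, 'e) module_scheme \<Rightarrow> nat \<Rightarrow> ('p \<Rightarrow> 'n) set" where
  "cocycles A P d Y n = {f \<in> Hom A (P n) Y. \<forall>x\<in>carrier (P (Suc n)). f (d n x) = \<zero>\<^bsub>Y\<^esub>}"

primrec coboundaries :: "('a, 'r) ring_scheme \<Rightarrow> (nat \<Rightarrow> ('a, 'p, 'f) module_scheme) \<Rightarrow>
    (nat \<Rightarrow> 'p \<Rightarrow> 'p) \<Rightarrow> ('a, 'n, 'e) module_scheme \<Rightarrow> nat \<Rightarrow> ('p \<Rightarrow> 'n) set" where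
  "coboundaries A P d Y 0 = {\<lambda>x\<in>carrier (P 0). \<zero>\<^bsub>Y\<^esub>}"
| "coboundaries A P d Y (Suc n) =
    (\<lambda>f. \<lambda>x\<in>carrier (P (Suc n)). f (d n x)) ` Hom A (P n) Y"

text \<open>The \<open>n\<close>-th cohomology group of \<open>Hom\<^sub>A(P, Y)\<close> for a chosen projective resolution \<open>P\<close> of \<open>X\<close> by
  finitely generated modules. Over an Artin algebra, a finitely generated \<open>X\<close> has such a
  resolution on the type \<open>nat \<Rightarrow> 'a\<close>.\<close>

definition Ext :: "('a, 'r) ring_scheme \<Rightarrow> nat \<Rightarrow> ('a, 'm, 'e) module_scheme \<Rightarrow>
    ('a, 'n, 'f) module_scheme \<Rightarrow> ((nat \<Rightarrow> 'a) \<Rightarrow> 'n) set monoid" where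
  "Ext A n X Y =
    (case (SOME (P :: nat \<Rightarrow> ('a, nat \<Rightarrow> 'a) module, d, e). projective_resolution A X P d e) of
      (P, d, e) \<Rightarrow>
        ((Hom_group A (P n) Y)\<lparr>carrier := cocycles A P d Y n\<rparr>) Mod coboundaries A P d Y n)"


section \<open>The functor \<open>Hom\<^sub>A(-, A)\<close>, reflexive modules and the transpose\<close>

text \<open>The dual \<open>M\<^sup>*\<close> of a right \<open>A\<close>-module is the left \<open>A\<close>-module, i.e. right module over
  \<open>opp_ring A\<close>, with action \<open>(a f)(x) = a f(x)\<close>.\<close>

definition dual :: "('a, 'r) ring_scheme \<Rightarrow> ('a, 'm, 'e) module_scheme \<Rightarrow> ('a, 'm \<Rightarrow> 'a) module" where
  "dual A M =
    \<lparr>carrier = Hom A M (regular_module A), mult = undefined, one = undefined,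
     zero = (\<lambda>x\<in>carrier M. \<zero>\<^bsub>A\<^esub>),
     add = (\<lambda>f g. \<lambda>x\<in>carrier M. f x \<oplus>\<^bsub>A\<^esub> g x),
     smult = (\<lambda>a f. \<lambda>x\<in>carrier M. a \<otimes>\<^bsub>A\<^esub> f x)\<rparr>"

definition dual_map :: "('a, 'r) ring_scheme \<Rightarrow> ('a, 'm, 'e) module_scheme \<Rightarrow>
    ('a, 'n, 'f) module_scheme \<Rightarrow> ('m \<Rightarrow> 'n) \<Rightarrow> ('n \<Rightarrow> 'a) \<Rightarrow> ('m \<Rightarrow> 'a)" where
  "dual_map A M N g = (\<lambda>f\<in>carrier (dual A N). \<lambda>x\<in>carrier M. f (g x))"

definition evaluation :: "('a, 'r) ring_scheme \<Rightarrow> ('a, 'm, 'e) module_scheme \<Rightarrow>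
    'm \<Rightarrow> ('m \<Rightarrow> 'a) \<Rightarrow> 'a" where
  "evaluation A M = (\<lambda>x\<in>carrier M. \<lambda>f\<in>carrier (dual A M). f x)"

definition reflexive :: "('a, 'r) ring_scheme \<Rightarrow> ('a, 'm, 'e) module_scheme \<Rightarrow> bool" where
  "reflexive A M \<longleftrightarrow>
    evaluation A M \<in> module_iso A M (dual (opp_ring A) (dual A M))"

text \<open>The minimal projective presentation consists of the projective covers \<open>P0 \<rightarrow> X\<close> and
  \<open>P1 \<rightarrow> \<Omega> X\<close>, the latter read as a map to \<open>P0\<close>. The transpose is a module over
  \<open>opp_ring A\<close>.\<close>

definition AB_transpose :: "('a, 'r) ring_scheme \<Rightarrow> ('a, 'm, 'e) module_scheme \<Rightarrow>
    ('a, ((nat \<Rightarrow> 'a) \<Rightarrow> 'a) set) module" where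
  "AB_transpose A X =
    (let P0 = fst (proj_cover A X); (P1, g) = proj_cover A (syzygy A X)
     in quotient_module (dual A P1) (dual_map A P1 P0 g ` carrier (dual A P0)))"


section \<open>Artin algebras and the standard duality\<close>

definition restrict_scalars :: "('k \<Rightarrow> 'a) \<Rightarrow> ('a, 'm, 'e) module_scheme \<Rightarrow> ('k, 'm) module" where
  "restrict_scalars \<phi> M =
    \<lparr>carrier = carrier M, mult = mult M, one = one M, zero = zero M, add = add M,
     smult = (\<lambda>c. smult M (\<phi> c))\<rparr>"

definition artinian :: "('k, 's) ring_scheme \<Rightarrow> bool" where
  "artinian k \<longleftrightarrow> (\<forall>I :: nat \<Rightarrow> 'k set.
    (\<forall>n. ideal (I n) k) \<and> (\<forall>n. I (Suc n) \<subseteq> I n) \<longrightarrow> (\<exists>m. \<forall>n\<ge>m. I n = I m))"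

text \<open>An Artin algebra over the commutative artinian ring \<open>k\<close> with structure map \<open>\<phi>\<close>.\<close>

definition artin_algebra :: "('k, 's) ring_scheme \<Rightarrow> ('k \<Rightarrow> 'a) \<Rightarrow> ('a, 'r) ring_scheme \<Rightarrow> bool" where
  "artin_algebra k \<phi> A \<longleftrightarrow> cring k \<and> artinian k \<and> ring A \<and> \<phi> \<in> ring_hom k A \<and>
    (\<forall>c\<in>carrier k. \<forall>a\<in>carrier A. \<phi> c \<otimes>\<^bsub>A\<^esub> a = a \<otimes>\<^bsub>A\<^esub> \<phi> c) \<and>
    fg_module k (restrict_scalars \<phi> (regular_module A))"

text \<open>The type \<open>(nat \<Rightarrow> 'k) set\<close> contains copies of \<open>k\<close> and its ideals, so by Baer's criterion it
  is no restriction to test the extension property on this type only.\<close>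

definition injective :: "('k, 's) ring_scheme \<Rightarrow> ('k, 'j, 'e) module_scheme \<Rightarrow> bool" where
  "injective k J \<longleftrightarrow> right_module k J \<and>
    (\<forall>(N :: ('k, (nat \<Rightarrow> 'k) set) module) (M :: ('k, (nat \<Rightarrow> 'k) set) module) i f.
      right_module k N \<and> right_module k M \<and>
      i \<in> Hom k N M \<and> inj_on i (carrier N) \<and> f \<in> Hom k N J \<longrightarrow>
      (\<exists>h\<in>Hom k M J. \<forall>x\<in>carrier N. h (i x) = f x))"

definition injective_envelope :: "('k, 's) ring_scheme \<Rightarrow> ('k, 'm, 'e) module_scheme \<Rightarrow>
    ('k, 'j, 'f) module_scheme \<Rightarrow> bool" where
  "injective_envelope k S J \<longleftrightarrow> injective k J \<and>
    (\<exists>i\<in>Hom k S J. inj_on i (carrier S) \<and>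
      (\<forall>N. submodule N k J \<and> N \<inter> i ` carrier S = {\<zero>\<^bsub>J\<^esub>} \<longrightarrow> N = {\<zero>\<^bsub>J\<^esub>}))"

definition jacobson_radical :: "('k, 's) ring_scheme \<Rightarrow> 'k set" where
  "jacobson_radical k = carrier k \<inter> \<Inter>{I. maximalideal I k}"

text \<open>\<open>D M = Hom\<^sub>k(M, J)\<close> with action \<open>(a f)(x) = f(x a)\<close>, where \<open>J\<close> is an injective envelope
  of \<open>k/rad k\<close>. It takes right modules over \<open>A\<close> to right modules over \<open>opp_ring A\<close> and
  vice versa.\<close>

definition standard_dual :: "('k, 's) ring_scheme \<Rightarrow> ('k \<Rightarrow> 'a) \<Rightarrow> ('k, 'j, 'f) module_scheme \<Rightarrow>
    ('a, 'm, 'e) module_scheme \<Rightarrow> ('a, 'm \<Rightarrow> 'j) module" where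
  "standard_dual k \<phi> J M =
    \<lparr>carrier = Hom k (restrict_scalars \<phi> M) J, mult = undefined, one = undefined,
     zero = (\<lambda>x\<in>carrier M. \<zero>\<^bsub>J\<^esub>),
     add = (\<lambda>f g. \<lambda>x\<in>carrier M. f x \<oplus>\<^bsub>J\<^esub> g x),
     smult = (\<lambda>a f. \<lambda>x\<in>carrier M. f (a \<odot>\<^bsub>M\<^esub> x))\<rparr>"

definition AR_translate :: "('k, 's) ring_scheme \<Rightarrow> ('k \<Rightarrow> 'a) \<Rightarrow> ('k, 'j, 'f) module_scheme \<Rightarrow>
    ('a, 'r) ring_scheme \<Rightarrow> ('a, 'm, 'e) module_scheme \<Rightarrow>
    ('a, ((nat \<Rightarrow> 'a) \<Rightarrow> 'a) set \<Rightarrow> 'j) module" where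
  "AR_translate k \<phi> J A X = standard_dual k \<phi> J (AB_transpose A X)"

definition nakayama :: "('k, 's) ring_scheme \<Rightarrow> ('k \<Rightarrow> 'a) \<Rightarrow> ('k, 'j, 'f) module_scheme \<Rightarrow>
    ('a, 'r) ring_scheme \<Rightarrow> ('a, 'm, 'e) module_scheme \<Rightarrow> ('a, ('m \<Rightarrow> 'a) \<Rightarrow> 'j) module" where
  "nakayama k \<phi> J A M = standard_dual k \<phi> J (dual A M)"

definition tau_perfect :: "('k, 's) ring_scheme \<Rightarrow> ('k \<Rightarrow> 'a) \<Rightarrow> ('k, 'j, 'f) module_scheme \<Rightarrow>
    ('a, 'r) ring_scheme \<Rightarrow> ('a, 'm, 'e) module_scheme \<Rightarrow> bool" where
  "tau_perfect k \<phi> J A X \<longleftrightarrow>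
    isomorphic A (AR_translate k \<phi> J A X) (nakayama k \<phi> J A (syzygy A (syzygy A X)))"

end

theory Submission
  imports Defs
begin

text \<open>Let \<open>P1 \<rightarrow> P0 \<rightarrow> X \<rightarrow> 0\<close> be the minimal projective presentation with map \<open>g : P1 \<rightarrow> P0\<close>,
  \<open>K = ker g = \<Omega>\<^sup>2 X\<close> and \<open>T = Tr X = coker g\<^sup>*\<close>. Restriction of functionals to \<open>K\<close> induces a map
  \<open>u : T \<rightarrow> K\<^sup>*\<close>. Each of the three conditions says that \<open>u\<close> is bijective. Injectivity and surjectivity
  of \<open>u\<close> are the vanishing of \<open>Ext\<^sup>1(X, A)\<close> and \<open>Ext\<^sup>2(X, A)\<close>. Since \<open>P1\<close> is reflexive,
  \<open>K \<cong> T\<^sup>*\<close>, and this turns \<open>u\<close> into the evaluation \<open>T \<rightarrow> T\<^sup>*\<^sup>*\<close>. Finally \<open>\<tau> X = D T\<close> and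
  \<open>\<nu> \<Omega>\<^sup>2 X = D K\<^sup>*\<close>, so by the duality \<open>D\<close> an isomorphism between them is an abstract isomorphism
  \<open>T \<cong> K\<^sup>*\<close>; for modules of finite length its existence already forces \<open>u\<close> to be bijective.\<close>

section \<open>Modules, submodules and homomorphisms\<close>

text \<open>Covers, syzygies and Ext are fixed by \<open>SOME\<close>. The resolution spliced from
  the covers of the iterated syzygies ties these choices together: its first differential is
  \<open>g\<close> itself and the kernel of \<open>g\<close> is \<open>\<Omega>\<^sup>2 X\<close> on
  the nose, so only Ext has to be freed of its own chosen resolution, by chain homotopy.
  Projectivity and injectivity are tested by the definitions on one type only; dual bases and copies
  of finitely generated modules carry them to the other types that arise. Tau-perfectness offers an
  arbitrary isomorphism \<open>D T \<cong> D K\<^sup>*\<close>. It is the transpose of an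
  isomorphism between T and the dual of K because finitely generated k-modules are reflexive for
  \<open>Hom\<^sub>k(-, J)\<close>, which is proved by adding one simple factor at a time. That u is
  then injective rests on the fact that every functional on T factors through u: the kernel of u is
  killed by all functionals, whereas a dual module is separated by them. Finite length, derived from
  the descending chain condition on k, settles surjectivity.\<close>

lemma right_module_ring: "right_module A M \<Longrightarrow> ring A"
  by (simp add: right_module_def)

context right_module
begin

lemma smult_r_null [simp]: "a \<in> carrier R \<Longrightarrow> a \<odot>\<^bsub>M\<^esub> \<zero>\<^bsub>M\<^esub> = \<zero>\<^bsub>M\<^esub>"
  using smult_r_distr[of a "\<zero>\<^bsub>M\<^esub>" "\<zero>\<^bsub>M\<^esub>"] by (simp add: M.add.r_cancel_one')

lemma smult_l_null [simp]: "x \<in> carrier M \<Longrightarrow> \<zero> \<odot>\<^bsub>M\<^esub> x = \<zero>\<^bsub>M\<^esub>"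
  using smult_l_distr[of \<zero> \<zero> x] by (simp add: M.add.r_cancel_one')

lemma smult_r_minus: "\<lbrakk>a \<in> carrier R; x \<in> carrier M\<rbrakk> \<Longrightarrow> a \<odot>\<^bsub>M\<^esub> (\<ominus>\<^bsub>M\<^esub> x) = \<ominus>\<^bsub>M\<^esub> (a \<odot>\<^bsub>M\<^esub> x)"
  by (metis M.add.inv_closed M.minus_equality M.l_neg smult_closed smult_r_distr smult_r_null)

lemma smult_l_minus: "\<lbrakk>a \<in> carrier R; x \<in> carrier M\<rbrakk> \<Longrightarrow> (\<ominus> a) \<odot>\<^bsub>M\<^esub> x = \<ominus>\<^bsub>M\<^esub> (a \<odot>\<^bsub>M\<^esub> x)"
  by (metis M.minus_equality R.add.inv_closed R.l_neg smult_closed smult_l_distr smult_l_null)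

lemma minus_conv_smult: "x \<in> carrier M \<Longrightarrow> \<ominus>\<^bsub>M\<^esub> x = (\<ominus> \<one>) \<odot>\<^bsub>M\<^esub> x"
  by (simp add: smult_l_minus)

text \<open>The library locale also demands closure under negation; it follows because
  \<open>\<ominus> x\<close> is the action of \<open>\<ominus> \<one>\<close> on
  \<open>x\<close>.\<close>

lemma submodule_iff:
  "submodule N R M \<longleftrightarrow> N \<subseteq> carrier M \<and> \<zero>\<^bsub>M\<^esub> \<in> N \<and>
    (\<forall>x\<in>N. \<forall>y\<in>N. x \<oplus>\<^bsub>M\<^esub> y \<in> N) \<and> (\<forall>a\<in>carrier R. \<forall>x\<in>N. a \<odot>\<^bsub>M\<^esub> x \<in> N)" (is "?l = ?r")
proof
  assume ?l
  then interpret submodule N R M .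
  show ?r using subset one_closed m_closed smult_closed by auto
next
  assume r: ?r
  have inv: "\<ominus>\<^bsub>M\<^esub> x \<in> N" if "x \<in> N" for x
    using r that minus_conv_smult[of x] by auto
  show ?l
    using r inv by (auto simp: submodule_def submodule_axioms_def subgroup_def simp flip: a_inv_def)
qed

lemma carrier_submodule: "submodule (carrier M) R M"
  by (simp add: submodule_iff)

lemma zero_submodule: "submodule {\<zero>\<^bsub>M\<^esub>} R M"
  by (simp add: submodule_iff)

lemma submodule_neg: "submodule N R M \<Longrightarrow> x \<in> N \<Longrightarrow> \<ominus>\<^bsub>M\<^esub> x \<in> N"
  using minus_conv_smult[of x] by (auto simp: submodule_iff)

lemma submodule_diff: "submodule N R M \<Longrightarrow> x \<in> N \<Longrightarrow> y \<in> N \<Longrightarrow> x \<ominus>\<^bsub>M\<^esub> y \<in> N"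
  using submodule_neg[of N y] by (auto simp: submodule_iff a_minus_def)

lemma submodule_cancel:
  assumes "submodule N R M" "x \<oplus>\<^bsub>M\<^esub> y \<in> N" "y \<in> N" "x \<in> carrier M"
  shows "x \<in> N"
proof -
  have "(x \<oplus>\<^bsub>M\<^esub> y) \<ominus>\<^bsub>M\<^esub> y \<in> N" using assms submodule_diff by blast
  moreover have "(x \<oplus>\<^bsub>M\<^esub> y) \<ominus>\<^bsub>M\<^esub> y = x"
    using assms by (auto simp: submodule_iff a_minus_def M.a_assoc M.r_neg subset_iff)
  ultimately show ?thesis by simp
qed

lemma submodule_Int: "submodule N R M \<Longrightarrow> submodule N' R M \<Longrightarrow> submodule (N \<inter> N') R M"
  by (auto simp: submodule_iff)

lemma mem_set_add: "z \<in> N <+>\<^bsub>M\<^esub> N' \<longleftrightarrow> (\<exists>x\<in>N. \<exists>y\<in>N'. z = x \<oplus>\<^bsub>M\<^esub> y)"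
  by (auto simp: set_add_def')

lemma submodule_add:
  assumes "submodule N R M" "submodule N' R M" shows "submodule (N <+>\<^bsub>M\<^esub> N') R M"
proof -
  have N: "N \<subseteq> carrier M" and N': "N' \<subseteq> carrier M" using assms by (auto simp: submodule_iff)
  show ?thesis
    unfolding submodule_iff
  proof (intro conjI ballI)
    show "N <+>\<^bsub>M\<^esub> N' \<subseteq> carrier M" using N N' by (auto simp: mem_set_add subset_iff)
    show "\<zero>\<^bsub>M\<^esub> \<in> N <+>\<^bsub>M\<^esub> N'"
      using assms unfolding mem_set_add by (intro bexI[of _ "\<zero>\<^bsub>M\<^esub>"]) (auto simp: submodule_iff)
  next
    fix z z' assume "z \<in> N <+>\<^bsub>M\<^esub> N'" "z' \<in> N <+>\<^bsub>M\<^esub> N'"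
    then obtain x y x' y' where *: "x \<in> N" "y \<in> N'" "x' \<in> N" "y' \<in> N'"
      and z: "z = x \<oplus>\<^bsub>M\<^esub> y" "z' = x' \<oplus>\<^bsub>M\<^esub> y'" by (auto simp: mem_set_add)
    then have "z \<oplus>\<^bsub>M\<^esub> z' = (x \<oplus>\<^bsub>M\<^esub> x') \<oplus>\<^bsub>M\<^esub> (y \<oplus>\<^bsub>M\<^esub> y')"
      using N N' by (auto simp: M.a_ac subset_iff)
    moreover have "x \<oplus>\<^bsub>M\<^esub> x' \<in> N" "y \<oplus>\<^bsub>M\<^esub> y' \<in> N'" using assms * by (auto simp: submodule_iff)
    ultimately show "z \<oplus>\<^bsub>M\<^esub> z' \<in> N <+>\<^bsub>M\<^esub> N'" by (auto simp: mem_set_add)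
  next
    fix a z assume a: "a \<in> carrier R" and "z \<in> N <+>\<^bsub>M\<^esub> N'"
    then obtain x y where *: "x \<in> N" "y \<in> N'" and z: "z = x \<oplus>\<^bsub>M\<^esub> y" by (auto simp: mem_set_add)
    then have "a \<odot>\<^bsub>M\<^esub> z = (a \<odot>\<^bsub>M\<^esub> x) \<oplus>\<^bsub>M\<^esub> (a \<odot>\<^bsub>M\<^esub> y)"
      using N N' a by (auto simp: smult_r_distr subset_iff)
    moreover have "a \<odot>\<^bsub>M\<^esub> x \<in> N" "a \<odot>\<^bsub>M\<^esub> y \<in> N'" using assms * a by (auto simp: submodule_iff)
    ultimately show "a \<odot>\<^bsub>M\<^esub> z \<in> N <+>\<^bsub>M\<^esub> N'" by (auto simp: mem_set_add)
  qed
qed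

lemma set_add_upper:
  assumes "submodule N R M" "submodule N' R M"
  shows "N \<subseteq> N <+>\<^bsub>M\<^esub> N'" "N' \<subseteq> N <+>\<^bsub>M\<^esub> N'"
proof
  fix x assume "x \<in> N" then show "x \<in> N <+>\<^bsub>M\<^esub> N'"
    using assms unfolding mem_set_add by (intro bexI[of _ x] bexI[of _ "\<zero>\<^bsub>M\<^esub>"]) (auto simp: submodule_iff)
next
  show "N' \<subseteq> N <+>\<^bsub>M\<^esub> N'"
  proof
    fix x assume "x \<in> N'" then show "x \<in> N <+>\<^bsub>M\<^esub> N'"
      using assms unfolding mem_set_add by (intro bexI[of _ x] bexI[of _ "\<zero>\<^bsub>M\<^esub>"]) (auto simp: submodule_iff)
  qed
qed

lemma set_add_least:
  "submodule K R M \<Longrightarrow> N \<subseteq> K \<Longrightarrow> N' \<subseteq> K \<Longrightarrow> N <+>\<^bsub>M\<^esub> N' \<subseteq> K"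
  unfolding submodule_iff by (clarsimp simp: mem_set_add) (meson subsetD)

definition cyclic :: "'m \<Rightarrow> 'm set" where
  "cyclic x = (\<lambda>a. a \<odot>\<^bsub>M\<^esub> x) ` carrier R"

lemma submodule_cyclic: "x \<in> carrier M \<Longrightarrow> submodule (cyclic x) R M"
  unfolding submodule_iff cyclic_def
  apply (auto simp flip: smult_l_distr smult_assoc)
  by (metis R.zero_closed image_iff smult_l_null)

lemma mem_cyclic: "x \<in> carrier M \<Longrightarrow> x \<in> cyclic x"
  unfolding cyclic_def by (metis R.one_closed image_eqI smult_one)

lemma cyclic_least: "submodule N R M \<Longrightarrow> x \<in> N \<Longrightarrow> cyclic x \<subseteq> N"
  by (auto simp: submodule_iff cyclic_def)

lemma minus_eq_zero_iff:
  "\<lbrakk>x \<in> carrier M; y \<in> carrier M\<rbrakk> \<Longrightarrow> x \<ominus>\<^bsub>M\<^esub> y = \<zero>\<^bsub>M\<^esub> \<longleftrightarrow> x = y"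
  by (metis M.add.inv_closed M.add.inv_equality M.minus_minus M.r_neg a_minus_def)

end

text \<open>All module axioms except the existence of negatives are identities or closure
  conditions, and a negative can be taken in \<open>M\<close>; each passes to elements
  \<open>\<pi> x\<close> because \<open>\<pi>\<close> turns the operations of \<open>M\<close> into
  those of \<open>Q\<close>. Quotients, copies of modules and the passage to the opposite ring use
  it.\<close>

lemma right_moduleI_image:
  assumes M: "right_module R M"
    and car: "\<pi> ` carrier M = carrier Q" and zero: "\<pi> \<zero>\<^bsub>M\<^esub> = \<zero>\<^bsub>Q\<^esub>"
    and add: "\<And>x y. \<lbrakk>x \<in> carrier M; y \<in> carrier M\<rbrakk> \<Longrightarrow> \<pi> (x \<oplus>\<^bsub>M\<^esub> y) = \<pi> x \<oplus>\<^bsub>Q\<^esub> \<pi> y"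
    and smult: "\<And>a x. \<lbrakk>a \<in> carrier R; x \<in> carrier M\<rbrakk> \<Longrightarrow> \<pi> (a \<odot>\<^bsub>M\<^esub> x) = a \<odot>\<^bsub>Q\<^esub> \<pi> x"
  shows "right_module R Q"
proof -
  interpret M: right_module R M by fact
  have ball: "(\<forall>q\<in>carrier Q. P q) \<longleftrightarrow> (\<forall>x\<in>carrier M. P (\<pi> x))" for P
    unfolding car[symmetric] by blast
  have mem: "\<pi> x \<in> carrier Q" if "x \<in> carrier M" for x using that car by auto
  have "abelian_group Q"
  proof (rule abelian_groupI)
    show "\<zero>\<^bsub>Q\<^esub> \<in> carrier Q" using mem[of "\<zero>\<^bsub>M\<^esub>"] zero by auto
    have "\<forall>x\<in>carrier Q. \<forall>y\<in>carrier Q. x \<oplus>\<^bsub>Q\<^esub> y \<in> carrier Q"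
      unfolding ball by (auto simp: mem simp flip: add)
    then show "x \<oplus>\<^bsub>Q\<^esub> y \<in> carrier Q" if "x \<in> carrier Q" "y \<in> carrier Q" for x y using that by blast
    have "\<forall>x\<in>carrier Q. \<forall>y\<in>carrier Q. \<forall>z\<in>carrier Q. x \<oplus>\<^bsub>Q\<^esub> y \<oplus>\<^bsub>Q\<^esub> z = x \<oplus>\<^bsub>Q\<^esub> (y \<oplus>\<^bsub>Q\<^esub> z)"
      unfolding ball by (auto simp: M.a_assoc simp flip: add)
    then show "x \<oplus>\<^bsub>Q\<^esub> y \<oplus>\<^bsub>Q\<^esub> z = x \<oplus>\<^bsub>Q\<^esub> (y \<oplus>\<^bsub>Q\<^esub> z)" 
      if "x \<in> carrier Q" "y \<in> carrier Q" "z \<in> carrier Q" for x y z using that by blast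
    have "\<forall>x\<in>carrier Q. \<forall>y\<in>carrier Q. x \<oplus>\<^bsub>Q\<^esub> y = y \<oplus>\<^bsub>Q\<^esub> x"
      unfolding ball by (auto simp: M.a_comm simp flip: add)
    then show "x \<oplus>\<^bsub>Q\<^esub> y = y \<oplus>\<^bsub>Q\<^esub> x" if "x \<in> carrier Q" "y \<in> carrier Q" for x y using that by blast
    have "\<forall>x\<in>carrier Q. \<zero>\<^bsub>Q\<^esub> \<oplus>\<^bsub>Q\<^esub> x = x"
      unfolding ball by (auto simp flip: add zero)
    then show "\<zero>\<^bsub>Q\<^esub> \<oplus>\<^bsub>Q\<^esub> x = x" if "x \<in> carrier Q" for x using that by blast
    have "\<forall>x\<in>carrier Q. \<exists>y\<in>carrier Q. y \<oplus>\<^bsub>Q\<^esub> x = \<zero>\<^bsub>Q\<^esub>"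
      unfolding ball
    proof
      fix x assume x: "x \<in> carrier M"
      show "\<exists>y\<in>carrier Q. y \<oplus>\<^bsub>Q\<^esub> \<pi> x = \<zero>\<^bsub>Q\<^esub>"
        using x by (intro bexI[of _ "\<pi> (\<ominus>\<^bsub>M\<^esub> x)"]) (auto simp: mem M.l_neg zero simp flip: add)
    qed
    then show "\<exists>y\<in>carrier Q. y \<oplus>\<^bsub>Q\<^esub> x = \<zero>\<^bsub>Q\<^esub>" if "x \<in> carrier Q" for x using that by blast
  qed
  moreover have
    "\<forall>x\<in>carrier Q. \<forall>a\<in>carrier R. a \<odot>\<^bsub>Q\<^esub> x \<in> carrier Q"
    "\<forall>x\<in>carrier Q. \<forall>a\<in>carrier R. \<forall>b\<in>carrier R. (a \<oplus>\<^bsub>R\<^esub> b) \<odot>\<^bsub>Q\<^esub> x = a \<odot>\<^bsub>Q\<^esub> x \<oplus>\<^bsub>Q\<^esub> b \<odot>\<^bsub>Q\<^esub> x"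
    "\<forall>x\<in>carrier Q. \<forall>a\<in>carrier R. \<forall>b\<in>carrier R. (a \<otimes>\<^bsub>R\<^esub> b) \<odot>\<^bsub>Q\<^esub> x = b \<odot>\<^bsub>Q\<^esub> (a \<odot>\<^bsub>Q\<^esub> x)"
    "\<forall>x\<in>carrier Q. \<forall>y\<in>carrier Q. \<forall>a\<in>carrier R. a \<odot>\<^bsub>Q\<^esub> (x \<oplus>\<^bsub>Q\<^esub> y) = a \<odot>\<^bsub>Q\<^esub> x \<oplus>\<^bsub>Q\<^esub> a \<odot>\<^bsub>Q\<^esub> y"
    "\<forall>x\<in>carrier Q. \<one>\<^bsub>R\<^esub> \<odot>\<^bsub>Q\<^esub> x = x"
    unfolding ball
    by (auto simp: mem M.smult_l_distr M.smult_r_distr M.smult_assoc simp flip: add smult)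
  ultimately show ?thesis
    unfolding right_module_def right_module_axioms_def using M.R.ring_axioms by blast
qed

lemma submodule_right_module:
  assumes "right_module R M" "submodule N R M"
  shows "right_module R (M\<lparr>carrier := N\<rparr>)"
proof -
  interpret M: right_module R M by fact
  have sub: "x \<in> N \<Longrightarrow> x \<in> carrier M" for x using assms(2) by (auto simp: M.submodule_iff)
  have cl: "\<zero>\<^bsub>M\<^esub> \<in> N" "x \<in> N \<Longrightarrow> y \<in> N \<Longrightarrow> x \<oplus>\<^bsub>M\<^esub> y \<in> N"
    "a \<in> carrier R \<Longrightarrow> x \<in> N \<Longrightarrow> a \<odot>\<^bsub>M\<^esub> x \<in> N" for a x y
    using assms(2) by (auto simp: M.submodule_iff)
  have "abelian_group (M\<lparr>carrier := N\<rparr>)"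
  proof (rule abelian_groupI)
    fix x assume "x \<in> carrier (M\<lparr>carrier := N\<rparr>)"
    then show "\<exists>y\<in>carrier (M\<lparr>carrier := N\<rparr>). y \<oplus>\<^bsub>M\<lparr>carrier := N\<rparr>\<^esub> x = \<zero>\<^bsub>M\<lparr>carrier := N\<rparr>\<^esub>"
      using M.submodule_neg[OF assms(2)] sub by (intro bexI[of _ "\<ominus>\<^bsub>M\<^esub> x"]) (simp_all add: M.l_neg)
  qed (simp_all add: cl sub M.a_ac)
  then show ?thesis
    unfolding right_module_def right_module_axioms_def
    using M.R.ring_axioms by (simp add: cl sub M.smult_l_distr M.smult_r_distr M.smult_assoc)
qed

lemma submodule_trans_iff:
  assumes "right_module R M" "submodule N R M"
  shows "submodule U R (M\<lparr>carrier := N\<rparr>) \<longleftrightarrow> submodule U R M \<and> U \<subseteq> N"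
proof -
  have "N \<subseteq> carrier M" using assms by (simp add: right_module.submodule_iff)
  then show ?thesis
    unfolding right_module.submodule_iff[OF submodule_right_module[OF assms]]
      right_module.submodule_iff[OF assms(1)] by (simp add: conj_ac) blast
qed

section \<open>Homomorphisms, kernels, images and isomorphisms\<close>

lemma HomI:
  assumes "\<And>x. x \<in> carrier M \<Longrightarrow> f x \<in> carrier N"
    "\<And>x y. x \<in> carrier M \<Longrightarrow> y \<in> carrier M \<Longrightarrow> f (x \<oplus>\<^bsub>M\<^esub> y) = f x \<oplus>\<^bsub>N\<^esub> f y"
    "\<And>a x. a \<in> carrier A \<Longrightarrow> x \<in> carrier M \<Longrightarrow> f (a \<odot>\<^bsub>M\<^esub> x) = a \<odot>\<^bsub>N\<^esub> f x"
    "f \<in> extensional (carrier M)"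
  shows "f \<in> Hom A M N"
  using assms by (auto simp: Hom_def PiE_iff)

lemma restrict_HomI:
  assumes "right_module A M"
    "\<And>x. x \<in> carrier M \<Longrightarrow> f x \<in> carrier N"
    "\<And>x y. x \<in> carrier M \<Longrightarrow> y \<in> carrier M \<Longrightarrow> f (x \<oplus>\<^bsub>M\<^esub> y) = f x \<oplus>\<^bsub>N\<^esub> f y"
    "\<And>a x. a \<in> carrier A \<Longrightarrow> x \<in> carrier M \<Longrightarrow> f (a \<odot>\<^bsub>M\<^esub> x) = a \<odot>\<^bsub>N\<^esub> f x"
  shows "(\<lambda>x\<in>carrier M. f x) \<in> Hom A M N"
proof -
  interpret M: right_module A M by fact
  show ?thesis using assms by (intro HomI) auto
qed

lemma Hom_closed: "f \<in> Hom A M N \<Longrightarrow> x \<in> carrier M \<Longrightarrow> f x \<in> carrier N"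
  and Hom_add: "f \<in> Hom A M N \<Longrightarrow> x \<in> carrier M \<Longrightarrow> y \<in> carrier M \<Longrightarrow> f (x \<oplus>\<^bsub>M\<^esub> y) = f x \<oplus>\<^bsub>N\<^esub> f y"
  and Hom_smult: "f \<in> Hom A M N \<Longrightarrow> a \<in> carrier A \<Longrightarrow> x \<in> carrier M \<Longrightarrow> f (a \<odot>\<^bsub>M\<^esub> x) = a \<odot>\<^bsub>N\<^esub> f x"
  and Hom_extensional: "f \<in> Hom A M N \<Longrightarrow> f \<in> extensional (carrier M)"
  by (auto simp: Hom_def PiE_iff)

lemma Hom_ext:
  "f \<in> Hom A M N \<Longrightarrow> g \<in> Hom A M N' \<Longrightarrow> (\<And>x. x \<in> carrier M \<Longrightarrow> f x = g x) \<Longrightarrow> f = g"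
  by (metis Hom_extensional extensionalityI)

lemma Hom_zero:
  assumes "right_module A M" "right_module A N" "f \<in> Hom A M N"
  shows "f \<zero>\<^bsub>M\<^esub> = \<zero>\<^bsub>N\<^esub>"
proof -
  interpret M: right_module A M by fact
  interpret N: right_module A N by fact
  have "f \<zero>\<^bsub>M\<^esub> = \<zero>\<^bsub>A\<^esub> \<odot>\<^bsub>N\<^esub> f \<zero>\<^bsub>M\<^esub>"
    using Hom_smult[OF assms(3), of "\<zero>\<^bsub>A\<^esub>" "\<zero>\<^bsub>M\<^esub>"] by simp
  then show ?thesis using Hom_closed[OF assms(3)] by simp
qed

lemma Hom_minus:
  assumes "right_module A M" "right_module A N" "f \<in> Hom A M N" "x \<in> carrier M"
  shows "f (\<ominus>\<^bsub>M\<^esub> x) = \<ominus>\<^bsub>N\<^esub> f x"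
proof -
  interpret M: right_module A M by fact
  interpret N: right_module A N by fact
  show ?thesis
    using Hom_smult[OF assms(3), of "\<ominus>\<^bsub>A\<^esub> \<one>\<^bsub>A\<^esub>" x] assms(4) Hom_closed[OF assms(3,4)]
    by (simp add: M.minus_conv_smult N.minus_conv_smult)
qed

lemma Hom_diff:
  assumes "right_module A M" "right_module A N" "f \<in> Hom A M N" "x \<in> carrier M" "y \<in> carrier M"
  shows "f (x \<ominus>\<^bsub>M\<^esub> y) = f x \<ominus>\<^bsub>N\<^esub> f y"
proof -
  interpret M: right_module A M by fact
  show ?thesis using Hom_add[OF assms(3,4), of "\<ominus>\<^bsub>M\<^esub> y"] assms
    by (simp add: a_minus_def Hom_minus)
qed

lemma Hom_comp:
  assumes "right_module A M" "f \<in> Hom A M N" "g \<in> Hom A N L"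
  shows "(\<lambda>x\<in>carrier M. g (f x)) \<in> Hom A M L"
  using assms by (intro restrict_HomI) (auto simp: Hom_closed Hom_add Hom_smult)

lemma Hom_plus:
  assumes "right_module A M" "right_module A N" "f \<in> Hom A M N" "g \<in> Hom A M N"
  shows "(\<lambda>x\<in>carrier M. f x \<oplus>\<^bsub>N\<^esub> g x) \<in> Hom A M N"
proof -
  interpret N: right_module A N by fact
  show ?thesis
    using assms by (intro restrict_HomI) (auto simp: Hom_closed Hom_add Hom_smult N.smult_r_distr N.a_ac)
qed

lemma Hom_uminus:
  assumes "right_module A M" "right_module A N" "f \<in> Hom A M N"
  shows "(\<lambda>x\<in>carrier M. \<ominus>\<^bsub>N\<^esub> f x) \<in> Hom A M N"
proof -
  interpret N: right_module A N by fact
  show ?thesis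
    using assms by (intro restrict_HomI) (auto simp: Hom_closed Hom_add Hom_smult N.smult_r_minus N.minus_add)
qed

lemma Hom_sub:
  assumes "right_module A M" "right_module A N" "f \<in> Hom A M N" "g \<in> Hom A M N"
  shows "(\<lambda>x\<in>carrier M. f x \<ominus>\<^bsub>N\<^esub> g x) \<in> Hom A M N"
  using Hom_plus[OF assms(1-3) Hom_uminus[OF assms(1,2,4)]]
  by (simp add: a_minus_def cong: restrict_cong)

lemma Hom_id: "right_module A M \<Longrightarrow> (\<lambda>x\<in>carrier M. x) \<in> Hom A M M"
  by (intro restrict_HomI) auto

lemma Hom_null:
  assumes "right_module A M" "right_module A N"
  shows "(\<lambda>x\<in>carrier M. \<zero>\<^bsub>N\<^esub>) \<in> Hom A M N"
proof -
  interpret N: right_module A N by fact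
  show ?thesis using assms by (intro restrict_HomI) auto
qed

lemma Hom_restrict:
  assumes "right_module A M" "submodule U A M" "f \<in> Hom A M N"
  shows "(\<lambda>x\<in>U. f x) \<in> Hom A (M\<lparr>carrier := U\<rparr>) N"
proof -
  interpret M: right_module A M by fact
  have "(\<lambda>x\<in>carrier (M\<lparr>carrier := U\<rparr>). f x) \<in> Hom A (M\<lparr>carrier := U\<rparr>) N"
    using assms(2) by (intro restrict_HomI submodule_right_module assms)
       (auto simp: M.submodule_iff subset_iff intro: Hom_closed[OF assms(3)] Hom_add[OF assms(3)] Hom_smult[OF assms(3)])
  then show ?thesis by simp
qed

lemma Hom_into_submodule:
  assumes "f \<in> Hom A M N" "f ` carrier M \<subseteq> U"
  shows "f \<in> Hom A M (N\<lparr>carrier := U\<rparr>)"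
  using assms by (intro HomI) (auto simp: Hom_add Hom_smult Hom_extensional)

lemma Hom_from_into_submodule:
  assumes "f \<in> Hom A M (N\<lparr>carrier := U\<rparr>)" "U \<subseteq> carrier N"
  shows "f \<in> Hom A M N"
  using assms Hom_closed[OF assms(1)] Hom_add[OF assms(1)] Hom_smult[OF assms(1)] Hom_extensional[OF assms(1)]
  by (intro HomI) auto

lemma a_kernel_eq: "a_kernel M N f = {x \<in> carrier M. f x = \<zero>\<^bsub>N\<^esub>}"
  by (simp add: a_kernel_def kernel_def)

lemma Hom_vimage_submodule:
  assumes "right_module A M" "right_module A N" "f \<in> Hom A M N" "submodule U A N"
  shows "submodule {x \<in> carrier M. f x \<in> U} A M"
proof -
  interpret M: right_module A M by fact
  interpret N: right_module A N by fact
  show ?thesis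
    using assms by (auto simp: M.submodule_iff N.submodule_iff Hom_add Hom_smult Hom_zero)
qed

lemma Hom_kernel_submodule:
  assumes "right_module A M" "right_module A N" "f \<in> Hom A M N"
  shows "submodule (a_kernel M N f) A M"
  using Hom_vimage_submodule[OF assms right_module.zero_submodule[OF assms(2)]]
  by (simp add: a_kernel_eq)

lemma Hom_image_submodule:
  assumes "right_module A M" "right_module A N" "f \<in> Hom A M N" "submodule U A M"
  shows "submodule (f ` U) A N"
proof -
  interpret M: right_module A M by fact
  interpret N: right_module A N by fact
  have U: "U \<subseteq> carrier M" "\<zero>\<^bsub>M\<^esub> \<in> U" using assms(4) by (auto simp: M.submodule_iff)
  { fix x y assume "x \<in> U" "y \<in> U"
    then have "f x \<oplus>\<^bsub>N\<^esub> f y = f (x \<oplus>\<^bsub>M\<^esub> y)" "x \<oplus>\<^bsub>M\<^esub> y \<in> U" 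
      using assms(3,4) U by (auto simp: Hom_add[OF assms(3)] M.submodule_iff subset_iff)
    then have "f x \<oplus>\<^bsub>N\<^esub> f y \<in> f ` U" by simp }
  moreover { fix a x assume "x \<in> U" "a \<in> carrier A"
    then have "a \<odot>\<^bsub>N\<^esub> f x = f (a \<odot>\<^bsub>M\<^esub> x)" "a \<odot>\<^bsub>M\<^esub> x \<in> U" 
      using assms(3,4) U by (auto simp: Hom_smult[OF assms(3)] M.submodule_iff subset_iff)
    then have "a \<odot>\<^bsub>N\<^esub> f x \<in> f ` U" by simp }
  moreover have "\<zero>\<^bsub>N\<^esub> \<in> f ` U" using U Hom_zero[OF assms(1-3)] by (metis imageI)
  ultimately show ?thesis
    using U by (auto simp: N.submodule_iff intro: Hom_closed[OF assms(3)])
qed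

lemma Hom_inj_on_iff:
  assumes "right_module A M" "right_module A N" "f \<in> Hom A M N"
  shows "inj_on f (carrier M) \<longleftrightarrow> (\<forall>x\<in>carrier M. f x = \<zero>\<^bsub>N\<^esub> \<longrightarrow> x = \<zero>\<^bsub>M\<^esub>)" (is "?l = ?r")
proof -
  interpret M: right_module A M by fact
  interpret N: right_module A N by fact
  show ?thesis
  proof
    assume ?l then show ?r using Hom_zero[OF assms] by (metis M.zero_closed inj_on_def)
  next
    assume r: ?r
    show ?l
    proof (rule inj_onI)
      fix x y assume xy: "x \<in> carrier M" "y \<in> carrier M" "f x = f y"
      then have "f (x \<ominus>\<^bsub>M\<^esub> y) = \<zero>\<^bsub>N\<^esub>"
        using Hom_diff[OF assms xy(1,2)] Hom_closed[OF assms(3)] by (simp add: N.minus_eq_zero_iff)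
      then show "x = y" using r xy M.minus_eq_zero_iff by (metis M.minus_closed)
    qed
  qed
qed

text \<open>The bare \<open>inv_into\<close> is not extensional, which membership in
  \<open>Hom\<close> requires; hence the restriction to \<open>carrier N\<close>.\<close>

lemma module_iso_inv:
  assumes "right_module A M" "right_module A N" "f \<in> module_iso A M N"
  shows "(\<lambda>y\<in>carrier N. inv_into (carrier M) f y) \<in> module_iso A N M"
proof -
  interpret M: right_module A M by fact
  interpret N: right_module A N by fact
  let ?g = "\<lambda>y\<in>carrier N. inv_into (carrier M) f y"
  have f: "f \<in> Hom A M N" and bij: "bij_betw f (carrier M) (carrier N)" 
    using assms(3) by (auto simp: module_iso_def)
  have gf: "inv_into (carrier M) f (f x) = x" if "x \<in> carrier M" for x
    using bij that Hom_closed[OF f] by (simp add: bij_betw_inv_into_left)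
  have surj: "\<exists>x\<in>carrier M. y = f x" if "y \<in> carrier N" for y
    using bij that by (auto simp: bij_betw_def)
  have bijg: "bij_betw ?g (carrier N) (carrier M)"
    using bij_betw_inv_into[OF bij] by (simp cong: bij_betw_cong)
  have "?g \<in> Hom A N M"
  proof (rule HomI)
    fix x y assume "x \<in> carrier N" "y \<in> carrier N"
    then obtain x' y' where "x' \<in> carrier M" "x = f x'" "y' \<in> carrier M" "y = f y'" using surj by metis
    then show "?g (x \<oplus>\<^bsub>N\<^esub> y) = ?g x \<oplus>\<^bsub>M\<^esub> ?g y"
      using gf by (simp add: Hom_closed[OF f] flip: Hom_add[OF f])
  next
    fix a x assume "a \<in> carrier A" "x \<in> carrier N"
    moreover from this obtain x' where "x' \<in> carrier M" "x = f x'" using surj by metis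
    ultimately show "?g (a \<odot>\<^bsub>N\<^esub> x) = a \<odot>\<^bsub>M\<^esub> ?g x"
      using gf by (simp add: Hom_closed[OF f] flip: Hom_smult[OF f])
  qed (use bijg in \<open>auto simp: bij_betw_def\<close>)
  then show ?thesis using bijg by (simp add: module_iso_def)
qed

section \<open>Finitely generated and projective modules\<close>

lemma right_module_regular: "ring A \<Longrightarrow> right_module A (regular_module A)"
proof -
  assume "ring A"
  then interpret ring A .
  have "abelian_group (regular_module A)"
    by (rule abelian_groupI) (auto simp: regular_module_def a_ac add.l_inv_ex)
  then show ?thesis
    by (auto simp: right_module_def right_module_axioms_def regular_module_def l_distr r_distr m_assoc ring_axioms)
qed

lemma regular_simps [simp]:
  "carrier (regular_module A) = carrier A" "zero (regular_module A) = zero A"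
  "add (regular_module A) = add A" "smult (regular_module A) = (\<lambda>a x. x \<otimes>\<^bsub>A\<^esub> a)"
  by (auto simp: regular_module_def)

section \<open>Finite sums, free modules and dual bases\<close>

context right_module
begin

lemma submodule_finsum:
  assumes "submodule N R M" "finite I" "\<And>i. i \<in> I \<Longrightarrow> g i \<in> N"
  shows "finsum M g I \<in> N"
  using assms(2,3)
proof (induction I rule: finite_induct)
  case empty then show ?case using assms(1) by (simp add: submodule_iff)
next
  case (insert i I)
  have N: "N \<subseteq> carrier M" using assms(1) by (simp add: submodule_iff)
  have "g \<in> I \<rightarrow> carrier M" "g i \<in> carrier M" using insert N by auto
  then show ?case using insert assms(1) by (simp add: submodule_iff)
qed

lemma smult_finsum:
  assumes "finite I" "\<And>i. i \<in> I \<Longrightarrow> g i \<in> carrier M" "a \<in> carrier R"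
  shows "a \<odot>\<^bsub>M\<^esub> finsum M g I = finsum M (\<lambda>i. a \<odot>\<^bsub>M\<^esub> g i) I"
  using assms(1,2)
proof (induction I rule: finite_induct)
  case (insert i I)
  have "g \<in> I \<rightarrow> carrier M" "g i \<in> carrier M" "(\<lambda>i. a \<odot>\<^bsub>M\<^esub> g i) \<in> I \<rightarrow> carrier M"
    using insert assms(3) by auto
  then show ?case using insert assms(3) by (simp add: smult_r_distr)
qed (simp add: assms(3))

end

lemma Hom_finsum:
  assumes "right_module A M" "right_module A N" "f \<in> Hom A M N"
    "finite I" "\<And>i. i \<in> I \<Longrightarrow> g i \<in> carrier M"
  shows "f (finsum M g I) = finsum N (\<lambda>i. f (g i)) I"
proof -
  interpret M: right_module A M by fact
  interpret N: right_module A N by fact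
  show ?thesis using assms(4,5)
  proof (induction I rule: finite_induct)
    case empty then show ?case using Hom_zero[OF assms(1-3)] by simp
  next
    case (insert i I)
    have "g \<in> I \<rightarrow> carrier M" "g i \<in> carrier M" "(\<lambda>i. f (g i)) \<in> I \<rightarrow> carrier N" "f (g i) \<in> carrier N"
      using insert Hom_closed[OF assms(3)] by auto
    then show ?case using insert by (simp add: Hom_add[OF assms(3)])
  qed
qed

lemma Hom_inclusion:
  assumes "right_module A M" "submodule U A M"
  shows "(\<lambda>x\<in>U. x) \<in> Hom A (M\<lparr>carrier := U\<rparr>) M"
proof -
  interpret M: right_module A M by fact
  have "U \<subseteq> carrier M" using assms(2) by (simp add: M.submodule_iff)
  then have "(\<lambda>x\<in>carrier (M\<lparr>carrier := U\<rparr>). x) \<in> Hom A (M\<lparr>carrier := U\<rparr>) M"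
    by (intro restrict_HomI submodule_right_module assms) auto
  then show ?thesis by simp
qed

text \<open>Lifts along surjections and maps out of free modules are of this form. It is linear
  because \<open>\<phi> i (a \<odot> x)\<close> is \<open>\<phi> i x\<close> times \<open>a\<close>
  on the right, and the factor \<open>a\<close> then acts last on \<open>m i\<close>.\<close>

lemma Hom_lincomb:
  assumes "right_module A P" "right_module A M" "finite I"
    "\<And>i. i \<in> I \<Longrightarrow> \<phi> i \<in> Hom A P (regular_module A)" "\<And>i. i \<in> I \<Longrightarrow> m i \<in> carrier M"
  shows "(\<lambda>x\<in>carrier P. finsum M (\<lambda>i. \<phi> i x \<odot>\<^bsub>M\<^esub> m i) I) \<in> Hom A P M"
proof -
  interpret P: right_module A P by fact
  interpret M: right_module A M by fact
  have \<phi>: "\<phi> i x \<in> carrier A" if "i \<in> I" "x \<in> carrier P" for i x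
    using Hom_closed[OF assms(4)[OF that(1)] that(2)] by simp
  show ?thesis
  proof (rule restrict_HomI[OF assms(1)])
    fix x y assume xy: "x \<in> carrier P" "y \<in> carrier P"
    have "finsum M (\<lambda>i. \<phi> i (x \<oplus>\<^bsub>P\<^esub> y) \<odot>\<^bsub>M\<^esub> m i) I
        = finsum M (\<lambda>i. \<phi> i x \<odot>\<^bsub>M\<^esub> m i \<oplus>\<^bsub>M\<^esub> \<phi> i y \<odot>\<^bsub>M\<^esub> m i) I"
      using xy \<phi> assms(5) Hom_add[OF assms(4)] by (intro M.finsum_cong') (auto simp: M.smult_l_distr)
    also have "\<dots> = finsum M (\<lambda>i. \<phi> i x \<odot>\<^bsub>M\<^esub> m i) I \<oplus>\<^bsub>M\<^esub> finsum M (\<lambda>i. \<phi> i y \<odot>\<^bsub>M\<^esub> m i) I"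
      using xy \<phi> assms(5) by (intro M.finsum_addf) auto
    finally show "finsum M (\<lambda>i. \<phi> i (x \<oplus>\<^bsub>P\<^esub> y) \<odot>\<^bsub>M\<^esub> m i) I =
      finsum M (\<lambda>i. \<phi> i x \<odot>\<^bsub>M\<^esub> m i) I \<oplus>\<^bsub>M\<^esub> finsum M (\<lambda>i. \<phi> i y \<odot>\<^bsub>M\<^esub> m i) I" .
  next
    fix a x assume ax: "a \<in> carrier A" "x \<in> carrier P"
    have "finsum M (\<lambda>i. \<phi> i (a \<odot>\<^bsub>P\<^esub> x) \<odot>\<^bsub>M\<^esub> m i) I = finsum M (\<lambda>i. a \<odot>\<^bsub>M\<^esub> (\<phi> i x \<odot>\<^bsub>M\<^esub> m i)) I"
      using ax \<phi> assms(5) Hom_smult[OF assms(4)] by (intro M.finsum_cong') (auto simp: M.smult_assoc)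
    then show "finsum M (\<lambda>i. \<phi> i (a \<odot>\<^bsub>P\<^esub> x) \<odot>\<^bsub>M\<^esub> m i) I = a \<odot>\<^bsub>M\<^esub> finsum M (\<lambda>i. \<phi> i x \<odot>\<^bsub>M\<^esub> m i) I"
      using ax \<phi> assms(3,5) by (simp add: M.smult_finsum)
  qed (use \<phi> assms(5) in \<open>auto intro!: M.finsum_closed\<close>)
qed

text \<open>The elements are extensional on \<open>{..<n}\<close>, so that equality is equality of
  coordinates, and their type is the one on which \<open>proj_cover\<close> chooses its
  modules.\<close>

definition free_module :: "('a, 'r) ring_scheme \<Rightarrow> nat \<Rightarrow> ('a, nat \<Rightarrow> 'a) module" where
  "free_module A n =
    \<lparr>carrier = {..<n} \<rightarrow>\<^sub>E carrier A, mult = undefined, one = undefined,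
     zero = (\<lambda>i\<in>{..<n}. \<zero>\<^bsub>A\<^esub>), add = (\<lambda>f g. \<lambda>i\<in>{..<n}. f i \<oplus>\<^bsub>A\<^esub> g i),
     smult = (\<lambda>a f. \<lambda>i\<in>{..<n}. f i \<otimes>\<^bsub>A\<^esub> a)\<rparr>"

lemma free_simps [simp]:
  "carrier (free_module A n) = {..<n} \<rightarrow>\<^sub>E carrier A"
  "zero (free_module A n) = (\<lambda>i\<in>{..<n}. \<zero>\<^bsub>A\<^esub>)"
  "add (free_module A n) = (\<lambda>f g. \<lambda>i\<in>{..<n}. f i \<oplus>\<^bsub>A\<^esub> g i)"
  "smult (free_module A n) = (\<lambda>a f. \<lambda>i\<in>{..<n}. f i \<otimes>\<^bsub>A\<^esub> a)"
  by (auto simp: free_module_def)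

lemma right_module_free:
  assumes "ring A" shows "right_module A (free_module A n)"
proof -
  interpret ring A by fact
  let ?F = "free_module A n"
  have mem: "f i \<in> carrier A" if "f \<in> carrier ?F" "i < n" for f :: "nat \<Rightarrow> 'a" and i
    using that by auto
  have arb: "f i = undefined" if "f \<in> carrier ?F" "\<not> i < n" for f :: "nat \<Rightarrow> 'a" and i
    using that by auto
  note eqs = fun_eq_iff restrict_def
  have "abelian_group ?F"
  proof (rule abelian_groupI)
    fix x assume x': "x \<in> carrier ?F"
    note m = mem[OF x'] arb[OF x']
    show "\<exists>y\<in>carrier ?F. y \<oplus>\<^bsub>?F\<^esub> x = \<zero>\<^bsub>?F\<^esub>"
      by (intro bexI[of _ "\<lambda>i\<in>{..<n}. \<ominus>\<^bsub>A\<^esub> x i"]) (auto simp: l_neg m intro!: restrict_ext)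
  next
    fix x y assume x': "x \<in> carrier ?F" and y': "y \<in> carrier ?F"
    note m = mem[OF x'] arb[OF x'] mem[OF y'] arb[OF y']
    show "x \<oplus>\<^bsub>?F\<^esub> y \<in> carrier ?F" by (auto simp: m)
  next
    fix x y assume x': "x \<in> carrier ?F" and y': "y \<in> carrier ?F"
    note m = mem[OF x'] arb[OF x'] mem[OF y'] arb[OF y']
    show "x \<oplus>\<^bsub>?F\<^esub> y = y \<oplus>\<^bsub>?F\<^esub> x" by (simp add: m eqs a_comm)
  next
    fix x y z assume x': "x \<in> carrier ?F" and y': "y \<in> carrier ?F" and z': "z \<in> carrier ?F"
    note m = mem[OF x'] arb[OF x'] mem[OF y'] arb[OF y'] mem[OF z'] arb[OF z']
    show "x \<oplus>\<^bsub>?F\<^esub> y \<oplus>\<^bsub>?F\<^esub> z = x \<oplus>\<^bsub>?F\<^esub> (y \<oplus>\<^bsub>?F\<^esub> z)"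
      by (simp add: m eqs a_assoc)
  next
    fix x assume x': "x \<in> carrier ?F"
    note m = mem[OF x'] arb[OF x']
    show "\<zero>\<^bsub>?F\<^esub> \<oplus>\<^bsub>?F\<^esub> x = x" by (simp add: m eqs)
  qed auto
  moreover have "right_module_axioms A ?F"
  proof
    fix a x assume ab: "a \<in> carrier A" and x': "x \<in> carrier ?F"
    note m = mem[OF x'] arb[OF x']
    show "a \<odot>\<^bsub>?F\<^esub> x \<in> carrier ?F" by (auto simp: m ab)
  next
    fix a b x assume ab: "a \<in> carrier A" "b \<in> carrier A" and x': "x \<in> carrier ?F"
    note m = mem[OF x'] arb[OF x']
    show "(a \<oplus>\<^bsub>A\<^esub> b) \<odot>\<^bsub>?F\<^esub> x = a \<odot>\<^bsub>?F\<^esub> x \<oplus>\<^bsub>?F\<^esub> b \<odot>\<^bsub>?F\<^esub> x"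
      by (simp add: m eqs ab r_distr)
  next
    fix a x y assume ab: "a \<in> carrier A" and x': "x \<in> carrier ?F" and y': "y \<in> carrier ?F"
    note m = mem[OF x'] arb[OF x'] mem[OF y'] arb[OF y']
    show "a \<odot>\<^bsub>?F\<^esub> (x \<oplus>\<^bsub>?F\<^esub> y) = a \<odot>\<^bsub>?F\<^esub> x \<oplus>\<^bsub>?F\<^esub> a \<odot>\<^bsub>?F\<^esub> y"
      by (simp add: m eqs ab l_distr)
  next
    fix a b x assume ab: "a \<in> carrier A" "b \<in> carrier A" and x': "x \<in> carrier ?F"
    note m = mem[OF x'] arb[OF x']
    show "(a \<otimes>\<^bsub>A\<^esub> b) \<odot>\<^bsub>?F\<^esub> x = b \<odot>\<^bsub>?F\<^esub> (a \<odot>\<^bsub>?F\<^esub> x)"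
      by (simp add: m eqs ab m_assoc)
  next
    fix x assume x': "x \<in> carrier ?F"
    note m = mem[OF x'] arb[OF x']
    show "\<one>\<^bsub>A\<^esub> \<odot>\<^bsub>?F\<^esub> x = x" by (simp add: m eqs)
  qed
  ultimately show ?thesis
    using ring_axioms by (simp add: right_module_def)
qed

text \<open>Existence of a dual basis is projectivity without reference to test modules, so it gives
  lifting along surjections between modules on arbitrary types.\<close>

definition dual_basis :: "('a, 'r) ring_scheme \<Rightarrow> ('a, 'm, 'e) module_scheme \<Rightarrow> nat \<Rightarrow>
    (nat \<Rightarrow> 'm) \<Rightarrow> (nat \<Rightarrow> 'm \<Rightarrow> 'a) \<Rightarrow> bool" where
  "dual_basis A P n e \<phi> \<longleftrightarrow> (\<forall>i<n. e i \<in> carrier P \<and> \<phi> i \<in> Hom A P (regular_module A)) \<and>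
    (\<forall>x\<in>carrier P. x = finsum P (\<lambda>i. \<phi> i x \<odot>\<^bsub>P\<^esub> e i) {..<n})"

lemma coordinate_Hom:
  assumes "ring A" "i < n"
  shows "(\<lambda>f\<in>carrier (free_module A n). f i) \<in> Hom A (free_module A n) (regular_module A)"
  using assms by (intro restrict_HomI right_module_free) auto

text \<open>The expansion in unit vectors is verified one coordinate at a time, a coordinate being a
  homomorphism that passes through the finite sum.\<close>

lemma dual_basis_free:
  assumes "ring A"
  shows "dual_basis A (free_module A n) n (\<lambda>i. \<lambda>j\<in>{..<n}. if i = j then \<one>\<^bsub>A\<^esub> else \<zero>\<^bsub>A\<^esub>)
    (\<lambda>i. \<lambda>f\<in>carrier (free_module A n). f i)"
proof -
  interpret ring A by fact
  interpret F: right_module A "free_module A n" using right_module_free[OF assms] .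
  interpret AA: right_module A "regular_module A" using right_module_regular[OF assms] .
  let ?e = "\<lambda>i. \<lambda>j\<in>{..<n}. if i = j then \<one>\<^bsub>A\<^esub> else \<zero>\<^bsub>A\<^esub>"
  have e: "?e i \<in> carrier (free_module A n)" for i by auto
  have "f = finsum (free_module A n) (\<lambda>i. f i \<odot>\<^bsub>free_module A n\<^esub> ?e i) {..<n}" (is "f = ?s")
    if f: "f \<in> carrier (free_module A n)" for f
  proof -
    have fi: "f i \<in> carrier A" if "i < n" for i using f that by auto
    have *: "f i \<odot>\<^bsub>free_module A n\<^esub> ?e i \<in> carrier (free_module A n)" if "i \<in> {..<n}" for i
      using fi[of i] e that F.smult_closed by blast
    have s: "?s \<in> carrier (free_module A n)" using * by (intro F.finsum_closed) auto
    have "f j = ?s j" if j: "j < n" for j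
    proof -
      have "?s j = (\<lambda>f\<in>carrier (free_module A n). f j) ?s" using s by auto
      also have "\<dots> = finsum (regular_module A)
        (\<lambda>i. (\<lambda>f\<in>carrier (free_module A n). f j) (f i \<odot>\<^bsub>free_module A n\<^esub> ?e i)) {..<n}"
        by (intro Hom_finsum[OF F.right_module_axioms AA.right_module_axioms] coordinate_Hom assms j *) auto
      also have "\<dots> = finsum (regular_module A) (\<lambda>i. if j = i then f i else \<zero>\<^bsub>regular_module A\<^esub>) {..<n}"
        using * j fi by (intro AA.finsum_cong') auto
      also have "\<dots> = f j" using j fi by (subst AA.finsum_singleton) auto
      finally show ?thesis by simp
    qed
    then show ?thesis using f s by (intro PiE_ext[of _ "{..<n}" "\<lambda>_. carrier A"]) auto
  qed
  then show ?thesis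
    unfolding dual_basis_def using e coordinate_Hom[OF assms] by simp
qed

lemma fg_moduleD: "fg_module A M \<Longrightarrow> right_module A M"
  by (simp add: fg_module_def)

lemma lincomb_Hom:
  fixes n :: nat
  assumes "right_module A M" "\<And>i. i < n \<Longrightarrow> m i \<in> carrier M"
  shows "(\<lambda>c\<in>carrier (free_module A n). finsum M (\<lambda>i. c i \<odot>\<^bsub>M\<^esub> m i) {..<n}) \<in> Hom A (free_module A n) M"
proof -
  interpret M: right_module A M by fact
  have R: "ring A" by (rule M.R.ring_axioms)
  have "(\<lambda>c\<in>carrier (free_module A n). finsum M (\<lambda>i. (\<lambda>f\<in>carrier (free_module A n). f i) c \<odot>\<^bsub>M\<^esub> m i) {..<n})
      \<in> Hom A (free_module A n) M"
    using assms R by (intro Hom_lincomb right_module_free coordinate_Hom) auto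
  then show ?thesis by (simp cong: restrict_cong)
qed

text \<open>The combinations of the generators form a submodule, as the image of a free module, and
  unit vectors show that it contains the generators; so it is the whole module. Conversely a
  submodule with the generators contains all their combinations.\<close>

lemma fg_module_iff_generators:
  "fg_module A M \<longleftrightarrow> right_module A M \<and> (\<exists>(n::nat) m. (\<forall>i<n. m i \<in> carrier M) \<and>
    (\<forall>x\<in>carrier M. \<exists>c\<in>{..<n} \<rightarrow>\<^sub>E carrier A. x = finsum M (\<lambda>i. c i \<odot>\<^bsub>M\<^esub> m i) {..<n}))" (is "?l = ?r")
proof
  assume ?l
  then obtain S where M: "right_module A M" and S: "finite S" "S \<subseteq> carrier M"
    and gen: "\<forall>N. submodule N A M \<and> S \<subseteq> N \<longrightarrow> N = carrier M"
    unfolding fg_module_def by (elim conjE exE)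
  interpret M: right_module A M by fact
  have R: "ring A" by (rule M.R.ring_axioms)
  obtain xs where xs: "set xs = S" using finite_list[OF S(1)] by blast
  define n where "n = length xs"
  have m: "xs ! i \<in> carrier M" if "i < n" for i using that S(2) xs n_def by auto
  let ?l = "\<lambda>c\<in>carrier (free_module A n). finsum M (\<lambda>i. c i \<odot>\<^bsub>M\<^esub> xs ! i) {..<n}"
  have l: "?l \<in> Hom A (free_module A n) M" using lincomb_Hom[OF M m] .
  have sub: "submodule (?l ` carrier (free_module A n)) A M"
    by (intro Hom_image_submodule[OF right_module_free[OF R] M l] right_module.carrier_submodule right_module_free R)
  have "S \<subseteq> ?l ` carrier (free_module A n)"
  proof
    fix x assume "x \<in> S"
    then obtain j where j: "j < n" "x = xs ! j" using xs n_def by (metis in_set_conv_nth)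
    let ?e = "\<lambda>i\<in>{..<n}. if j = i then \<one>\<^bsub>A\<^esub> else \<zero>\<^bsub>A\<^esub>"
    have "?l ?e = finsum M (\<lambda>i. ?e i \<odot>\<^bsub>M\<^esub> xs ! i) {..<n}" by (simp del: restrict_apply) auto
    also have "\<dots> = finsum M (\<lambda>i. if j = i then xs ! i else \<zero>\<^bsub>M\<^esub>) {..<n}"
      using m by (intro M.finsum_cong') auto
    also have "\<dots> = x" using j m by (subst M.finsum_singleton) auto
    finally have "x = ?l ?e" by simp
    moreover have "?e \<in> carrier (free_module A n)" by auto
    ultimately show "x \<in> ?l ` carrier (free_module A n)" by (rule image_eqI)
  qed
  then have "?l ` carrier (free_module A n) = carrier M" by (rule gen[rule_format, OF conjI, OF sub])
  then have gen: "\<forall>x\<in>carrier M. \<exists>c\<in>{..<n} \<rightarrow>\<^sub>E carrier A. x = finsum M (\<lambda>i. c i \<odot>\<^bsub>M\<^esub> xs ! i) {..<n}"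
    by (auto simp: image_iff)
  show ?r
    by (intro conjI exI[of _ n] exI[of _ "\<lambda>i. xs ! i"] M gen) (use m in auto)
next
  assume ?r
  then obtain n :: nat and m where M: "right_module A M" and m: "\<forall>i<n. m i \<in> carrier M"
    and x: "\<forall>x\<in>carrier M. \<exists>c\<in>{..<n} \<rightarrow>\<^sub>E carrier A. x = finsum M (\<lambda>i. c i \<odot>\<^bsub>M\<^esub> m i) {..<n}"
    by (elim conjE exE)
  interpret M: right_module A M by fact
  have "N = carrier M" if N: "submodule N A M" "m ` {..<n} \<subseteq> N" for N
  proof
    show "N \<subseteq> carrier M" using N by (simp add: M.submodule_iff)
    show "carrier M \<subseteq> N"
    proof
      fix y assume "y \<in> carrier M"
      then obtain c where c: "c \<in> {..<n} \<rightarrow>\<^sub>E carrier A" and y: "y = finsum M (\<lambda>i. c i \<odot>\<^bsub>M\<^esub> m i) {..<n}" using x by blast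
      show "y \<in> N" unfolding y proof (intro M.submodule_finsum N(1) finite_lessThan)
        fix i assume "i \<in> {..<n}"
        then have "c i \<in> carrier A" "m i \<in> N" using N(2) c by auto
        then show "c i \<odot>\<^bsub>M\<^esub> m i \<in> N" using N(1) by (simp add: M.submodule_iff)
      qed
    qed
  qed
  then show ?l unfolding fg_module_def using M m by (intro conjI exI[of _ "m ` {..<n}"]) auto
qed

lemma dual_basisD:
  assumes "dual_basis A P n e \<phi>"
  shows "i < n \<Longrightarrow> e i \<in> carrier P" "i < n \<Longrightarrow> \<phi> i \<in> Hom A P (regular_module A)"
    "x \<in> carrier P \<Longrightarrow> finsum P (\<lambda>i. \<phi> i x \<odot>\<^bsub>P\<^esub> e i) {..<n} = x"
    "i < n \<Longrightarrow> x \<in> carrier P \<Longrightarrow> \<phi> i x \<in> carrier A"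
  using assms Hom_closed[of "\<phi> i" A P "regular_module A" x] by (auto simp: dual_basis_def)

text \<open>Choose \<open>m i\<close> over \<open>f (e i)\<close> and send \<open>x\<close> to the
  combination of the \<open>m i\<close> with the coordinates \<open>\<phi> i x\<close>. Asking only
  that \<open>g\<close> reaches the values of \<open>f\<close> spares replacing the target by an
  image submodule when resolutions are compared.\<close>

lemma dual_basis_lift:
  assumes "right_module A P" "dual_basis A P n e \<phi>" "right_module A M" "right_module A N"
    "g \<in> Hom A M N" "f \<in> Hom A P N" "f ` carrier P \<subseteq> g ` carrier M"
  shows "\<exists>h\<in>Hom A P M. \<forall>x\<in>carrier P. g (h x) = f x"
proof -
  interpret P: right_module A P by fact
  interpret M: right_module A M by fact
  interpret N: right_module A N by fact
  note db = dual_basisD[OF assms(2)]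
  have "\<forall>i\<in>{..<n}. \<exists>m\<in>carrier M. g m = f (e i)"
    using assms(7) db(1) by (metis image_iff image_subset_iff lessThan_iff)
  then obtain m where m: "\<And>i. i < n \<Longrightarrow> m i \<in> carrier M" "\<And>i. i < n \<Longrightarrow> g (m i) = f (e i)"
    by (metis lessThan_iff)
  let ?h = "\<lambda>x\<in>carrier P. finsum M (\<lambda>i. \<phi> i x \<odot>\<^bsub>M\<^esub> m i) {..<n}"
  have "g (?h x) = f x" if x: "x \<in> carrier P" for x
  proof -
    have "g (?h x) = finsum N (\<lambda>i. g (\<phi> i x \<odot>\<^bsub>M\<^esub> m i)) {..<n}"
      using x m db by (subst restrict_apply', simp, intro Hom_finsum[OF assms(3,4,5)]) auto
    also have "\<dots> = finsum N (\<lambda>i. f (\<phi> i x \<odot>\<^bsub>P\<^esub> e i)) {..<n}"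
      using x m db Hom_closed[OF assms(6)]
      by (intro N.finsum_cong') (auto simp: Hom_smult[OF assms(5)] Hom_smult[OF assms(6)])
    also have "\<dots> = f (finsum P (\<lambda>i. \<phi> i x \<odot>\<^bsub>P\<^esub> e i) {..<n})"
      using x db(1,4) by (intro Hom_finsum[OF assms(1,4,6), symmetric]) auto
    also have "\<dots> = f x" using x db(3) by simp
    finally show ?thesis .
  qed
  moreover have "?h \<in> Hom A P M" using assms m db by (intro Hom_lincomb) auto
  ultimately show ?thesis by blast
qed

lemma dual_basis_fg:
  assumes "right_module A P" "dual_basis A P n e \<phi>" shows "fg_module A P"
  unfolding fg_module_iff_generators
proof (intro conjI exI allI ballI impI)
  fix x assume x: "x \<in> carrier P"
  interpret P: right_module A P by fact
  have "x = finsum P (\<lambda>i. (\<lambda>i\<in>{..<n}. \<phi> i x) i \<odot>\<^bsub>P\<^esub> e i) {..<n}"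
    using dual_basisD[OF assms(2)] x by (subst dual_basisD(3)[OF assms(2) x, symmetric], intro P.finsum_cong') auto
  then show "\<exists>c\<in>{..<n} \<rightarrow>\<^sub>E carrier A. x = finsum P (\<lambda>i. c i \<odot>\<^bsub>P\<^esub> e i) {..<n}"
    using dual_basisD(4)[OF assms(2)] x by (intro bexI[of _ "\<lambda>i\<in>{..<n}. \<phi> i x"]) auto
qed (use dual_basisD(1)[OF assms(2)] assms in auto)

lemma dual_basis_projective:
  assumes "right_module A P" "dual_basis A P n e \<phi>" shows "fg_projective A P"
  unfolding fg_projective_def
proof (intro conjI allI impI)
  show "fg_module A P" using dual_basis_fg[OF assms] .
next
  fix M :: "('a, (nat \<Rightarrow> 'a) set) module" and N :: "('a, (nat \<Rightarrow> 'a) set) module" and g f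
  assume *: "right_module A M \<and> right_module A N \<and>
      g \<in> Hom A M N \<and> g ` carrier M = carrier N \<and> f \<in> Hom A P N"
  then have "f ` carrier P \<subseteq> g ` carrier M" using Hom_closed[of f A P N] by auto
  then show "\<exists>h\<in>Hom A P M. \<forall>x\<in>carrier P. g (h x) = f x"
    using dual_basis_lift[OF assms, of M N g f] * by blast
qed

text \<open>Transport along an injection: the lifting and extension properties in the definitions of
  projective and injective modules are only assumed for modules on one particular type.\<close>

definition copy_module :: "('m \<Rightarrow> 'b) \<Rightarrow> ('a, 'm, 'e) module_scheme \<Rightarrow> ('a, 'b) module" where
  "copy_module i M =
    \<lparr>carrier = i ` carrier M, mult = undefined, one = undefined, zero = i \<zero>\<^bsub>M\<^esub>,
     add = (\<lambda>x y. i (inv_into (carrier M) i x \<oplus>\<^bsub>M\<^esub> inv_into (carrier M) i y)),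
     smult = (\<lambda>a x. i (a \<odot>\<^bsub>M\<^esub> inv_into (carrier M) i x))\<rparr>"

lemma copy_module:
  assumes "right_module A M" "inj_on i (carrier M)"
  shows "right_module A (copy_module i M)" "(\<lambda>x\<in>carrier M. i x) \<in> module_iso A M (copy_module i M)"
proof -
  show "right_module A (copy_module i M)"
    using assms by (intro right_moduleI_image[OF assms(1), of i]) (auto simp: copy_module_def)
  have "(\<lambda>x\<in>carrier M. i x) \<in> Hom A M (copy_module i M)"
    using assms by (intro restrict_HomI) (auto simp: copy_module_def)
  moreover have "bij_betw (\<lambda>x\<in>carrier M. i x) (carrier M) (carrier (copy_module i M))"
    using assms by (auto simp: bij_betw_def copy_module_def)
  ultimately show "(\<lambda>x\<in>carrier M. i x) \<in> module_iso A M (copy_module i M)"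
    by (simp add: module_iso_def)
qed

text \<open>An element is represented by the set of its coordinate vectors.\<close>

lemma fg_module_small:
  fixes M :: "('a, 'm, 'e) module_scheme"
  assumes "fg_module A M"
  shows "\<exists>i :: 'm \<Rightarrow> (nat \<Rightarrow> 'a) set. inj_on i (carrier M)"
proof -
  from assms obtain n :: nat and m
    where x: "\<forall>x\<in>carrier M. \<exists>c\<in>{..<n} \<rightarrow>\<^sub>E carrier A. x = finsum M (\<lambda>i. c i \<odot>\<^bsub>M\<^esub> m i) {..<n}"
    unfolding fg_module_iff_generators by (elim conjE exE)
  have "inj_on (\<lambda>x. {c :: nat \<Rightarrow> 'a. x = finsum M (\<lambda>i. c i \<odot>\<^bsub>M\<^esub> m i) {..<n}}) (carrier M)"
  proof (rule inj_onI)
    fix x y assume "x \<in> carrier M" and eq: "{c. x = finsum M (\<lambda>i. c i \<odot>\<^bsub>M\<^esub> m i) {..<n}} = {c. y = finsum M (\<lambda>i. c i \<odot>\<^bsub>M\<^esub> m i) {..<n}}"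
    then obtain c where "x = finsum M (\<lambda>i. c i \<odot>\<^bsub>M\<^esub> m i) {..<n}" using x by blast
    then have "c \<in> {c. y = finsum M (\<lambda>i. c i \<odot>\<^bsub>M\<^esub> m i) {..<n}}" "x = finsum M (\<lambda>i. c i \<odot>\<^bsub>M\<^esub> m i) {..<n}"
      unfolding eq[symmetric] by simp_all
    then show "x = y" by simp
  qed
  then show ?thesis by blast
qed

lemma image_restrict_comp: "(\<lambda>x\<in>S. g (f x)) ` S = g ` f ` S"
  by (auto simp: image_iff)

text \<open>The map \<open>l\<close> from a free module onto \<open>P\<close> should split, but
  lifting is available only on the type of sets of vectors. So the free module is copied there by
  singletons and \<open>P\<close> by \<open>fg_module_small\<close>; the section found for the
  copies is carried back, and its coordinates are the functionals of the dual basis.\<close>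

lemma projective_dual_basis:
  fixes P :: "('a, 'p, 'e) module_scheme"
  assumes "fg_projective A P" shows "\<exists>n e \<phi>. dual_basis A P n e \<phi>"
proof -
  have fg: "fg_module A P" using assms by (simp add: fg_projective_def)
  then interpret P: right_module A P by (rule fg_moduleD)
  have R: "ring A" by (rule P.R.ring_axioms)
  from fg obtain n :: nat and m where m: "\<forall>i<n. m i \<in> carrier P"
    and gen: "\<forall>x\<in>carrier P. \<exists>c\<in>{..<n} \<rightarrow>\<^sub>E carrier A. x = finsum P (\<lambda>i. c i \<odot>\<^bsub>P\<^esub> m i) {..<n}"
    unfolding fg_module_iff_generators by (elim conjE exE)
  let ?F = "free_module A n"
  define l where "l = (\<lambda>c\<in>carrier ?F. finsum P (\<lambda>i. c i \<odot>\<^bsub>P\<^esub> m i) {..<n})"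
  have l: "l \<in> Hom A ?F P" unfolding l_def by (rule lincomb_Hom) (use m P.right_module_axioms in auto)
  have lsurj: "\<exists>c\<in>carrier ?F. l c = x" if "x \<in> carrier P" for x
    using gen[rule_format, OF that] by (auto simp: l_def)
  interpret F: right_module A ?F by (rule right_module_free[OF R])
  obtain i :: "'p \<Rightarrow> (nat \<Rightarrow> 'a) set" where i: "inj_on i (carrier P)" using fg_module_small[OF fg] by blast
  let ?s = "\<lambda>c :: nat \<Rightarrow> 'a. {c}"
  have s: "inj_on ?s (carrier ?F)" by (auto simp: inj_on_def)
  note cP = copy_module[OF P.right_module_axioms i] and cF = copy_module[OF F.right_module_axioms s]
  let ?t = "\<lambda>y\<in>carrier (copy_module ?s ?F). inv_into (carrier ?F) (\<lambda>x\<in>carrier ?F. ?s x) y"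
  have t: "?t \<in> module_iso A (copy_module ?s ?F) ?F"
    using module_iso_inv[OF F.right_module_axioms cF] .
  have tH: "?t \<in> Hom A (copy_module ?s ?F) ?F" using t by (simp add: module_iso_def)
  have iH: "(\<lambda>x\<in>carrier P. i x) \<in> Hom A P (copy_module i P)" using cP by (simp add: module_iso_def)
  have ilH: "(\<lambda>c\<in>carrier ?F. (\<lambda>x\<in>carrier P. i x) (l c)) \<in> Hom A ?F (copy_module i P)" (is "?il \<in> _")
    using Hom_comp[OF F.right_module_axioms l iH] .
  have gH: "(\<lambda>y\<in>carrier (copy_module ?s ?F). ?il (?t y)) \<in> Hom A (copy_module ?s ?F) (copy_module i P)" (is "?g \<in> _")
    using Hom_comp[OF cF(1) tH ilH] .
  have tsurj: "?t ` carrier (copy_module ?s ?F) = carrier ?F" using t by (auto simp: module_iso_def bij_betw_def)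
  have "?g ` carrier (copy_module ?s ?F) = ?il ` (?t ` carrier (copy_module ?s ?F))"
    by (rule image_restrict_comp)
  also have "\<dots> = (\<lambda>x\<in>carrier P. i x) ` (l ` carrier ?F)"
    unfolding tsurj by (rule image_restrict_comp)
  also have "l ` carrier ?F = carrier P" using lsurj Hom_closed[OF l] by blast
  also have "(\<lambda>x\<in>carrier P. i x) ` carrier P = carrier (copy_module i P)" by (simp add: copy_module_def)
  finally have gs: "?g ` carrier (copy_module ?s ?F) = carrier (copy_module i P)" .
  obtain h where h: "h \<in> Hom A P (copy_module ?s ?F)" and gh: "\<And>x. x \<in> carrier P \<Longrightarrow> ?g (h x) = (\<lambda>x\<in>carrier P. i x) x"
    using assms[unfolded fg_projective_def, THEN conjunct2, rule_format, OF conjI[OF cF(1) conjI[OF cP(1) conjI[OF gH conjI[OF gs iH]]]]]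
    by blast
  let ?h = "\<lambda>x\<in>carrier P. ?t (h x)"
  have hH: "?h \<in> Hom A P ?F" using Hom_comp[OF P.right_module_axioms h tH] .
  have lh: "l (?h x) = x" if x: "x \<in> carrier P" for x
  proof -
    have "?t (h x) \<in> carrier ?F" using Hom_closed[OF hH x] x by simp
    then have "i (l (?t (h x))) = i x"
      using gh[OF x] x Hom_closed[OF h x] Hom_closed[OF l] by simp
    then show ?thesis using i x Hom_closed[OF l Hom_closed[OF hH x]] by (simp add: inj_on_def)
  qed
  let ?\<phi> = "\<lambda>i. \<lambda>x\<in>carrier P. (\<lambda>c\<in>carrier ?F. c i) (?h x)"
  have \<phi>: "?\<phi> i \<in> Hom A P (regular_module A)" if "i < n" for i
    using Hom_comp[OF P.right_module_axioms hH coordinate_Hom[OF R that]] .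
  have "x = finsum P (\<lambda>i. ?\<phi> i x \<odot>\<^bsub>P\<^esub> m i) {..<n}" if x: "x \<in> carrier P" for x
  proof -
    have hx: "?h x \<in> carrier ?F" using Hom_closed[OF hH x] .
    then have "x = finsum P (\<lambda>i. ?h x i \<odot>\<^bsub>P\<^esub> m i) {..<n}" using lh[OF x] by (simp only: l_def restrict_apply if_True)
    moreover have "?\<phi> i x = ?h x i" for i using hx x by simp
    ultimately show ?thesis by simp
  qed
  then have "dual_basis A P n m ?\<phi>" unfolding dual_basis_def using m \<phi> by blast
  then show ?thesis by blast
qed

lemma projectiveD: "fg_projective A P \<Longrightarrow> fg_module A P" "fg_projective A P \<Longrightarrow> right_module A P"
  by (auto simp: fg_projective_def dest: fg_moduleD)

lemma projective_lift:
  assumes "fg_projective A P" "right_module A M" "right_module A N"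
    "g \<in> Hom A M N" "f \<in> Hom A P N" "f ` carrier P \<subseteq> g ` carrier M"
  obtains h where "h \<in> Hom A P M" "\<And>x. x \<in> carrier P \<Longrightarrow> g (h x) = f x"
proof -
  obtain n e \<phi> where "dual_basis A P n e \<phi>" using projective_dual_basis[OF assms(1)] by blast
  from dual_basis_lift[OF projectiveD(2)[OF assms(1)] this assms(2-)] that show ?thesis by blast
qed

text \<open>The dual basis of \<open>F\<close> descends: its elements are pushed forward by
  \<open>r\<close> and its functionals pulled back by \<open>s\<close>.\<close>

lemma projective_retract:
  assumes "fg_projective A F" "right_module A P" "r \<in> Hom A F P" "s \<in> Hom A P F"
    "\<And>x. x \<in> carrier P \<Longrightarrow> r (s x) = x"
  shows "fg_projective A P"
proof -
  obtain n e \<phi> where db: "dual_basis A F n e \<phi>" using projective_dual_basis[OF assms(1)] by blast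
  note d = dual_basisD[OF db]
  have F: "right_module A F" using assms(1) by (rule projectiveD)
  interpret P: right_module A P by fact
  interpret F: right_module A F by fact
  have "dual_basis A P n (\<lambda>i. r (e i)) (\<lambda>i. \<lambda>x\<in>carrier P. \<phi> i (s x))"
    unfolding dual_basis_def
  proof (intro conjI allI impI ballI)
    fix i assume "i < n"
    then show "r (e i) \<in> carrier P" "(\<lambda>x\<in>carrier P. \<phi> i (s x)) \<in> Hom A P (regular_module A)"
      using d(1,2)[of i] Hom_closed[OF assms(3)] Hom_comp[OF assms(2,4), of "\<phi> i"] by auto
  next
    fix x assume x: "x \<in> carrier P"
    then have sx: "s x \<in> carrier F" using Hom_closed[OF assms(4)] by blast
    have "x = r (finsum F (\<lambda>i. \<phi> i (s x) \<odot>\<^bsub>F\<^esub> e i) {..<n})" using assms(5) x d(3)[OF sx] by simp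
    also have "\<dots> = finsum P (\<lambda>i. r (\<phi> i (s x) \<odot>\<^bsub>F\<^esub> e i)) {..<n}"
      using sx d by (intro Hom_finsum[OF F assms(2,3)]) auto
    also have "\<dots> = finsum P (\<lambda>i. (\<lambda>x\<in>carrier P. \<phi> i (s x)) x \<odot>\<^bsub>P\<^esub> r (e i)) {..<n}"
      using sx x d Hom_closed[OF assms(3)] by (intro P.finsum_cong') (auto simp: Hom_smult[OF assms(3)])
    finally show "x = finsum P (\<lambda>i. (\<lambda>x\<in>carrier P. \<phi> i (s x)) x \<odot>\<^bsub>P\<^esub> r (e i)) {..<n}" .
  qed
  then show ?thesis using dual_basis_projective[OF assms(2)] by blast
qed

section \<open>Modules of finite length\<close>

text \<open>The function \<open>l\<close> need not be the length: any strictly monotone measure gives both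
  chain conditions, and measures can be added along extensions.\<close>

definition finite_length :: "('a, 'r) ring_scheme \<Rightarrow> ('a, 'm, 'e) module_scheme \<Rightarrow> bool" where
  "finite_length R M \<longleftrightarrow> (\<exists>l :: 'm set \<Rightarrow> nat. \<forall>U V.
    submodule U R M \<longrightarrow> submodule V R M \<longrightarrow> U \<subset> V \<longrightarrow> l U < l V)"

lemma finite_lengthE:
  assumes "finite_length R M"
  obtains l :: "'m set \<Rightarrow> nat" where
    "\<And>U V. submodule U R (M :: ('a, 'm, 'e) module_scheme) \<Longrightarrow> submodule V R M \<Longrightarrow> U \<subset> V \<Longrightarrow> l U < l V"
  using assms unfolding finite_length_def by blast

lemma finite_lengthI:
  fixes l :: "'m set \<Rightarrow> nat"
  assumes "\<And>U V. submodule U R (M :: ('a, 'm, 'e) module_scheme) \<Longrightarrow> submodule V R M \<Longrightarrow> U \<subset> V \<Longrightarrow> l U < l V"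
  shows "finite_length R M"
  using assms unfolding finite_length_def by blast

lemma finite_length_minimal:
  assumes "finite_length R M" "P N0" "\<And>N. P N \<Longrightarrow> submodule N R M"
  shows "\<exists>N. P N \<and> (\<forall>N'. P N' \<longrightarrow> \<not> N' \<subset> N)"
proof -
  obtain l where l: "\<And>U V. submodule U R M \<Longrightarrow> submodule V R M \<Longrightarrow> U \<subset> V \<Longrightarrow> (l U :: nat) < l V"
    using finite_lengthE[OF assms(1)] by blast
  obtain N where N: "P N" "\<And>N'. P N' \<Longrightarrow> l N \<le> l N'"
    using ex_has_least_nat[of P N0 l] assms(2) by blast
  have "\<not> N' \<subset> N" if "P N'" for N'
    using l[OF assms(3)[OF that] assms(3)[OF N(1)]] N(2)[OF that] by linarith
  then show ?thesis using N(1) by blast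
qed

lemma finite_length_maximal:
  assumes "right_module R M" "finite_length R M" "P N0" "\<And>N. P N \<Longrightarrow> submodule N R M"
  shows "\<exists>N. P N \<and> (\<forall>N'. P N' \<longrightarrow> \<not> N \<subset> N')"
proof -
  interpret M: right_module R M by fact
  obtain l where l: "\<And>U V. submodule U R M \<Longrightarrow> submodule V R M \<Longrightarrow> U \<subset> V \<Longrightarrow> (l U :: nat) < l V"
    using finite_lengthE[OF assms(2)] by blast
  have "l N \<le> l (carrier M)" if "P N" for N
  proof (cases "N = carrier M")
    case False
    have "N \<subseteq> carrier M" using assms(4)[OF that] by (simp add: M.submodule_iff)
    then have "N \<subset> carrier M" using False by blast
    then show ?thesis using l[OF assms(4)[OF that] M.carrier_submodule] by simp
  qed simp
  then have bound: "\<forall>y. P y \<longrightarrow> l y < Suc (l (carrier M))" by (simp add: less_Suc_eq_le)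
  obtain N where N: "P N" "\<And>N'. P N' \<Longrightarrow> l N' \<le> l N"
    using ex_has_greatest_nat[OF assms(3) bound] by blast
  have "\<not> N \<subset> N'" if "P N'" for N'
    using l[OF assms(4)[OF N(1)] assms(4)[OF that]] N(2)[OF that] by linarith
  then show ?thesis using N(1) by blast
qed

text \<open>If \<open>f\<close> were not onto, there would be an \<open>N\<close> minimal with
  \<open>f N\<close> strictly inside \<open>N\<close>. Injectivity preserves the strict inclusion
  under \<open>f\<close>, so \<open>f N\<close> would be a smaller one.\<close>

lemma injective_endo_surj:
  assumes "right_module R M" "finite_length R M" "f \<in> Hom R M M" "inj_on f (carrier M)"
  shows "f ` carrier M = carrier M"
proof (rule ccontr)
  assume neq: "f ` carrier M \<noteq> carrier M"
  interpret M: right_module R M by fact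
  define P where "P N \<longleftrightarrow> submodule N R M \<and> f ` N \<subset> N" for N
  have "P (carrier M)" unfolding P_def using neq Hom_closed[OF assms(3)] M.carrier_submodule by blast
  moreover have Psub: "\<And>N. P N \<Longrightarrow> submodule N R M" by (simp add: P_def)
  ultimately obtain N where N: "P N" "\<forall>N'. P N' \<longrightarrow> \<not> N' \<subset> N"
    using finite_length_minimal[OF assms(2) _ Psub] by blast
  have fN: "submodule N R M" "f ` N \<subset> N" using N(1) by (simp_all add: P_def)
  have sub: "N \<subseteq> carrier M" using fN(1) by (simp add: M.submodule_iff)
  have "P (f ` N)"
    unfolding P_def using Hom_image_submodule[OF assms(1,1,3) fN(1)]
      image_strict_mono[OF inj_on_subset[OF assms(4) sub] fN(2)] by simp
  then show False using N fN by blast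
qed

text \<open>The mirror image with preimages: a nonzero kernel makes the zero submodule strictly
  smaller than its preimage, and surjectivity keeps such an inclusion strict when preimages are
  taken, against maximality.\<close>

lemma surjective_endo_inj:
  assumes "right_module R M" "finite_length R M" "f \<in> Hom R M M" "f ` carrier M = carrier M"
  shows "inj_on f (carrier M)"
proof (rule ccontr)
  assume ninj: "\<not> inj_on f (carrier M)"
  interpret M: right_module R M by fact
  let ?f = "\<lambda>N. {x \<in> carrier M. f x \<in> N}"
  define P where "P N \<longleftrightarrow> submodule N R M \<and> N \<subset> ?f N" for N
  obtain x where x: "x \<in> carrier M" "f x = \<zero>\<^bsub>M\<^esub>" "x \<noteq> \<zero>\<^bsub>M\<^esub>"
    using ninj Hom_inj_on_iff[OF assms(1,1,3)] by blast
  then have "P {\<zero>\<^bsub>M\<^esub>}"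
    using M.zero_submodule Hom_zero[OF assms(1,1,3)] by (auto simp: P_def psubset_eq)
  moreover have Psub: "\<And>N. P N \<Longrightarrow> submodule N R M" by (simp add: P_def)
  ultimately obtain N where N: "P N" "\<forall>N'. P N' \<longrightarrow> \<not> N \<subset> N'"
    using finite_length_maximal[OF assms(1,2) _ Psub] by blast
  have fN: "submodule N R M" "N \<subset> ?f N" using N(1) by (simp_all add: P_def)
  obtain z where z: "z \<in> carrier M" "f z \<in> N" "z \<notin> N" using fN(2) by blast
  obtain y where y: "y \<in> carrier M" "f y = z" using z(1) assms(4) by (metis imageE)
  have "?f N \<subset> ?f (?f N)" using fN(2) y z by blast
  then have "P (?f N)" using Hom_vimage_submodule[OF assms(1,1,3) fN(1)] by (simp add: P_def)
  then show False using N fN by blast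
qed

lemma finite_length_inj:
  assumes "right_module R M" "right_module R N" "f \<in> Hom R M N" "inj_on f (carrier M)" "finite_length R N"
  shows "finite_length R M"
proof -
  interpret M: right_module R M by fact
  obtain l where l: "\<And>U V. submodule U R N \<Longrightarrow> submodule V R N \<Longrightarrow> U \<subset> V \<Longrightarrow> (l U :: nat) < l V"
    using finite_lengthE[OF assms(5)] by blast
  show ?thesis
  proof (rule finite_lengthI)
    fix U V assume UV: "submodule U R M" "submodule V R M" "U \<subset> V"
    have "inj_on f V" using assms(4) UV(2) by (auto simp: M.submodule_iff intro: inj_on_subset)
    then show "l (f ` U) < l (f ` V)"
      using UV by (intro l Hom_image_submodule[OF assms(1-3)] image_strict_mono)
  qed
qed

lemma finite_length_submodule:
  assumes "right_module R M" "finite_length R M" "submodule N R M"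
  shows "finite_length R (M\<lparr>carrier := N\<rparr>)"
  by (rule finite_length_inj[OF submodule_right_module[OF assms(1,3)] assms(1) Hom_inclusion[OF assms(1,3)] _ assms(2)])
    (auto simp: inj_on_def)

lemma fg_module_submoduleI:
  assumes "right_module R M" "submodule N R M" "finite S" "S \<subseteq> N"
    "\<And>V. submodule V R M \<Longrightarrow> V \<subseteq> N \<Longrightarrow> S \<subseteq> V \<Longrightarrow> V = N"
  shows "fg_module R (M\<lparr>carrier := N\<rparr>)"
  unfolding fg_module_def submodule_trans_iff[OF assms(1,2)]
  using assms submodule_right_module[OF assms(1,2)] by (intro conjI exI[of _ S]) auto

text \<open>A maximal finitely generated submodule of \<open>N\<close> is \<open>N\<close>, since a
  missing element could be added as one more generator. Generation is stated through submodules of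
  \<open>M\<close>, which avoids nested carrier updates.\<close>

lemma finite_length_fg:
  assumes "right_module R M" "finite_length R M" "submodule N R M"
  shows "fg_module R (M\<lparr>carrier := N\<rparr>)"
proof -
  interpret M: right_module R M by fact
  let ?Q = "\<lambda>U S. finite S \<and> S \<subseteq> U \<and> (\<forall>V. submodule V R M \<longrightarrow> V \<subseteq> U \<longrightarrow> S \<subseteq> V \<longrightarrow> V = U)"
  define P where "P U \<longleftrightarrow> submodule U R M \<and> U \<subseteq> N \<and> (\<exists>S. ?Q U S)" for U
  have "?Q {\<zero>\<^bsub>M\<^esub>} {\<zero>\<^bsub>M\<^esub>}" by auto
  moreover have "{\<zero>\<^bsub>M\<^esub>} \<subseteq> N" using assms(3) by (simp add: M.submodule_iff)
  ultimately have "P {\<zero>\<^bsub>M\<^esub>}" unfolding P_def using M.zero_submodule by blast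
  moreover have Psub: "\<And>N. P N \<Longrightarrow> submodule N R M" by (simp add: P_def)
  ultimately obtain U where PU: "P U" and max: "\<forall>U'. P U' \<longrightarrow> \<not> U \<subset> U'"
    using finite_length_maximal[OF assms(1,2) _ Psub] by blast
  have U: "submodule U R M" "U \<subseteq> N" using PU by (simp_all add: P_def)
  obtain S where S: "?Q U S" using PU unfolding P_def by (elim conjE exE) (rule that, simp)
  have "U = N"
  proof (rule ccontr)
    assume "U \<noteq> N"
    then obtain x where x: "x \<in> N" "x \<notin> U" using U(2) by blast
    have xM: "x \<in> carrier M" using x(1) assms(3) by (auto simp: M.submodule_iff)
    note sub = M.submodule_cyclic[OF xM]
    let ?U = "U <+>\<^bsub>M\<^esub> M.cyclic x"
    have sU: "submodule ?U R M" by (rule M.submodule_add[OF U(1) sub])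
    note up = M.set_add_upper[OF U(1) sub]
    have UN: "?U \<subseteq> N" by (rule M.set_add_least[OF assms(3) U(2) M.cyclic_least[OF assms(3) x(1)]])
    have Q: "?Q ?U (insert x S)"
    proof (intro conjI allI impI)
      show "finite (insert x S)" "insert x S \<subseteq> ?U" using S up M.mem_cyclic[OF xM] by auto
      fix V assume V: "submodule V R M" "V \<subseteq> ?U" "insert x S \<subseteq> V"
      have VU: "submodule (V \<inter> U) R M" by (rule M.submodule_Int[OF V(1) U(1)])
      have "V \<inter> U = U" by (rule S[THEN conjunct2, THEN conjunct2, rule_format, OF VU]) (use S V(3) in auto)
      then have "U \<subseteq> V" by blast
      moreover have "M.cyclic x \<subseteq> V" using V(3) by (intro M.cyclic_least[OF V(1)]) simp
      ultimately have "?U \<subseteq> V" by (rule M.set_add_least[OF V(1)])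
      then show "V = ?U" using V(2) by blast
    qed
    have "P ?U" unfolding P_def by (rule conjI[OF sU conjI[OF UN exI[of _ "insert x S"]]], rule Q)
    moreover have "U \<subset> ?U" using up x(2) M.mem_cyclic[OF xM] by blast
    ultimately show False using max by blast
  qed
  show ?thesis
    by (rule fg_module_submoduleI[OF assms(1,3), of S]) (use S \<open>U = N\<close> in auto)
qed

lemma finite_length_fg_module:
  "right_module R M \<Longrightarrow> finite_length R M \<Longrightarrow> fg_module R M"
  using finite_length_fg[of R M "carrier M"] right_module.carrier_submodule[of R M] by simp

text \<open>By the modular law, \<open>U \<subseteq> N + x R\<close> is determined within a chain by \<open>U \<inter> N\<close> and
  \<open>{a. x a \<in> U + N}\<close>.\<close>

lemma finite_length_add_cyclic:
  assumes "right_module R M" "finite_length R (regular_module R)"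
    "submodule N R M" "finite_length R (M\<lparr>carrier := N\<rparr>)" "x \<in> carrier M"
  shows "finite_length R (M\<lparr>carrier := N <+>\<^bsub>M\<^esub> right_module.cyclic R M x\<rparr>)"
proof -
  interpret M: right_module R M by fact
  have AA: "right_module R (regular_module R)" by (rule right_module_regular[OF M.R.ring_axioms])
  let ?C = "N <+>\<^bsub>M\<^esub> M.cyclic x"
  have C: "submodule ?C R M" using M.submodule_add[OF assms(3) M.submodule_cyclic[OF assms(5)]] .
  obtain l where l: "\<And>U V. submodule U R M \<and> U \<subseteq> N \<Longrightarrow> submodule V R M \<and> V \<subseteq> N \<Longrightarrow> U \<subset> V \<Longrightarrow> (l U :: nat) < l V"
    using finite_lengthE[OF assms(4)] unfolding submodule_trans_iff[OF assms(1,3)] by blast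
  obtain m where m: "\<And>U V. submodule U R (regular_module R) \<Longrightarrow> submodule V R (regular_module R) \<Longrightarrow> U \<subset> V \<Longrightarrow> (m U :: nat) < m V"
    using finite_lengthE[OF assms(2)] by blast
  define r where "r = (\<lambda>a\<in>carrier (regular_module R). a \<odot>\<^bsub>M\<^esub> x)"
  have r: "r \<in> Hom R (regular_module R) M"
    unfolding r_def using assms(5) by (intro restrict_HomI AA) (auto simp: M.smult_l_distr M.smult_assoc)
  define q where "q U = {a \<in> carrier (regular_module R). r a \<in> U <+>\<^bsub>M\<^esub> N}" for U
  have q: "submodule (q U) R (regular_module R)" if "submodule U R M" for U
    unfolding q_def by (intro Hom_vimage_submodule[OF AA assms(1) r] M.submodule_add that assms(3))
  show ?thesis
  proof (rule finite_lengthI)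
    fix U V
    assume "submodule U R (M\<lparr>carrier := ?C\<rparr>)" "submodule V R (M\<lparr>carrier := ?C\<rparr>)" and less: "U \<subset> V"
    then have U: "submodule U R M" "U \<subseteq> ?C" and V: "submodule V R M" "V \<subseteq> ?C"
      unfolding submodule_trans_iff[OF assms(1) C] by auto
    note I = M.submodule_Int[OF U(1) assms(3)] M.submodule_Int[OF V(1) assms(3)]
    note upU = M.set_add_upper[OF U(1) assms(3)] and upV = M.set_add_upper[OF V(1) assms(3)]
    note addU = M.submodule_add[OF U(1) assms(3)] and addV = M.submodule_add[OF V(1) assms(3)]
    have UV: "U <+>\<^bsub>M\<^esub> N \<subseteq> V <+>\<^bsub>M\<^esub> N" using M.set_add_least[OF addV, of U N] less upV by blast
    have qm: "q U \<subseteq> q V" using UV unfolding q_def by blast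
    have l1: "U \<inter> N = V \<inter> N \<or> l (U \<inter> N) < l (V \<inter> N)"
      using l[of "U \<inter> N" "V \<inter> N"] I less by blast
    have m1: "q U = q V \<or> m (q U) < m (q V)"
      using m[OF q[OF U(1)] q[OF V(1)]] qm by blast
    have "\<not> (U \<inter> N = V \<inter> N \<and> q U = q V)"
    proof
      assume eq: "U \<inter> N = V \<inter> N \<and> q U = q V"
      \<comment> \<open>Let \<open>v\<close> be \<open>n\<close> plus the multiple of
        \<open>x\<close> by \<open>a\<close>. Equality of the second invariants puts that multiple
        into \<open>U + N\<close>, so \<open>v = u + n'\<close> with \<open>u\<close> in
        \<open>U\<close> and \<open>n'\<close> in \<open>N\<close>; then \<open>n' = v - u\<close>
        lies in \<open>V \<inter> N\<close>, which is \<open>U \<inter> N\<close>.\<close>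
      have "V \<subseteq> U"
      proof
        fix v assume v: "v \<in> V"
        then obtain n a where na: "n \<in> N" "a \<in> carrier R" "v = n \<oplus>\<^bsub>M\<^esub> a \<odot>\<^bsub>M\<^esub> x"
          using subsetD[OF V(2) v] unfolding M.mem_set_add M.cyclic_def by blast
        have nM: "n \<in> carrier M" using na(1) assms(3) by (auto simp: M.submodule_iff)
        have ax: "a \<odot>\<^bsub>M\<^esub> x \<in> carrier M" using na(2) assms(5) by simp
        have "a \<odot>\<^bsub>M\<^esub> x \<oplus>\<^bsub>M\<^esub> n \<in> V <+>\<^bsub>M\<^esub> N" using v upV(1) na(3) M.a_comm[OF nM ax] by auto
        then have "a \<odot>\<^bsub>M\<^esub> x \<in> V <+>\<^bsub>M\<^esub> N"
          using M.submodule_cancel[OF addV _ _ ax] upV(2) na(1) by blast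
        then have "a \<in> q V" using na(2) by (simp add: q_def r_def)
        then have "a \<in> q U" using eq by simp
        then have "a \<odot>\<^bsub>M\<^esub> x \<in> U <+>\<^bsub>M\<^esub> N" using na(2) by (simp add: q_def r_def)
        then have "v \<in> U <+>\<^bsub>M\<^esub> N" unfolding na(3) using addU upU(2) na(1) by (auto simp: M.submodule_iff)
        then obtain u n' where un: "u \<in> U" "n' \<in> N" "v = u \<oplus>\<^bsub>M\<^esub> n'" by (auto simp: M.mem_set_add)
        have c: "u \<in> carrier M" "n' \<in> carrier M" using un U(1) assms(3) by (auto simp: M.submodule_iff)
        have "n' \<oplus>\<^bsub>M\<^esub> u \<in> V" using v un(3) c by (simp add: M.a_comm)
        then have "n' \<in> V" using M.submodule_cancel[OF V(1) _ _ c(2)] un(1) less by blast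
        then have "n' \<in> U" using eq un(2) by blast
        then show "v \<in> U" using un U(1) by (simp add: M.submodule_iff)
      qed
      then show False using less by blast
    qed
    then show "l (U \<inter> N) + m (q U) < l (V \<inter> N) + m (q V)"
      using l1 m1 by (elim disjE) auto
  qed
qed

lemma finite_length_zero: "right_module R M \<Longrightarrow> finite_length R (M\<lparr>carrier := {\<zero>\<^bsub>M\<^esub>}\<rparr>)"
proof (rule finite_lengthI[where l = "\<lambda>_. 0"])
  fix U V assume M: "right_module R M"
    and "submodule U R (M\<lparr>carrier := {\<zero>\<^bsub>M\<^esub>}\<rparr>)" "submodule V R (M\<lparr>carrier := {\<zero>\<^bsub>M\<^esub>}\<rparr>)" "U \<subset> V"
  then show "0 < (0::nat)"
    using right_module.zero_submodule[OF M] 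
    by (auto simp: submodule_trans_iff[OF M] right_module.submodule_iff[OF M])
qed

text \<open>Induction on the generators, each contributing a cyclic submodule. It suffices that
  \<open>N\<close> contains \<open>S\<close>, so no span has to be defined.\<close>

lemma fg_finite_length:
  assumes "finite_length R (regular_module R)" "fg_module R M"
  shows "finite_length R M"
proof -
  have M: "right_module R M" using assms(2) by (rule fg_moduleD)
  then interpret M: right_module R M .
  obtain S where S: "finite S" "S \<subseteq> carrier M" and gen: "\<forall>N. submodule N R M \<and> S \<subseteq> N \<longrightarrow> N = carrier M"
    using assms(2) unfolding fg_module_def by (elim conjE exE)
  have "\<exists>N. submodule N R M \<and> S \<subseteq> N \<and> finite_length R (M\<lparr>carrier := N\<rparr>)"
    using S
  proof (induction S rule: finite_induct)
    case empty
    then show ?case using M.zero_submodule finite_length_zero[OF M] by blast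
  next
    case (insert x S)
    then obtain N where N: "submodule N R M" "S \<subseteq> N" "finite_length R (M\<lparr>carrier := N\<rparr>)" by auto
    have x: "x \<in> carrier M" using insert by simp
    note cx = M.submodule_cyclic[OF x]
    show ?case
    proof (intro exI conjI)
      show "submodule (N <+>\<^bsub>M\<^esub> M.cyclic x) R M" by (rule M.submodule_add[OF N(1) cx])
      show "insert x S \<subseteq> N <+>\<^bsub>M\<^esub> M.cyclic x"
        using M.set_add_upper[OF N(1) cx] N(2) M.mem_cyclic[OF x] by blast
      show "finite_length R (M\<lparr>carrier := N <+>\<^bsub>M\<^esub> M.cyclic x\<rparr>)"
        by (rule finite_length_add_cyclic[OF M assms(1) N(1,3) x])
    qed
  qed
  then obtain N where N: "submodule N R M" "S \<subseteq> N" "finite_length R (M\<lparr>carrier := N\<rparr>)" by blast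
  then have "N = carrier M" using gen by blast
  then show ?thesis using N(3) by simp
qed

lemma fg_module_surj:
  assumes "fg_module R M" "right_module R N" "f \<in> Hom R M N" "f ` carrier M = carrier N"
  shows "fg_module R N"
proof -
  have M: "right_module R M" using assms(1) by (rule fg_moduleD)
  interpret N: right_module R N by fact
  obtain S where S: "finite S" "S \<subseteq> carrier M" and gen: "\<forall>N. submodule N R M \<and> S \<subseteq> N \<longrightarrow> N = carrier M"
    using assms(1) unfolding fg_module_def by (elim conjE exE)
  have "V = carrier N" if V: "submodule V R N" "f ` S \<subseteq> V" for V
  proof -
    have "{x \<in> carrier M. f x \<in> V} = carrier M"
      using gen[rule_format, OF conjI, OF Hom_vimage_submodule[OF M assms(2,3) V(1)]] S(2) V(2) by blast
    then have "carrier N \<subseteq> V" unfolding assms(4)[symmetric] by blast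
    then show ?thesis using V(1) by (auto simp: N.submodule_iff)
  qed
  then show ?thesis
    unfolding fg_module_def using assms(2,4) S by (intro conjI exI[of _ "f ` S"]) blast+
qed

section \<open>Quotients\<close>

context right_module
begin

lemma coset_eq:
  assumes "submodule N R M" "x \<in> carrier M"
  shows "N +>\<^bsub>M\<^esub> x = {z \<in> carrier M. z \<ominus>\<^bsub>M\<^esub> x \<in> N}"
proof -
  have N: "N \<subseteq> carrier M" using assms(1) by (simp add: submodule_iff)
  have "(\<exists>h\<in>N. z = h \<oplus>\<^bsub>M\<^esub> x) \<longleftrightarrow> z \<in> carrier M \<and> z \<ominus>\<^bsub>M\<^esub> x \<in> N" for z
  proof
    assume "\<exists>h\<in>N. z = h \<oplus>\<^bsub>M\<^esub> x"
    then obtain h where h: "h \<in> N" "z = h \<oplus>\<^bsub>M\<^esub> x" by blast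
    then have "z \<ominus>\<^bsub>M\<^esub> x = h" using N assms(2) by (auto simp: a_minus_def M.a_assoc M.r_neg)
    then show "z \<in> carrier M \<and> z \<ominus>\<^bsub>M\<^esub> x \<in> N" using h N assms(2) by auto
  next
    assume "z \<in> carrier M \<and> z \<ominus>\<^bsub>M\<^esub> x \<in> N"
    moreover from this have "z = (z \<ominus>\<^bsub>M\<^esub> x) \<oplus>\<^bsub>M\<^esub> x"
      using assms(2) by (simp add: a_minus_def M.a_assoc M.l_neg)
    ultimately show "\<exists>h\<in>N. z = h \<oplus>\<^bsub>M\<^esub> x" by blast
  qed
  then show ?thesis unfolding a_r_coset_def' by auto
qed

lemma coset_eq_iff:
  assumes "submodule N R M" "x \<in> carrier M" "y \<in> carrier M"
  shows "N +>\<^bsub>M\<^esub> x = N +>\<^bsub>M\<^esub> y \<longleftrightarrow> x \<ominus>\<^bsub>M\<^esub> y \<in> N"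
proof
  have "x \<ominus>\<^bsub>M\<^esub> x = \<zero>\<^bsub>M\<^esub>" using assms(2) by (simp add: a_minus_def M.r_neg)
  then have "x \<in> N +>\<^bsub>M\<^esub> x" using assms(1,2) by (simp add: coset_eq) (simp add: submodule_iff)
  moreover assume "N +>\<^bsub>M\<^esub> x = N +>\<^bsub>M\<^esub> y"
  ultimately show "x \<ominus>\<^bsub>M\<^esub> y \<in> N" using assms by (simp add: coset_eq)
next
  assume d: "x \<ominus>\<^bsub>M\<^esub> y \<in> N"
  have "z \<ominus>\<^bsub>M\<^esub> x \<in> N \<longleftrightarrow> z \<ominus>\<^bsub>M\<^esub> y \<in> N" if z: "z \<in> carrier M" for z
  proof -
    have "z \<ominus>\<^bsub>M\<^esub> y = (z \<ominus>\<^bsub>M\<^esub> x) \<oplus>\<^bsub>M\<^esub> (x \<ominus>\<^bsub>M\<^esub> y)"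
      using z assms(2,3) by (simp add: a_minus_def M.a_assoc M.r_neg2 M.r_neg1)
    then show ?thesis
      using d assms z submodule_cancel[OF assms(1), of "z \<ominus>\<^bsub>M\<^esub> x" "x \<ominus>\<^bsub>M\<^esub> y"] by (auto simp: submodule_iff)
  qed
  then show "N +>\<^bsub>M\<^esub> x = N +>\<^bsub>M\<^esub> y" using assms by (auto simp: coset_eq)
qed

lemma coset_add:
  assumes N: "submodule N R M" and x: "x \<in> carrier M" and y: "y \<in> carrier M"
  shows "(N +>\<^bsub>M\<^esub> x) <+>\<^bsub>M\<^esub> (N +>\<^bsub>M\<^esub> y) = N +>\<^bsub>M\<^esub> (x \<oplus>\<^bsub>M\<^esub> y)"
proof (intro subset_antisym subsetI)
  fix z assume "z \<in> (N +>\<^bsub>M\<^esub> x) <+>\<^bsub>M\<^esub> (N +>\<^bsub>M\<^esub> y)"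
  then obtain u v where uv: "u \<in> carrier M" "u \<ominus>\<^bsub>M\<^esub> x \<in> N" "v \<in> carrier M" "v \<ominus>\<^bsub>M\<^esub> y \<in> N" "z = u \<oplus>\<^bsub>M\<^esub> v"
    using assms by (auto simp: mem_set_add coset_eq)
  then have "(u \<ominus>\<^bsub>M\<^esub> x) \<oplus>\<^bsub>M\<^esub> (v \<ominus>\<^bsub>M\<^esub> y) \<in> N" using N by (simp add: submodule_iff)
  moreover have "(u \<ominus>\<^bsub>M\<^esub> x) \<oplus>\<^bsub>M\<^esub> (v \<ominus>\<^bsub>M\<^esub> y) = z \<ominus>\<^bsub>M\<^esub> (x \<oplus>\<^bsub>M\<^esub> y)"
    using uv x y by (simp add: a_minus_def M.minus_add M.a_ac)
  ultimately show "z \<in> N +>\<^bsub>M\<^esub> (x \<oplus>\<^bsub>M\<^esub> y)" using assms uv by (simp add: coset_eq)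
next
  fix z assume "z \<in> N +>\<^bsub>M\<^esub> (x \<oplus>\<^bsub>M\<^esub> y)"
  then have z: "z \<in> carrier M" "z \<ominus>\<^bsub>M\<^esub> (x \<oplus>\<^bsub>M\<^esub> y) \<in> N" using assms by (auto simp: coset_eq)
  have "z \<ominus>\<^bsub>M\<^esub> y \<ominus>\<^bsub>M\<^esub> x = z \<ominus>\<^bsub>M\<^esub> (x \<oplus>\<^bsub>M\<^esub> y)"
    using z(1) x y by (simp add: a_minus_def M.minus_add M.a_ac)
  then have "z \<ominus>\<^bsub>M\<^esub> y \<in> N +>\<^bsub>M\<^esub> x" using z x y N by (simp add: coset_eq)
  moreover have "y \<in> N +>\<^bsub>M\<^esub> y"
  proof -
    have "y \<ominus>\<^bsub>M\<^esub> y = \<zero>\<^bsub>M\<^esub>" using y by (simp add: a_minus_def M.r_neg)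
    then show ?thesis using N y by (simp add: coset_eq) (simp add: submodule_iff)
  qed
  moreover have "z = (z \<ominus>\<^bsub>M\<^esub> y) \<oplus>\<^bsub>M\<^esub> y" using z(1) y by (simp add: a_minus_def M.a_assoc M.l_neg)
  ultimately show "z \<in> (N +>\<^bsub>M\<^esub> x) <+>\<^bsub>M\<^esub> (N +>\<^bsub>M\<^esub> y)" unfolding mem_set_add by blast
qed

text \<open>The union in \<open>quotient_module\<close> runs over all representatives of a coset.
  Two of them differ by an element of \<open>N\<close>, also after the action of \<open>a\<close>,
  so the union is a single coset.\<close>

lemma coset_smult:
  assumes N: "submodule N R M" and x: "x \<in> carrier M" and a: "a \<in> carrier R"
  shows "(\<Union>u\<in>N +>\<^bsub>M\<^esub> x. N +>\<^bsub>M\<^esub> (a \<odot>\<^bsub>M\<^esub> u)) = N +>\<^bsub>M\<^esub> (a \<odot>\<^bsub>M\<^esub> x)"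
proof -
  have "N +>\<^bsub>M\<^esub> (a \<odot>\<^bsub>M\<^esub> u) = N +>\<^bsub>M\<^esub> (a \<odot>\<^bsub>M\<^esub> x)" if "u \<in> N +>\<^bsub>M\<^esub> x" for u
  proof -
    have u: "u \<in> carrier M" "u \<ominus>\<^bsub>M\<^esub> x \<in> N" using that N x by (auto simp: coset_eq)
    have "a \<odot>\<^bsub>M\<^esub> u \<ominus>\<^bsub>M\<^esub> a \<odot>\<^bsub>M\<^esub> x = a \<odot>\<^bsub>M\<^esub> (u \<ominus>\<^bsub>M\<^esub> x)"
      using u x a by (simp add: a_minus_def smult_r_distr smult_r_minus)
    also have "\<dots> \<in> N" using u a N by (simp add: submodule_iff)
    finally show ?thesis using coset_eq_iff[OF N] u x a by simp
  qed
  moreover have "x \<in> N +>\<^bsub>M\<^esub> x"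
  proof -
    have "x \<ominus>\<^bsub>M\<^esub> x = \<zero>\<^bsub>M\<^esub>" using x by (simp add: a_minus_def M.r_neg)
    then show ?thesis using N x by (simp add: coset_eq) (simp add: submodule_iff)
  qed
  ultimately show ?thesis by blast
qed

lemma quotient_simps:
  assumes "submodule N R M"
  shows "carrier (quotient_module M N) = (\<lambda>x. N +>\<^bsub>M\<^esub> x) ` carrier M"
    "zero (quotient_module M N) = N +>\<^bsub>M\<^esub> \<zero>\<^bsub>M\<^esub>"
    "\<lbrakk>x \<in> carrier M; y \<in> carrier M\<rbrakk> \<Longrightarrow> (N +>\<^bsub>M\<^esub> x) \<oplus>\<^bsub>quotient_module M N\<^esub> (N +>\<^bsub>M\<^esub> y) = N +>\<^bsub>M\<^esub> (x \<oplus>\<^bsub>M\<^esub> y)"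
    "\<lbrakk>a \<in> carrier R; x \<in> carrier M\<rbrakk> \<Longrightarrow> a \<odot>\<^bsub>quotient_module M N\<^esub> (N +>\<^bsub>M\<^esub> x) = N +>\<^bsub>M\<^esub> (a \<odot>\<^bsub>M\<^esub> x)"
proof -
  have N: "N \<subseteq> carrier M" using assms by (simp add: submodule_iff)
  have "N +>\<^bsub>M\<^esub> \<zero>\<^bsub>M\<^esub> = N" using N by (auto simp: coset_eq[OF assms] a_minus_def)
  then show "zero (quotient_module M N) = N +>\<^bsub>M\<^esub> \<zero>\<^bsub>M\<^esub>" by (simp add: quotient_module_def)
  show "carrier (quotient_module M N) = (\<lambda>x. N +>\<^bsub>M\<^esub> x) ` carrier M"
    by (auto simp: quotient_module_def A_RCOSETS_def')
qed (simp_all add: quotient_module_def coset_add coset_smult assms)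

lemma right_module_quotient:
  assumes "submodule N R M" shows "right_module R (quotient_module M N)"
  by (rule right_moduleI_image[OF right_module_axioms, of "\<lambda>x. N +>\<^bsub>M\<^esub> x"])
     (simp_all add: quotient_simps[OF assms])

lemma quotient_Hom:
  assumes "submodule N R M" shows "(\<lambda>x\<in>carrier M. N +>\<^bsub>M\<^esub> x) \<in> Hom R M (quotient_module M N)"
  by (rule restrict_HomI[OF right_module_axioms]) (simp_all add: quotient_simps[OF assms])

lemma quotient_zero_iff:
  assumes "submodule N R M" "x \<in> carrier M"
  shows "N +>\<^bsub>M\<^esub> x = \<zero>\<^bsub>quotient_module M N\<^esub> \<longleftrightarrow> x \<in> N"
  using coset_eq_iff[OF assms, of "\<zero>\<^bsub>M\<^esub>"] assms(2) M.minus_equality[of "\<zero>\<^bsub>M\<^esub>" "\<zero>\<^bsub>M\<^esub>"]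
  by (simp add: quotient_simps[OF assms(1)] a_minus_def)

end

section \<open>Artinian commutative rings\<close>

text \<open>Zorn's lemma applies because the union of a chain of submodules that avoid
  \<open>x\<close> avoids \<open>x\<close>. For \<open>x = \<one>\<close> the outcome is a maximal
  ideal; in general, that all proper enlargements of \<open>L\<close> contain \<open>x\<close> is
  the tool for cutting out a simple factor.\<close>

lemma (in right_module) submodule_Zorn:
  assumes "submodule U R M" "x \<notin> U"
  shows "\<exists>L. submodule L R M \<and> U \<subseteq> L \<and> x \<notin> L \<and> (\<forall>L'. submodule L' R M \<longrightarrow> L \<subset> L' \<longrightarrow> x \<in> L')"
proof -
  define \<A> where "\<A> = {L. submodule L R M \<and> U \<subseteq> L \<and> x \<notin> L}"
  have "\<exists>L\<in>\<A>. \<forall>X\<in>\<A>. L \<subseteq> X \<longrightarrow> X = L"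
  proof (rule subset_Zorn_nonempty)
    show "\<A> \<noteq> {}" using assms unfolding \<A>_def by blast
  next
    fix \<C> assume ne: "\<C> \<noteq> {}" and ch: "subset.chain \<A> \<C>"
    have C: "submodule L R M" "U \<subseteq> L" "x \<notin> L" if "L \<in> \<C>" for L
      using ch that unfolding subset.chain_def \<A>_def by blast+
    have comp: "L \<subseteq> L' \<or> L' \<subseteq> L" if "L \<in> \<C>" "L' \<in> \<C>" for L L'
      using ch that unfolding subset.chain_def by blast
    have "submodule (\<Union>\<C>) R M"
      unfolding submodule_iff
    proof (intro conjI ballI)
      show "\<Union>\<C> \<subseteq> carrier M" using C(1) unfolding submodule_iff by blast
      show "\<zero>\<^bsub>M\<^esub> \<in> \<Union>\<C>" using C(1) ne unfolding submodule_iff by blast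
    next
      fix y z assume "y \<in> \<Union>\<C>" "z \<in> \<Union>\<C>"
      then obtain L L' where L: "L \<in> \<C>" "L' \<in> \<C>" "y \<in> L" "z \<in> L'" by blast
      then obtain L'' where "L'' \<in> \<C>" "y \<in> L''" "z \<in> L''" using comp[OF L(1,2)] by blast
      moreover from this have "y \<oplus>\<^bsub>M\<^esub> z \<in> L''" using C(1) by (simp add: submodule_iff)
      ultimately show "y \<oplus>\<^bsub>M\<^esub> z \<in> \<Union>\<C>" by blast
    next
      fix a y assume a: "a \<in> carrier R" and "y \<in> \<Union>\<C>"
      then obtain L where "L \<in> \<C>" "y \<in> L" by blast
      moreover from this a have "a \<odot>\<^bsub>M\<^esub> y \<in> L" using C(1) by (simp add: submodule_iff)
      ultimately show "a \<odot>\<^bsub>M\<^esub> y \<in> \<Union>\<C>" by blast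
    qed
    then show "\<Union>\<C> \<in> \<A>" using C(2,3) ne unfolding \<A>_def by blast
  qed
  then obtain L where L: "L \<in> \<A>" "\<And>X. X \<in> \<A> \<Longrightarrow> L \<subseteq> X \<Longrightarrow> X = L" by blast
  have "x \<in> L'" if "submodule L' R M" "L \<subset> L'" for L'
    using L(1) L(2)[of L'] that unfolding \<A>_def by blast
  then show ?thesis using L(1) unfolding \<A>_def by blast
qed

context cring
begin

lemma regular_right_module: "right_module R (regular_module R)"
  by (rule right_module_regular[OF ring_axioms])

lemma regular_submodule_iff:
  "submodule I R (regular_module R) \<longleftrightarrow> I \<subseteq> carrier R \<and> \<zero> \<in> I \<and>
    (\<forall>x\<in>I. \<forall>y\<in>I. x \<oplus> y \<in> I) \<and> (\<forall>a\<in>carrier R. \<forall>x\<in>I. x \<otimes> a \<in> I)"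
  using right_module.submodule_iff[OF regular_right_module] by simp

lemma ideal_iff_submodule: "ideal I R \<longleftrightarrow> submodule I R (regular_module R)"
proof
  assume "ideal I R"
  then interpret ideal I R .
  show "submodule I R (regular_module R)"
    unfolding regular_submodule_iff using a_subset I_r_closed by (auto simp: a_subset[THEN subsetD])
next
  assume s: "submodule I R (regular_module R)"
  have "subgroup I (add_monoid R)"
    using s by (simp add: submodule_def subgroup_def a_inv_def m_inv_def)
  then show "ideal I R"
    using s unfolding regular_submodule_iff
    by (intro idealI ring_axioms) (auto simp: m_comm[of _ a for a] subset_iff m_comm)
qed

lemma maximalideal_exists:
  assumes "submodule U R (regular_module R)" "\<one> \<notin> U"
  shows "\<exists>m. maximalideal m R \<and> U \<subseteq> m"
proof -
  interpret RR: right_module R "regular_module R" by (rule regular_right_module)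
  obtain m where m: "submodule m R (regular_module R)" "U \<subseteq> m" "\<one> \<notin> m"
    "\<And>L. submodule L R (regular_module R) \<Longrightarrow> m \<subset> L \<Longrightarrow> \<one> \<in> L"
    using RR.submodule_Zorn[OF assms] by blast
  have "maximalideal m R"
  proof (rule maximalidealI)
    show "ideal m R" using m(1) ideal_iff_submodule by simp
    show "carrier R \<noteq> m" using m(3) by blast
    fix J assume J: "ideal J R" "m \<subseteq> J" "J \<subseteq> carrier R"
    show "J = m \<or> J = carrier R"
    proof (cases "J = m")
      case False
      then have "\<one> \<in> J" using m(4)[of J] J ideal_iff_submodule by blast
      then show ?thesis using ideal.one_imp_carrier[OF J(1)] by simp
    qed simp
  qed
  then show ?thesis using m(2) by blast
qed

lemma maximalideal_submodule: "maximalideal m R \<Longrightarrow> submodule m R (regular_module R)"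
  using ideal_iff_submodule maximalideal_def by blast

text \<open>The ideal generated by \<open>m\<close> and \<open>c\<close> exceeds \<open>m\<close>
  and so contains \<open>\<one>\<close>. Invertibility modulo \<open>m\<close> in this form replaces
  the residue field throughout.\<close>

lemma maximalideal_inverse:
  assumes "maximalideal m R" "c \<in> carrier R" "c \<notin> m"
  shows "\<exists>d\<in>carrier R. \<exists>\<mu>\<in>m. \<one> = \<mu> \<oplus> c \<otimes> d"
proof -
  interpret RR: right_module R "regular_module R" by (rule regular_right_module)
  have c: "c \<in> carrier (regular_module R)" using assms(2) by simp
  note sm = maximalideal_submodule[OF assms(1)] and sc = RR.submodule_cyclic[OF c]
  let ?J = "m <+>\<^bsub>regular_module R\<^esub> RR.cyclic c"
  have J: "submodule ?J R (regular_module R)" by (rule RR.submodule_add[OF sm sc])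
  have "ideal ?J R" "m \<subseteq> ?J" "?J \<subseteq> carrier R" "?J \<noteq> m"
    using J RR.set_add_upper[OF sm sc] RR.mem_cyclic[OF c] assms(3)
    by (auto simp: ideal_iff_submodule regular_submodule_iff)
  then have "?J = carrier R" using maximalideal.I_maximal[OF assms(1)] by blast
  then have "\<one> \<in> ?J" by simp
  then show ?thesis unfolding RR.mem_set_add RR.cyclic_def by auto
qed

lemma maximalideal_one: "maximalideal m R \<Longrightarrow> \<one> \<notin> m"
  using ideal.one_imp_carrier maximalideal.I_notcarr maximalideal_def by metis

text \<open>\<open>artinian\<close> is about descending sequences of ideals; without a minimal
  ideal, dependent choice would produce a strictly descending one.\<close>

lemma artinian_minimal:
  assumes "artinian R" "P I0" "\<And>I. P I \<Longrightarrow> submodule I R (regular_module R)"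
  shows "\<exists>I. P I \<and> (\<forall>I'. P I' \<longrightarrow> \<not> I' \<subset> I)"
proof (rule ccontr)
  assume "\<nexists>I. P I \<and> (\<forall>I'. P I' \<longrightarrow> \<not> I' \<subset> I)"
  then have step: "\<exists>I'. P I' \<and> I' \<subset> I" if "P I" for I using that by blast
  obtain I where I: "\<And>n. P (I n) \<and> I (Suc n) \<subset> I n"
    using dependent_nat_choice[of "\<lambda>n I. P I" "\<lambda>n I I'. I' \<subset> I"] assms(2) step by metis
  have "\<forall>n. ideal (I n) R" using I assms(3) ideal_iff_submodule by blast
  moreover have "\<forall>n. I (Suc n) \<subseteq> I n" using I by blast
  ultimately have "\<exists>m. \<forall>n\<ge>m. I n = I m"
    using assms(1) unfolding artinian_def by blast
  then show False using I by (metis le_SucI order_refl psubset_eq)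
qed

text \<open>If \<open>m I = I\<close> for all maximal \<open>m\<close>, a minimal \<open>L\<close> with \<open>L I \<noteq> 0\<close> is generated by some \<open>x\<close>,
  and \<open>(x m) I = x I \<noteq> 0\<close> forces \<open>x m = L \<ni> x\<close>. So no \<open>m\<close> contains the annihilator of \<open>x\<close>, whence
  \<open>x = 0\<close>. This replaces the nilpotency of the radical.\<close>

lemma artinian_maximal_mult:
  assumes "artinian R" "submodule I R (regular_module R)" "I \<noteq> {\<zero>}"
  shows "\<exists>m U. maximalideal m R \<and> submodule U R (regular_module R) \<and> U \<subset> I \<and>
    (\<forall>\<mu>\<in>m. \<forall>y\<in>I. y \<otimes> \<mu> \<in> U)"
proof (rule ccontr)
  assume "\<not> ?thesis"
  \<comment> \<open>The negated claim turned around: a submodule of \<open>I\<close> that contains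
    all products of \<open>I\<close> with one maximal \<open>m\<close> is \<open>I\<close>
    itself.\<close>
  then have full: "U = I" if "maximalideal m R" "submodule U R (regular_module R)" "U \<subseteq> I"
    "\<And>\<mu> y. \<mu> \<in> m \<Longrightarrow> y \<in> I \<Longrightarrow> y \<otimes> \<mu> \<in> U" for m U using that by blast
  interpret RR: right_module R "regular_module R" by (rule regular_right_module)
  have IR: "y \<in> carrier R" if "y \<in> I" for y using that assms(2) unfolding regular_submodule_iff by blast
  define P where "P L \<longleftrightarrow> submodule L R (regular_module R) \<and> (\<exists>x\<in>L. \<exists>y\<in>I. x \<otimes> y \<noteq> \<zero>)" for L
  obtain y where y: "y \<in> I" "y \<noteq> \<zero>" using assms(2,3) unfolding regular_submodule_iff by blast
  then have "\<exists>x\<in>carrier R. \<exists>y\<in>I. x \<otimes> y \<noteq> \<zero>" using IR by (intro bexI[of _ \<one>] bexI[of _ y]) auto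
  then have "P (carrier R)" unfolding P_def using RR.carrier_submodule by simp
  then obtain L where PL: "P L" and min: "\<And>L'. P L' \<Longrightarrow> \<not> L' \<subset> L"
    using artinian_minimal[OF assms(1), of P] P_def by metis
  obtain x y where xy: "x \<in> L" "y \<in> I" "x \<otimes> y \<noteq> \<zero>" and L: "submodule L R (regular_module R)"
    using PL unfolding P_def by blast
  have x: "x \<in> carrier R" using xy(1) L unfolding regular_submodule_iff by blast
  have V: "\<exists>\<mu>\<in>m. x = x \<otimes> \<mu>" if m: "maximalideal m R" for m
  proof -
    note sm = maximalideal_submodule[OF m]
    have mR: "\<mu> \<in> carrier R" if "\<mu> \<in> m" for \<mu> using that sm unfolding regular_submodule_iff by blast
    define V where "V = (\<lambda>\<mu>. x \<otimes> \<mu>) ` m"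
    have sV: "submodule V R (regular_module R)"
      unfolding regular_submodule_iff
    proof (intro conjI ballI)
      show "V \<subseteq> carrier R" using x mR by (auto simp: V_def)
      show "\<zero> \<in> V" using sm x unfolding V_def regular_submodule_iff by (intro image_eqI[of _ _ \<zero>]) auto
    next
      fix a b assume "a \<in> V" "b \<in> V"
      then obtain \<mu> \<nu> where mn: "\<mu> \<in> m" "\<nu> \<in> m" "a = x \<otimes> \<mu>" "b = x \<otimes> \<nu>" unfolding V_def by blast
      then have "a \<oplus> b = x \<otimes> (\<mu> \<oplus> \<nu>)" using x mR by (simp add: r_distr)
      moreover have "\<mu> \<oplus> \<nu> \<in> m" using mn sm unfolding regular_submodule_iff by blast
      ultimately show "a \<oplus> b \<in> V" unfolding V_def by blast
    next
      fix a b assume a: "a \<in> carrier R" and "b \<in> V"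
      then obtain \<nu> where mn: "\<nu> \<in> m" "b = x \<otimes> \<nu>" unfolding V_def by blast
      then have "b \<otimes> a = x \<otimes> (\<nu> \<otimes> a)" using x mR a by (simp add: m_assoc)
      moreover have "\<nu> \<otimes> a \<in> m" using mn a sm unfolding regular_submodule_iff by blast
      ultimately show "b \<otimes> a \<in> V" unfolding V_def by blast
    qed
    have VL: "V \<subseteq> L" using L xy(1) mR unfolding V_def regular_submodule_iff by blast
    have "P V"
    proof (rule ccontr)
      assume "\<not> P V"
      then have z: "v \<otimes> w = \<zero>" if "v \<in> V" "w \<in> I" for v w using that sV unfolding P_def by blast
      \<comment> \<open>If all products of \<open>V\<close> and \<open>I\<close> were zero, the
        annihilator of \<open>x\<close> in \<open>I\<close> would contain the products of
        \<open>I\<close> and \<open>m\<close> and hence be \<open>I\<close>, against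
        \<open>x \<otimes> y \<noteq> \<zero>\<close>.\<close>
      define U where "U = {w \<in> I. x \<otimes> w = \<zero>}"
      have sU: "submodule U R (regular_module R)"
        using assms(2) x IR unfolding U_def regular_submodule_iff
        by (auto simp: r_distr subset_iff) (metis m_assoc l_null)
      have "U = I"
      proof (rule full[OF m sU])
        fix \<mu> w assume mw: "\<mu> \<in> m" "w \<in> I"
        have "x \<otimes> (w \<otimes> \<mu>) = x \<otimes> \<mu> \<otimes> w" using x IR[OF mw(2)] mR[OF mw(1)] by (simp add: m_ac)
        also have "\<dots> = \<zero>" using z mw unfolding V_def by blast
        finally show "w \<otimes> \<mu> \<in> U"
          using mw assms(2) mR[OF mw(1)] unfolding U_def regular_submodule_iff by blast
      qed (auto simp: U_def)
      then show False using xy(2,3) unfolding U_def by blast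
    qed
    then have "V = L" using min VL by blast
    then show ?thesis using xy(1) unfolding V_def by blast
  qed
  define N where "N = {c \<in> carrier R. x \<otimes> c = \<zero>}"
  have sN: "submodule N R (regular_module R)"
    using x unfolding N_def regular_submodule_iff
    by (auto simp: r_distr) (metis m_assoc l_null)
  have "\<one> \<in> N"
  proof (rule ccontr)
    assume "\<one> \<notin> N"
    then obtain m where m: "maximalideal m R" "N \<subseteq> m" using maximalideal_exists[OF sN] by blast
    note sm = maximalideal_submodule[OF m(1)]
    obtain \<mu> where mu: "\<mu> \<in> m" "x = x \<otimes> \<mu>" using V[OF m(1)] by blast
    have mR: "\<mu> \<in> carrier R" using mu sm unfolding regular_submodule_iff by blast
    \<comment> \<open>From \<open>x = x \<otimes> \<mu>\<close> the element
      \<open>\<one> \<ominus> \<mu>\<close> is in the annihilator \<open>N\<close>, hence in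
      \<open>m\<close>; together with \<open>\<mu>\<close> this puts \<open>\<one>\<close> into
      \<open>m\<close>.\<close>
    have "x \<otimes> (\<one> \<ominus> \<mu>) = x \<ominus> x \<otimes> \<mu>" using x mR by (simp add: r_distr a_minus_def r_minus)
    also have "\<dots> = \<zero>" using mu(2) x by (simp add: a_minus_def r_neg)
    finally have "\<one> \<ominus> \<mu> \<in> m" using m(2) mR unfolding N_def by auto
    then have "(\<one> \<ominus> \<mu>) \<oplus> \<mu> \<in> m" using mu(1) sm unfolding regular_submodule_iff by blast
    moreover have "(\<one> \<ominus> \<mu>) \<oplus> \<mu> = \<one>" using mR by (simp add: a_minus_def a_assoc l_neg)
    ultimately show False using maximalideal_one[OF m(1)] by simp
  qed
  then have "x = \<zero>" using x unfolding N_def by simp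
  then show False using xy(2,3) IR by simp
qed

text \<open>\<open>Q I\<close> says that the quotient by \<open>I\<close> has finite length,
  expressed by a measure for the submodules above \<open>I\<close>. A minimal such \<open>I\<close>
  is zero: otherwise \<open>I\<close> has a submodule \<open>L \<inter> I\<close> with simple
  quotient, and one more unit of length gives \<open>Q\<close> for the smaller
  \<open>L \<inter> I\<close>.\<close>

lemma artinian_finite_length:
  assumes "artinian R" shows "finite_length R (regular_module R)"
proof -
  interpret RR: right_module R "regular_module R" by (rule regular_right_module)
  define Q where "Q I \<longleftrightarrow> submodule I R (regular_module R) \<and> (\<exists>l :: 'a set \<Rightarrow> nat. \<forall>U V.
    submodule U R (regular_module R) \<longrightarrow> submodule V R (regular_module R) \<longrightarrow> I \<subseteq> U \<longrightarrow> U \<subset> V \<longrightarrow> l U < l V)" for I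
  have "Q (carrier R)" using RR.carrier_submodule unfolding Q_def by (auto simp: regular_submodule_iff)
  then obtain I where I: "Q I" and min: "\<And>I'. Q I' \<Longrightarrow> \<not> I' \<subset> I"
    using artinian_minimal[OF assms, of Q] Q_def by metis
  have sI: "submodule I R (regular_module R)" using I by (simp add: Q_def)
  obtain l where l: "\<And>U V. submodule U R (regular_module R) \<Longrightarrow> submodule V R (regular_module R) \<Longrightarrow> I \<subseteq> U \<Longrightarrow> U \<subset> V \<Longrightarrow> (l U :: nat) < l V"
    using I unfolding Q_def by blast
  have "I = {\<zero>}"
  proof (rule ccontr)
    assume "I \<noteq> {\<zero>}"
    then obtain m U0 where m: "maximalideal m R" and U0: "submodule U0 R (regular_module R)" "U0 \<subset> I"
      and mI: "\<And>\<mu> y. \<mu> \<in> m \<Longrightarrow> y \<in> I \<Longrightarrow> y \<otimes> \<mu> \<in> U0"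
      using artinian_maximal_mult[OF assms sI] by blast
    obtain x where x: "x \<in> I" "x \<notin> U0" using U0(2) by blast
    obtain L where L: "submodule L R (regular_module R)" "U0 \<subseteq> L" "x \<notin> L"
      "\<And>L'. submodule L' R (regular_module R) \<Longrightarrow> L \<subset> L' \<Longrightarrow> x \<in> L'"
      using RR.submodule_Zorn[OF U0(1) x(2)] by blast
    have IR: "y \<in> carrier R" if "y \<in> I" for y using that sI unfolding regular_submodule_iff by blast
    have LR: "y \<in> carrier R" if "y \<in> L" for y using that L(1) unfolding regular_submodule_iff by blast
    have sK: "submodule (L \<inter> I) R (regular_module R)" by (rule RR.submodule_Int[OF L(1) sI])
    \<comment> \<open>Simplicity of \<open>I\<close> over \<open>L \<inter> I\<close>. By the choice
      of \<open>L\<close>, a larger \<open>W\<close> contains \<open>x\<close>. For \<open>y\<close>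
      in \<open>I\<close> outside \<open>L\<close> also \<open>x = b \<oplus> y \<otimes> c\<close>
      with \<open>b\<close> in \<open>L\<close>, and \<open>c\<close> is outside \<open>m\<close>
      since the products of \<open>I\<close> and \<open>m\<close> lie in \<open>L\<close>; inverting
      \<open>c\<close> modulo \<open>m\<close> recovers \<open>y\<close> inside
      \<open>W\<close>.\<close>
    have K: "W = I" if W: "submodule W R (regular_module R)" "L \<inter> I \<subseteq> W" "W \<subseteq> I" "W \<noteq> L \<inter> I" for W
    proof -
      have "submodule (L <+>\<^bsub>regular_module R\<^esub> W) R (regular_module R)" by (rule RR.submodule_add[OF L(1) W(1)])
      moreover have "L \<subset> L <+>\<^bsub>regular_module R\<^esub> W"
        using RR.set_add_upper[OF L(1) W(1)] W by blast
      ultimately have "x \<in> L <+>\<^bsub>regular_module R\<^esub> W" by (rule L(4))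
      then obtain a w where a: "a \<in> L" "w \<in> W" "x = a \<oplus> w" by (auto simp: RR.mem_set_add)
      have "a \<in> I" using RR.submodule_cancel[OF sI, of a w] a x W(3) LR by auto
      then have xW: "x \<in> W" using a W(1,2) unfolding regular_submodule_iff by blast
      have "y \<in> W" if y: "y \<in> I" for y
      proof (cases "y \<in> L")
        case True then show ?thesis using y W(2) by blast
      next
        case False
        have yR: "y \<in> carrier (regular_module R)" using IR[OF y] by simp
        note sc = RR.submodule_cyclic[OF yR]
        have "submodule (L <+>\<^bsub>regular_module R\<^esub> RR.cyclic y) R (regular_module R)" by (rule RR.submodule_add[OF L(1) sc])
        moreover have "L \<subset> L <+>\<^bsub>regular_module R\<^esub> RR.cyclic y"
          using RR.set_add_upper[OF L(1) sc] RR.mem_cyclic[OF yR] False by blast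
        ultimately have "x \<in> L <+>\<^bsub>regular_module R\<^esub> RR.cyclic y" by (rule L(4))
        then obtain b c where b: "b \<in> L" "c \<in> carrier R" "x = b \<oplus> y \<otimes> c"
          unfolding RR.mem_set_add RR.cyclic_def by auto
        have "c \<notin> m"
        proof
          assume "c \<in> m"
          then have "y \<otimes> c \<in> L" using mI y L(2) by blast
          then show False using b L(1,3) unfolding regular_submodule_iff by blast
        qed
        then obtain d \<mu> where d: "d \<in> carrier R" "\<mu> \<in> m" "\<one> = \<mu> \<oplus> c \<otimes> d"
          using maximalideal_inverse[OF m b(2)] by blast
        have muR: "\<mu> \<in> carrier R" using d(2) maximalideal_submodule[OF m] unfolding regular_submodule_iff by blast
        have bR: "b \<in> carrier R" using LR b(1) by blast
        have yc: "y \<otimes> c \<in> I" using y b(2) sI unfolding regular_submodule_iff by blast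
        have "b \<in> I" using RR.submodule_cancel[OF sI, of b "y \<otimes> c"] b x(1) yc bR by simp
        then have bW: "b \<in> W" using b(1) W(2) by blast
        have "y \<otimes> c \<oplus> b \<in> W" using xW b(3) bR IR[OF y] b(2) by (simp add: a_comm)
        then have "y \<otimes> c \<in> W" using RR.submodule_cancel[OF W(1), of "y \<otimes> c" b] bW IR[OF yc] by simp
        then have "y \<otimes> c \<otimes> d \<in> W" using d(1) W(1) unfolding regular_submodule_iff by blast
        moreover have "y \<otimes> \<mu> \<in> W" using mI[OF d(2) y] U0(2) L(2) W(2) by blast
        ultimately have "y \<otimes> \<mu> \<oplus> y \<otimes> c \<otimes> d \<in> W" using W(1) unfolding regular_submodule_iff by blast
        moreover have "y \<otimes> \<mu> \<oplus> y \<otimes> c \<otimes> d = y \<otimes> (\<mu> \<oplus> c \<otimes> d)"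
          using IR[OF y] muR b(2) d(1) by (simp add: r_distr m_assoc)
        ultimately show "y \<in> W" using IR[OF y] by (simp flip: d(3))
      qed
      then show ?thesis using W(3) by blast
    qed
    have "Q (L \<inter> I)"
      unfolding Q_def
    proof (intro conjI exI allI impI, rule sK)
      fix U V assume U: "submodule U R (regular_module R)" and V: "submodule V R (regular_module R)"
        and LU: "L \<inter> I \<subseteq> U" and less: "U \<subset> V"
      let ?s = "\<lambda>U. U <+>\<^bsub>regular_module R\<^esub> I"
      note sU = RR.submodule_add[OF U sI] and sV = RR.submodule_add[OF V sI]
      note uU = RR.set_add_upper[OF U sI] and uV = RR.set_add_upper[OF V sI]
      have le: "?s U \<subseteq> ?s V" by (rule RR.set_add_least[OF sV]) (use less uV in auto)
      \<comment> \<open>\<open>U\<close> is measured by \<open>U + I\<close>, which the old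
        \<open>l\<close> sees, and by \<open>U \<inter> I\<close>, which is either
        \<open>L \<inter> I\<close> or \<open>I\<close> and so contributes 0 or 1.\<close>
      show "l (?s U) + (if I \<subseteq> U then 1 else 0) < l (?s V) + (if I \<subseteq> V then 1 else 0)"
      proof (cases "?s U = ?s V")
        case False
        then have "l (?s U) < l (?s V)" using l[OF sU sV uU(2)] le by blast
        moreover have "I \<subseteq> U \<Longrightarrow> I \<subseteq> V" using less by blast
        ultimately show ?thesis by auto
      next
        case True
        have "\<not> I \<subseteq> U"
        proof
          assume "I \<subseteq> U"
          then have "?s U \<subseteq> U" by (intro RR.set_add_least[OF U]) auto
          then show False using True uV(1) less by blast
        qed
        moreover have "I \<subseteq> V"
        proof (rule ccontr)
          assume "\<not> I \<subseteq> V"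
          then have VI: "V \<inter> I = L \<inter> I" using K[OF RR.submodule_Int[OF V sI]] LU less by blast
          have "V \<subseteq> U"
          proof
            fix v assume v: "v \<in> V"
            then have "v \<in> ?s U" using uV(1) True by blast
            then obtain u i where ui: "u \<in> U" "i \<in> I" "v = u \<oplus> i" by (auto simp: RR.mem_set_add)
            have uR: "u \<in> carrier R" using ui(1) U unfolding regular_submodule_iff by blast
            have "i \<oplus> u \<in> V" using v ui(3) uR IR[OF ui(2)] by (simp add: a_comm)
            then have "i \<in> V" using RR.submodule_cancel[OF V, of i u] ui(1) less IR[OF ui(2)] by auto
            then have "i \<in> U" using VI ui(2) LU by blast
            then show "v \<in> U" using ui U unfolding regular_submodule_iff by blast
          qed
          then show False using less by blast
        qed
        ultimately show ?thesis using True by simp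
      qed
    qed
    moreover have "L \<inter> I \<subset> I" using x(1) L(3) by blast
    ultimately show False using min by blast
  qed
  then show ?thesis
    by (intro finite_lengthI[of R "regular_module R" l] l) (auto simp: regular_submodule_iff)
qed

end

section \<open>Artin algebras and projective covers\<close>

lemma opp_simps [simp]:
  "carrier (opp_ring A) = carrier A" "zero (opp_ring A) = zero A" "one (opp_ring A) = one A"
  "add (opp_ring A) = add A" "mult (opp_ring A) = (\<lambda>x y. y \<otimes>\<^bsub>A\<^esub> x)"
  by (simp_all add: opp_ring_def)

lemma opp_opp [simp]: "opp_ring (opp_ring A) = A"
  by (cases A) (simp add: opp_ring_def)

lemma ring_opp: assumes "ring A" shows "ring (opp_ring A)"
proof -
  interpret ring A by fact
  have "abelian_group (opp_ring A)"
    by (rule abelian_groupI) (auto simp: a_ac add.l_inv_ex)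
  moreover have "monoid (opp_ring A)"
    by (rule monoidI) (auto simp: m_assoc)
  ultimately show ?thesis
    by (intro ringI) (auto simp: abelian_group.axioms l_distr r_distr)
qed

lemma restrict_scalars_simps [simp]:
  "carrier (restrict_scalars \<phi> M) = carrier M" "zero (restrict_scalars \<phi> M) = zero M"
  "add (restrict_scalars \<phi> M) = add M" "smult (restrict_scalars \<phi> M) = (\<lambda>c. smult M (\<phi> c))"
  by (simp_all add: restrict_scalars_def)

lemma artin_algebraD:
  assumes "artin_algebra k \<phi> A"
  shows "cring k" "ring A" "artinian k" "c \<in> carrier k \<Longrightarrow> \<phi> c \<in> carrier A"
    "\<phi> \<one>\<^bsub>k\<^esub> = \<one>\<^bsub>A\<^esub>"
    "\<lbrakk>c \<in> carrier k; d \<in> carrier k\<rbrakk> \<Longrightarrow> \<phi> (c \<oplus>\<^bsub>k\<^esub> d) = \<phi> c \<oplus>\<^bsub>A\<^esub> \<phi> d"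
    "\<lbrakk>c \<in> carrier k; d \<in> carrier k\<rbrakk> \<Longrightarrow> \<phi> (c \<otimes>\<^bsub>k\<^esub> d) = \<phi> c \<otimes>\<^bsub>A\<^esub> \<phi> d"
    "\<lbrakk>c \<in> carrier k; a \<in> carrier A\<rbrakk> \<Longrightarrow> \<phi> c \<otimes>\<^bsub>A\<^esub> a = a \<otimes>\<^bsub>A\<^esub> \<phi> c"
    "fg_module k (restrict_scalars \<phi> (regular_module A))"
  using assms by (auto simp: artin_algebra_def ring_hom_def)

lemma restrict_scalars_right_module:
  assumes "artin_algebra k \<phi> A" "right_module A M"
  shows "right_module k (restrict_scalars \<phi> M)"
proof -
  interpret k: cring k using artin_algebraD(1)[OF assms(1)] .
  interpret M: right_module A M by fact
  note a = artin_algebraD[OF assms(1)]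
  have "abelian_group (restrict_scalars \<phi> M)"
    by (rule abelian_groupI) (auto simp: M.a_ac M.add.l_inv_ex)
  moreover have "right_module_axioms k (restrict_scalars \<phi> M)"
  proof
    fix c d x assume cd: "c \<in> carrier k" "d \<in> carrier k" and "x \<in> carrier (restrict_scalars \<phi> M)"
    then show "(c \<otimes>\<^bsub>k\<^esub> d) \<odot>\<^bsub>restrict_scalars \<phi> M\<^esub> x = d \<odot>\<^bsub>restrict_scalars \<phi> M\<^esub> (c \<odot>\<^bsub>restrict_scalars \<phi> M\<^esub> x)"
      using a(4) by (simp add: a(7) M.smult_assoc)
  qed (use a(4) in \<open>auto simp: a(5,6) M.smult_l_distr M.smult_r_distr\<close>)
  ultimately show ?thesis using k.ring_axioms by (simp add: right_module_def)
qed

lemma restrict_scalars_Hom: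
  assumes "artin_algebra k \<phi> A" "f \<in> Hom A M N"
  shows "f \<in> Hom k (restrict_scalars \<phi> M) (restrict_scalars \<phi> N)"
  using artin_algebraD(4)[OF assms(1)] Hom_extensional[OF assms(2)]
  by (intro HomI) (auto simp: Hom_closed[OF assms(2)] Hom_add[OF assms(2)] Hom_smult[OF assms(2)])

lemma restrict_scalars_submoduleI:
  assumes "artin_algebra k \<phi> A" "right_module A M" "submodule N A M"
  shows "submodule N k (restrict_scalars \<phi> M)"
  using assms(3) artin_algebraD(4)[OF assms(1)]
  unfolding right_module.submodule_iff[OF assms(2)]
    right_module.submodule_iff[OF restrict_scalars_right_module[OF assms(1,2)]] by simp

text \<open>Every \<open>A\<close>-submodule is a \<open>k\<close>-submodule, so a measure over
  \<open>k\<close> also serves over \<open>A\<close>.\<close>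

lemma restrict_scalars_finite_length:
  assumes "artin_algebra k \<phi> A" "right_module A M" "finite_length k (restrict_scalars \<phi> M)"
  shows "finite_length A M"
proof -
  obtain l where l: "\<And>U V. submodule U k (restrict_scalars \<phi> M) \<Longrightarrow> submodule V k (restrict_scalars \<phi> M) \<Longrightarrow>
      U \<subset> V \<Longrightarrow> (l U :: nat) < l V"
    using finite_lengthE[OF assms(3)] by blast
  show ?thesis
    by (rule finite_lengthI[of _ _ l]) (intro l restrict_scalars_submoduleI[OF assms(1,2)])
qed

text \<open>The generators over \<open>k\<close> are the products of generators \<open>s\<close> of
  \<open>M\<close> with \<open>k\<close>-generators \<open>b\<close> of \<open>A\<close>. For fixed
  \<open>s\<close>, the scalars that carry \<open>s\<close> into \<open>N\<close> form a
  \<open>k\<close>-submodule of \<open>A\<close> containing all \<open>b\<close>, hence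
  \<open>A\<close>.\<close>

lemma restrict_scalars_fg:
  assumes "artin_algebra k \<phi> A" "fg_module A M"
  shows "fg_module k (restrict_scalars \<phi> M)"
proof -
  note a = artin_algebraD[OF assms(1)]
  have M: "right_module A M" using assms(2) by (rule fg_moduleD)
  interpret M: right_module A M by fact
  have kM: "right_module k (restrict_scalars \<phi> M)" by (rule restrict_scalars_right_module[OF assms(1) M])
  have AA: "right_module A (regular_module A)" by (rule right_module_regular[OF a(2)])
  have kA: "right_module k (restrict_scalars \<phi> (regular_module A))"
    by (rule restrict_scalars_right_module[OF assms(1) AA])
  obtain S where S: "finite S" "S \<subseteq> carrier M" and gS: "\<forall>N. submodule N A M \<and> S \<subseteq> N \<longrightarrow> N = carrier M"
    using assms(2) unfolding fg_module_def by (elim conjE exE)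
  obtain B where B: "finite B" "B \<subseteq> carrier A"
    and gB: "\<forall>N. submodule N k (restrict_scalars \<phi> (regular_module A)) \<and> B \<subseteq> N \<longrightarrow> N = carrier A"
    using a(9) unfolding fg_module_def by auto
  let ?T = "(\<lambda>(s, b). b \<odot>\<^bsub>M\<^esub> s) ` (S \<times> B)"
  have "N = carrier M" if N: "submodule N k (restrict_scalars \<phi> M)" "?T \<subseteq> N" for N
  proof -
    have N0: "N \<subseteq> carrier M" "\<zero>\<^bsub>M\<^esub> \<in> N" and N1: "\<And>x y. x \<in> N \<Longrightarrow> y \<in> N \<Longrightarrow> x \<oplus>\<^bsub>M\<^esub> y \<in> N"
      and N2: "\<And>c x. c \<in> carrier k \<Longrightarrow> x \<in> N \<Longrightarrow> \<phi> c \<odot>\<^bsub>M\<^esub> x \<in> N"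
      using N(1) unfolding right_module.submodule_iff[OF kM] by auto
    have s: "a \<odot>\<^bsub>M\<^esub> s \<in> N" if s: "s \<in> S" and a': "a \<in> carrier A" for s a
    proof -
      have sM: "s \<in> carrier M" using s S by blast
      have "submodule {a \<in> carrier A. a \<odot>\<^bsub>M\<^esub> s \<in> N} k (restrict_scalars \<phi> (regular_module A))"
        unfolding right_module.submodule_iff[OF kA] using sM a(4) N0 N1 N2
        by (auto simp: M.smult_l_distr M.smult_assoc)
      moreover have "B \<subseteq> {a \<in> carrier A. a \<odot>\<^bsub>M\<^esub> s \<in> N}" using B(2) N(2) s by auto
      ultimately have "{a \<in> carrier A. a \<odot>\<^bsub>M\<^esub> s \<in> N} = carrier A" using gB by blast
      then show ?thesis using a' by blast
    qed
    \<comment> \<open>The largest \<open>A\<close>-submodule inside the \<open>k\<close>-submodule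
      \<open>N\<close>; it contains \<open>S\<close> and is therefore everything.\<close>
    let ?N = "{x \<in> carrier M. \<forall>a\<in>carrier A. a \<odot>\<^bsub>M\<^esub> x \<in> N}"
    have "submodule ?N A M"
      unfolding M.submodule_iff using N0 N1 by (auto simp: M.smult_r_distr simp flip: M.smult_assoc)
    moreover have "S \<subseteq> ?N" using s S by blast
    ultimately have "?N = carrier M" using gS by blast
    moreover have "?N \<subseteq> N" using M.smult_one M.R.one_closed by force
    ultimately show ?thesis using N0 by simp
  qed
  then show ?thesis
    unfolding fg_module_def using kM S B by (intro conjI exI[of _ ?T]) auto
qed

lemma artin_regular_finite_length:
  assumes "artin_algebra k \<phi> A" shows "finite_length A (regular_module A)"
proof -
  note a = artin_algebraD[OF assms]
  have "finite_length k (restrict_scalars \<phi> (regular_module A))"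
    by (rule fg_finite_length[OF cring.artinian_finite_length[OF a(1,3)] a(9)])
  then show ?thesis by (rule restrict_scalars_finite_length[OF assms right_module_regular[OF a(2)]])
qed

text \<open>The image of \<open>\<phi>\<close> is central, so left and right multiplication by it
  agree: \<open>\<phi>\<close> stays a ring homomorphism into the opposite ring, and the identity is
  \<open>k\<close>-linear between the two regular modules.\<close>

lemma artin_algebra_opp:
  assumes "artin_algebra k \<phi> A" shows "artin_algebra k \<phi> (opp_ring A)"
proof -
  note a = artin_algebraD[OF assms]
  interpret k: cring k by (rule a(1))
  have R: "ring (opp_ring A)" by (rule ring_opp[OF a(2)])
  have h: "\<phi> \<in> ring_hom k (opp_ring A)"
  proof (rule ring_hom_memI)
    fix c d assume c: "c \<in> carrier k" and d: "d \<in> carrier k"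
    then show "\<phi> (c \<otimes>\<^bsub>k\<^esub> d) = \<phi> c \<otimes>\<^bsub>opp_ring A\<^esub> \<phi> d"
      using a(7)[OF c d] a(8)[OF c a(4)[OF d]] by simp
  qed (simp_all add: a(4-6))
  have AA: "right_module k (restrict_scalars \<phi> (regular_module A))"
    by (rule restrict_scalars_right_module[OF assms right_module_regular[OF a(2)]])
  interpret AA: right_module k "restrict_scalars \<phi> (regular_module A)" by fact
  let ?B = "restrict_scalars \<phi> (regular_module (opp_ring A))"
  have B: "right_module k ?B"
    by (rule right_moduleI_image[OF AA, of "\<lambda>x. x"]) (simp_all add: a(8)[symmetric])
  have i: "(\<lambda>x\<in>carrier (restrict_scalars \<phi> (regular_module A)). x) \<in> Hom k (restrict_scalars \<phi> (regular_module A)) ?B"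
    by (rule restrict_HomI[OF AA]) (simp_all add: a(8)[symmetric])
  have "fg_module k ?B"
    by (rule fg_module_surj[OF a(9) B i]) auto
  then show ?thesis
    unfolding artin_algebra_def using R h a(1,3) by (simp add: a(8)[symmetric])
qed

text \<open>Let \<open>l\<close> map a free module \<open>F\<close> onto \<open>X\<close> and let \<open>L \<subseteq> F\<close> be minimal with \<open>l L = X\<close>. A lift
  \<open>q : F \<rightarrow> L\<close> of \<open>l\<close> along \<open>L \<rightarrow> X\<close> maps \<open>L\<close> onto \<open>L\<close> by minimality, hence bijectively by finite
  length, so \<open>L\<close> is a retract of \<open>F\<close>.\<close>

lemma projective_cover_exists:
  assumes "finite_length A (regular_module A)" "fg_module A X"
  shows "\<exists>(P :: ('a, nat \<Rightarrow> 'a) module) p. projective_cover (A :: ('a, 'r) ring_scheme) X P p"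
proof -
  have X: "right_module A X" using assms(2) by (rule fg_moduleD)
  have R: "ring A" using X by (rule right_module_ring)
  from assms(2) obtain n :: nat and m where m: "\<forall>i<n. m i \<in> carrier X"
    and gen: "\<forall>x\<in>carrier X. \<exists>c\<in>{..<n} \<rightarrow>\<^sub>E carrier A. x = finsum X (\<lambda>i. c i \<odot>\<^bsub>X\<^esub> m i) {..<n}"
    unfolding fg_module_iff_generators by (elim conjE exE)
  define F where "F = free_module A n"
  have F: "right_module A F" unfolding F_def by (rule right_module_free[OF R])
  interpret F: right_module A F by fact
  have PF: "fg_projective A F" unfolding F_def
    by (rule dual_basis_projective[OF right_module_free[OF R] dual_basis_free[OF R]])
  have FF: "finite_length A F" by (rule fg_finite_length[OF assms(1) projectiveD(1)[OF PF]])
  define l where "l = (\<lambda>c\<in>carrier F. finsum X (\<lambda>i. c i \<odot>\<^bsub>X\<^esub> m i) {..<n})"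
  have l: "l \<in> Hom A F X" unfolding l_def F_def using lincomb_Hom[OF X] m by blast
  have "x \<in> l ` carrier F" if "x \<in> carrier X" for x
    using gen[rule_format, OF that] by (auto simp: l_def F_def)
  then have lsurj: "l ` carrier F = carrier X" using Hom_closed[OF l] by blast
  define Q where "Q U \<longleftrightarrow> submodule U A F \<and> l ` U = carrier X" for U
  have "Q (carrier F)" unfolding Q_def using F.carrier_submodule lsurj by blast
  moreover have "\<And>U. Q U \<Longrightarrow> submodule U A F" by (simp add: Q_def)
  ultimately obtain L where QL: "Q L" and min: "\<forall>U. Q U \<longrightarrow> \<not> U \<subset> L"
    using finite_length_minimal[OF FF, of Q] by blast
  have L: "submodule L A F" and lL: "l ` L = carrier X" using QL by (simp_all add: Q_def)
  have LF: "L \<subseteq> carrier F" using L by (simp add: F.submodule_iff)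
  define P where "P = F\<lparr>carrier := L\<rparr>"
  have [simp]: "carrier P = L" by (simp add: P_def)
  have P: "right_module A P" unfolding P_def by (rule submodule_right_module[OF F L])
  define p where "p = (\<lambda>x\<in>L. l x)"
  have p: "p \<in> Hom A P X" unfolding p_def P_def by (rule Hom_restrict[OF F L l])
  have psurj: "p ` carrier P = carrier X" using lL by (simp add: p_def)
  obtain q where q: "q \<in> Hom A F P" and pq: "\<And>x. x \<in> carrier F \<Longrightarrow> p (q x) = l x"
    using projective_lift[OF PF P X p l] lsurj psurj by blast
  have qL: "q x \<in> L" if "x \<in> carrier F" for x using Hom_closed[OF q that] by simp
  have qF: "q \<in> Hom A F F" using Hom_from_into_submodule[OF q[unfolded P_def] LF] .
  have "Q (q ` L)"
    unfolding Q_def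
  proof
    show "submodule (q ` L) A F" by (rule Hom_image_submodule[OF F F qF L])
    have "l ` q ` L = (\<lambda>x. l (q x)) ` L" by (simp add: image_image)
    also have "\<dots> = l ` L"
    proof (rule image_cong[OF refl])
      fix x assume "x \<in> L"
      then have xF: "x \<in> carrier F" using LF by blast
      show "l (q x) = l x" using pq[OF xF] qL[OF xF] by (simp add: p_def)
    qed
    finally show "l ` q ` L = carrier X" using lL by simp
  qed
  moreover have "q ` L \<subseteq> L" using qL LF by blast
  ultimately have qLL: "q ` L = L" using min by blast
  define q' where "q' = (\<lambda>x\<in>L. q x)"
  have q': "q' \<in> Hom A P P" unfolding q'_def using Hom_restrict[OF F L q] by (simp add: P_def)
  have q's: "q' ` carrier P = carrier P" using qLL by (simp add: q'_def)
  have FP: "finite_length A P" unfolding P_def by (rule finite_length_submodule[OF F FF L])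
  have q'i: "q' \<in> module_iso A P P"
    using surjective_endo_inj[OF P FP q' q's] q' q's by (simp add: module_iso_def bij_betw_def)
  define i where "i = (\<lambda>y\<in>carrier P. inv_into (carrier P) q' y)"
  have i: "i \<in> Hom A P P" using module_iso_inv[OF P P q'i] by (simp add: module_iso_def i_def)
  have iq: "i (q x) = x" if "x \<in> L" for x
  proof -
    have "bij_betw q' L L" using q'i by (simp add: module_iso_def)
    then have "i (q' x) = x" using that Hom_closed[OF q'] 
      by (simp add: i_def bij_betw_inv_into_left)
    then show ?thesis using that by (simp add: q'_def)
  qed
  have "fg_projective A P"
  proof (rule projective_retract[OF PF P])
    \<comment> \<open>The retraction onto \<open>P\<close> is \<open>q\<close> corrected by the
      inverse \<open>i\<close> of its restriction to \<open>L\<close>.\<close>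
    show "(\<lambda>x\<in>carrier F. i (q x)) \<in> Hom A F P" by (rule Hom_comp[OF F q i])
    show "(\<lambda>x\<in>L. x) \<in> Hom A P F" unfolding P_def by (rule Hom_inclusion[OF F L])
    fix x assume "x \<in> carrier P"
    then have "x \<in> L" "x \<in> carrier F" using LF by auto
    then show "(\<lambda>x\<in>carrier F. i (q x)) ((\<lambda>x\<in>L. x) x) = x" using iq by simp
  qed
  moreover have "N = carrier P" if N: "submodule N A P" "N <+>\<^bsub>P\<^esub> a_kernel P X p = carrier P" for N
  proof -
    have N': "submodule N A F" "N \<subseteq> L" using N(1) submodule_trans_iff[OF F L] unfolding P_def by auto
    have "l x \<in> l ` N" if x: "x \<in> L" for x
    proof -
      have "x \<in> N <+>\<^bsub>P\<^esub> a_kernel P X p" using x N(2) by simp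
      then obtain y z where yz: "y \<in> N" "z \<in> L" "p z = \<zero>\<^bsub>X\<^esub>" "x = y \<oplus>\<^bsub>F\<^esub> z"
        by (auto simp: set_add_def' P_def a_kernel_eq)
      have "l x = l y \<oplus>\<^bsub>X\<^esub> l z" using yz N' LF by (auto intro: Hom_add[OF l])
      moreover have "l z = \<zero>\<^bsub>X\<^esub>" using yz by (simp add: p_def)
      moreover have "l y \<in> carrier X" using yz(1) N' LF Hom_closed[OF l] by blast
      ultimately have "l x = l y" using X by (simp add: right_module_def abelian_group_def abelian_monoid.r_zero)
      then show ?thesis using yz(1) by blast
    qed
    then have "l ` L \<subseteq> l ` N" by (rule image_subsetI)
    then have "l ` N = carrier X" using lL image_mono[OF N'(2), of l] by simp
    then have "Q N" using N' by (simp add: Q_def)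
    then show ?thesis using min N'(2) by auto
  qed
  ultimately have "projective_cover A X P p"
    unfolding projective_cover_def using p psurj by blast
  then show ?thesis by blast
qed

lemma proj_cover:
  assumes "finite_length A (regular_module A)" "fg_module A X"
  shows "projective_cover A X (fst (proj_cover A X)) (snd (proj_cover A X))"
proof -
  have "\<exists>Pp. case Pp of (P :: ('a, nat \<Rightarrow> 'a) module, p) \<Rightarrow> projective_cover A X P p"
    using projective_cover_exists[OF assms] by auto
  from someI_ex[OF this] show ?thesis
    unfolding proj_cover_def[symmetric] by (simp add: case_prod_beta)
qed

lemma projective_coverD:
  assumes "projective_cover A X P p"
  shows "fg_projective A P" "p \<in> Hom A P X" "p ` carrier P = carrier X"
  using assms by (auto simp: projective_cover_def)

lemma syzygy_eq:
  "syzygy A X = (fst (proj_cover A X))\<lparr>carrier := a_kernel (fst (proj_cover A X)) X (snd (proj_cover A X))\<rparr>"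
  by (simp add: syzygy_def case_prod_beta)

lemma syzygy_submodule:
  assumes "finite_length A (regular_module A)" "fg_module A X"
  shows "submodule (carrier (syzygy A X)) A (fst (proj_cover A X))"
proof -
  note pc = projective_coverD[OF proj_cover[OF assms]]
  show ?thesis
    using Hom_kernel_submodule[OF projectiveD(2)[OF pc(1)] fg_moduleD[OF assms(2)] pc(2)] by (simp add: syzygy_eq)
qed

lemma fg_syzygy:
  assumes "finite_length A (regular_module A)" "fg_module A X"
  shows "fg_module A (syzygy A X)"
proof -
  note pc = projectiveD[OF projective_coverD(1)[OF proj_cover[OF assms]]]
  show ?thesis
    using finite_length_fg[OF pc(2) fg_finite_length[OF assms(1) pc(1)] syzygy_submodule[OF assms]]
    by (simp add: syzygy_eq)
qed

section \<open>Comparison of projective resolutions\<close>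

lemma projective_resolutionD:
  assumes "projective_resolution A X P d e"
  shows "fg_projective A (P n)" "right_module A (P n)" "d n \<in> Hom A (P (Suc n)) (P n)"
    "e \<in> Hom A (P 0) X" "e ` carrier (P 0) = carrier X"
    "x \<in> carrier (P 0) \<Longrightarrow> e x = \<zero>\<^bsub>X\<^esub> \<longleftrightarrow> x \<in> d 0 ` carrier (P (Suc 0))"
    "x \<in> carrier (P (Suc n)) \<Longrightarrow> d n x = \<zero>\<^bsub>P n\<^esub> \<longleftrightarrow> x \<in> d (Suc n) ` carrier (P (Suc (Suc n)))"
proof -
  note r = assms[unfolded projective_resolution_def]
  show "d n \<in> Hom A (P (Suc n)) (P n)"
    "e \<in> Hom A (P 0) X" "e ` carrier (P 0) = carrier X" using r by simp_all
  show P: "fg_projective A (P n)" using r by simp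
  show "right_module A (P n)" by (rule projectiveD(2)[OF P])
  have "a_kernel (P 0) X e = d 0 ` carrier (P (Suc 0))"
    "a_kernel (P (Suc n)) (P n) (d n) = d (Suc n) ` carrier (P (Suc (Suc n)))" using r by simp_all
  then show "x \<in> carrier (P 0) \<Longrightarrow> e x = \<zero>\<^bsub>X\<^esub> \<longleftrightarrow> x \<in> d 0 ` carrier (P (Suc 0))"
    "x \<in> carrier (P (Suc n)) \<Longrightarrow> d n x = \<zero>\<^bsub>P n\<^esub> \<longleftrightarrow> x \<in> d (Suc n) ` carrier (P (Suc (Suc n)))"
    unfolding a_kernel_eq by blast+
qed

lemma projective_resolution_square:
  assumes "projective_resolution A X P d e" "x \<in> carrier (P (Suc (Suc n)))"
  shows "d n (d (Suc n) x) = \<zero>\<^bsub>P n\<^esub>"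
  using projective_resolutionD(7)[OF assms(1) Hom_closed[OF projective_resolutionD(3)[OF assms(1)] assms(2)]] assms(2)
  by blast

text \<open>The comparison theorem. The map in degree \<open>n\<close> is chosen together with the
  invariant that its composite with \<open>d n\<close> takes values in the image of
  \<open>d' n\<close>, which is what the next lift needs; in degree 0 the augmentations provide
  it.\<close>

lemma chain_map_exists:
  assumes X: "right_module A X"
    and P: "projective_resolution A X P d e" and Q: "projective_resolution A X Q d' e'"
  shows "\<exists>f. (\<forall>n. f n \<in> Hom A (P n) (Q n)) \<and> (\<forall>x\<in>carrier (P 0). e' (f 0 x) = e x) \<and>
    (\<forall>n. \<forall>x\<in>carrier (P (Suc n)). d' n (f (Suc n) x) = f n (d n x))"
proof -
  note p = projective_resolutionD[OF P] and q = projective_resolutionD[OF Q]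
  define I where "I n f \<longleftrightarrow> f \<in> Hom A (P n) (Q n) \<and> (n = 0 \<longrightarrow> (\<forall>x\<in>carrier (P 0). e' (f x) = e x)) \<and>
    (\<forall>x\<in>carrier (P (Suc n)). f (d n x) \<in> d' n ` carrier (Q (Suc n)))" for n f
  define S where "S n f g \<longleftrightarrow> (\<forall>x\<in>carrier (P (Suc n)). d' n (g x) = f (d n x))" for n f g
  have "\<exists>f. \<forall>n. I n (f n) \<and> S n (f n) (f (Suc n))"
  proof (rule dependent_nat_choice)
    obtain h where h: "h \<in> Hom A (P 0) (Q 0)" "\<And>x. x \<in> carrier (P 0) \<Longrightarrow> e' (h x) = e x"
      using projective_lift[OF p(1) q(2) X q(4) p(4)] p(5) q(5) by blast
    have "h (d 0 x) \<in> d' 0 ` carrier (Q (Suc 0))" if x: "x \<in> carrier (P (Suc 0))" for x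
    proof -
      have dx: "d 0 x \<in> carrier (P 0)" by (rule Hom_closed[OF p(3) x])
      have "e (d 0 x) = \<zero>\<^bsub>X\<^esub>" using p(6)[OF dx] x by blast
      then show ?thesis using q(6)[OF Hom_closed[OF h(1) dx]] h(2)[OF dx] by simp
    qed
    then show "\<exists>f. I 0 f" using h unfolding I_def by blast
  next
    fix f n assume "I n f"
    then have f: "f \<in> Hom A (P n) (Q n)" "\<And>x. x \<in> carrier (P (Suc n)) \<Longrightarrow> f (d n x) \<in> d' n ` carrier (Q (Suc n))"
      unfolding I_def by blast+
    let ?t = "\<lambda>x\<in>carrier (P (Suc n)). f (d n x)"
    have t: "?t \<in> Hom A (P (Suc n)) (Q n)" by (rule Hom_comp[OF p(2,3) f(1)])
    have tsub: "?t ` carrier (P (Suc n)) \<subseteq> d' n ` carrier (Q (Suc n))" using f(2) by auto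
    obtain h where h: "h \<in> Hom A (P (Suc n)) (Q (Suc n))"
      and dh: "\<And>x. x \<in> carrier (P (Suc n)) \<Longrightarrow> d' n (h x) = ?t x"
      using projective_lift[OF p(1) q(2,2,3) t tsub] by blast
    have "h (d (Suc n) x) \<in> d' (Suc n) ` carrier (Q (Suc (Suc n)))" if x: "x \<in> carrier (P (Suc (Suc n)))" for x
    proof -
      have dx: "d (Suc n) x \<in> carrier (P (Suc n))" by (rule Hom_closed[OF p(3) x])
      have "d' n (h (d (Suc n) x)) = f (d n (d (Suc n) x))" using dh[OF dx] dx by simp
      also have "\<dots> = \<zero>\<^bsub>Q n\<^esub>"
        using projective_resolution_square[OF P x] Hom_zero[OF p(2) q(2) f(1)] by simp
      finally show ?thesis using q(7)[OF Hom_closed[OF h dx]] by simp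
    qed
    then have "I (Suc n) h" using h unfolding I_def by blast
    moreover have "S n f h" using dh unfolding S_def by simp
    ultimately show "\<exists>g. I (Suc n) g \<and> S n f g" by blast
  qed
  then obtain f where f: "\<And>n. I n (f n)" "\<And>n. S n (f n) (f (Suc n))" by blast
  have "f n \<in> Hom A (P n) (Q n)" for n using f(1)[of n] by (simp add: I_def)
  moreover have "\<forall>x\<in>carrier (P 0). e' (f 0 x) = e x" using f(1)[of 0] by (simp add: I_def)
  moreover have "\<forall>x\<in>carrier (P (Suc n)). d' n (f (Suc n) x) = f n (d n x)" for n
    using f(2)[of n] by (simp add: S_def)
  ultimately show ?thesis by blast
qed

text \<open>A chain map over the identity of \<open>X\<close> is homotopic to the identity. The
  identity is recorded in positive degrees, where the comparison of Ext uses it.\<close>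

lemma chain_homotopy_exists:
  assumes X: "right_module A X" and Q: "projective_resolution A X Q d e"
    and c: "\<And>n. c n \<in> Hom A (Q n) (Q n)" and ce: "\<And>x. x \<in> carrier (Q 0) \<Longrightarrow> e (c 0 x) = e x"
    and cd: "\<And>n x. x \<in> carrier (Q (Suc n)) \<Longrightarrow> d n (c (Suc n) x) = c n (d n x)"
  shows "\<exists>s. (\<forall>n. s n \<in> Hom A (Q n) (Q (Suc n))) \<and>
    (\<forall>n. \<forall>x\<in>carrier (Q (Suc n)). d (Suc n) (s (Suc n) x) = c (Suc n) x \<ominus>\<^bsub>Q (Suc n)\<^esub> x \<ominus>\<^bsub>Q (Suc n)\<^esub> s n (d n x))"
proof -
  note q = projective_resolutionD[OF Q]
  have diff: "(\<lambda>x\<in>carrier (Q n). c n x \<ominus>\<^bsub>Q n\<^esub> x) \<in> Hom A (Q n) (Q n)" for n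
    using Hom_sub[OF q(2)[of n] q(2)[of n] c Hom_id[OF q(2)]] by (simp cong: restrict_cong)
  \<comment> \<open>The invariant keeps what the identity in degree \<open>n\<close> says about
    boundaries. It makes the values of \<open>c - 1 - s d\<close> in the next degree cycles, so that
    they can be lifted along \<open>d (Suc n)\<close>.\<close>
  define I where "I n s \<longleftrightarrow> s \<in> Hom A (Q n) (Q (Suc n)) \<and>
    (\<forall>x\<in>carrier (Q (Suc n)). d n (s (d n x)) = c n (d n x) \<ominus>\<^bsub>Q n\<^esub> d n x)" for n s
  define S where "S n s t \<longleftrightarrow> (\<forall>x\<in>carrier (Q (Suc n)).
    d (Suc n) (t x) = c (Suc n) x \<ominus>\<^bsub>Q (Suc n)\<^esub> x \<ominus>\<^bsub>Q (Suc n)\<^esub> s (d n x))" for n s t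
  have "\<exists>s. \<forall>n. I n (s n) \<and> S n (s n) (s (Suc n))"
  proof (rule dependent_nat_choice)
    interpret X: right_module A X by (rule X)
    interpret Q0: right_module A "Q 0" by (rule q(2))
    have "c 0 x \<ominus>\<^bsub>Q 0\<^esub> x \<in> d 0 ` carrier (Q (Suc 0))" if x: "x \<in> carrier (Q 0)" for x
    proof -
      have cx: "c 0 x \<in> carrier (Q 0)" by (rule Hom_closed[OF c x])
      have "e (c 0 x \<ominus>\<^bsub>Q 0\<^esub> x) = e x \<ominus>\<^bsub>X\<^esub> e x"
        using Hom_diff[OF q(2) X q(4) cx x] ce[OF x] by simp
      also have "\<dots> = \<zero>\<^bsub>X\<^esub>" using X.minus_eq_zero_iff Hom_closed[OF q(4) x] by simp
      finally show ?thesis using q(6) cx x by simp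
    qed
    then have "(\<lambda>x\<in>carrier (Q 0). c 0 x \<ominus>\<^bsub>Q 0\<^esub> x) ` carrier (Q 0) \<subseteq> d 0 ` carrier (Q (Suc 0))" by auto
    from projective_lift[OF q(1) q(2) q(2) q(3) diff this]
    obtain s where s: "s \<in> Hom A (Q 0) (Q (Suc 0))"
      "\<And>x. x \<in> carrier (Q 0) \<Longrightarrow> d 0 (s x) = (\<lambda>x\<in>carrier (Q 0). c 0 x \<ominus>\<^bsub>Q 0\<^esub> x) x" by blast
    then have "I 0 s" unfolding I_def using Hom_closed[OF q(3)[of 0]] by simp
    then show "\<exists>s. I 0 s" by blast
  next
    fix s n assume "I n s"
    then have s: "s \<in> Hom A (Q n) (Q (Suc n))"
      "\<And>x. x \<in> carrier (Q (Suc n)) \<Longrightarrow> d n (s (d n x)) = c n (d n x) \<ominus>\<^bsub>Q n\<^esub> d n x"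
      unfolding I_def by blast+
    interpret Qn: right_module A "Q n" by (rule q(2))
    interpret QS: right_module A "Q (Suc n)" by (rule q(2))
    let ?t = "\<lambda>x\<in>carrier (Q (Suc n)). c (Suc n) x \<ominus>\<^bsub>Q (Suc n)\<^esub> x \<ominus>\<^bsub>Q (Suc n)\<^esub> s (d n x)"
    have t: "?t \<in> Hom A (Q (Suc n)) (Q (Suc n))"
      using Hom_sub[OF q(2) q(2) diff[of "Suc n"] Hom_comp[OF q(2) q(3) s(1)]] by (simp cong: restrict_cong)
    have "?t x \<in> d (Suc n) ` carrier (Q (Suc (Suc n)))" if x: "x \<in> carrier (Q (Suc n))" for x
    proof -
      have cl: "c (Suc n) x \<in> carrier (Q (Suc n))" "d n x \<in> carrier (Q n)"
        using Hom_closed[OF c x] Hom_closed[OF q(3) x] by auto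
      have sdx: "s (d n x) \<in> carrier (Q (Suc n))" by (rule Hom_closed[OF s(1) cl(2)])
      have cc: "c n (d n x) \<in> carrier (Q n)" by (rule Hom_closed[OF c cl(2)])
      have "d n (?t x) = d n (c (Suc n) x) \<ominus>\<^bsub>Q n\<^esub> d n x \<ominus>\<^bsub>Q n\<^esub> d n (s (d n x))"
        using x cl sdx by (simp add: Hom_diff[OF q(2) q(2) q(3)])
      also have "\<dots> = (c n (d n x) \<ominus>\<^bsub>Q n\<^esub> d n x) \<ominus>\<^bsub>Q n\<^esub> (c n (d n x) \<ominus>\<^bsub>Q n\<^esub> d n x)"
        using cd[OF x] s(2)[OF x] by simp
      also have "\<dots> = \<zero>\<^bsub>Q n\<^esub>" using Qn.minus_eq_zero_iff cc cl(2) by simp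
      finally show ?thesis using q(7)[OF Hom_closed[OF t x]] by simp
    qed
    then have tsub: "?t ` carrier (Q (Suc n)) \<subseteq> d (Suc n) ` carrier (Q (Suc (Suc n)))" by blast
    obtain h where h: "h \<in> Hom A (Q (Suc n)) (Q (Suc (Suc n)))"
      "\<And>x. x \<in> carrier (Q (Suc n)) \<Longrightarrow> d (Suc n) (h x) = ?t x"
      using projective_lift[OF q(1) q(2) q(2) q(3) t tsub] by blast
    have S: "S n s h" using h(2) unfolding S_def by simp
    have "d (Suc n) (h (d (Suc n) x)) = c (Suc n) (d (Suc n) x) \<ominus>\<^bsub>Q (Suc n)\<^esub> d (Suc n) x"
      if x: "x \<in> carrier (Q (Suc (Suc n)))" for x
    proof -
      have dx: "d (Suc n) x \<in> carrier (Q (Suc n))" by (rule Hom_closed[OF q(3) x])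
      have "s (d n (d (Suc n) x)) = \<zero>\<^bsub>Q (Suc n)\<^esub>"
        using projective_resolution_square[OF Q x] Hom_zero[OF q(2) q(2) s(1)] by simp
      then show ?thesis using h(2)[OF dx] dx Hom_closed[OF c dx] QS.minus_equality[of "\<zero>\<^bsub>Q (Suc n)\<^esub>" "\<zero>\<^bsub>Q (Suc n)\<^esub>"]
        by (simp add: a_minus_def)
    qed
    then have "I (Suc n) h" using h(1) unfolding I_def by blast
    then show "\<exists>t. I (Suc n) t \<and> S n s t" using S by blast
  qed
  then obtain s where s: "\<And>n. I n (s n)" "\<And>n. S n (s n) (s (Suc n))" by blast
  have "s n \<in> Hom A (Q n) (Q (Suc n))" for n using s(1)[of n] by (simp add: I_def)
  then show ?thesis using s(2) unfolding S_def by blast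
qed

lemma coboundaries_SucI:
  "w \<in> Hom A (P n) Y \<Longrightarrow> (\<lambda>x\<in>carrier (P (Suc n)). w (d n x)) \<in> coboundaries A P d Y (Suc n)"
  by simp

text \<open>With chain maps \<open>f\<close> from \<open>P\<close> to \<open>Q\<close> and
  \<open>g\<close> back, \<open>c = f g\<close> is homotopic to the identity of \<open>Q\<close>. So
  a cocycle \<open>z\<close> differs from \<open>z f g\<close> by a coboundary, and
  \<open>z f\<close> is a coboundary by assumption.\<close>

lemma cocycles_coboundaries_transfer:
  assumes X: "right_module A X" and Y: "right_module A Y"
    and P: "projective_resolution A X P d e" and Q: "projective_resolution A X Q d' e'"
    and sub: "cocycles A P d Y (Suc n) \<subseteq> coboundaries A P d Y (Suc n)"
  shows "cocycles A Q d' Y (Suc n) \<subseteq> coboundaries A Q d' Y (Suc n)"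
proof
  fix z assume "z \<in> cocycles A Q d' Y (Suc n)"
  then have z: "z \<in> Hom A (Q (Suc n)) Y" "\<And>x. x \<in> carrier (Q (Suc (Suc n))) \<Longrightarrow> z (d' (Suc n) x) = \<zero>\<^bsub>Y\<^esub>"
    by (auto simp: cocycles_def)
  interpret Y: right_module A Y by (rule Y)
  note p = projective_resolutionD[OF P] and q = projective_resolutionD[OF Q]
  obtain f where f: "\<And>n. f n \<in> Hom A (P n) (Q n)" "\<And>x. x \<in> carrier (P 0) \<Longrightarrow> e' (f 0 x) = e x"
    "\<And>n x. x \<in> carrier (P (Suc n)) \<Longrightarrow> d' n (f (Suc n) x) = f n (d n x)"
    using chain_map_exists[OF X P Q] by metis
  obtain g where g: "\<And>n. g n \<in> Hom A (Q n) (P n)" "\<And>x. x \<in> carrier (Q 0) \<Longrightarrow> e (g 0 x) = e' x"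
    "\<And>n x. x \<in> carrier (Q (Suc n)) \<Longrightarrow> d n (g (Suc n) x) = g n (d' n x)"
    using chain_map_exists[OF X Q P] by metis
  define c where "c n = (\<lambda>x\<in>carrier (Q n). f n (g n x))" for n
  have c: "c n \<in> Hom A (Q n) (Q n)" for n unfolding c_def by (rule Hom_comp[OF q(2) g(1) f(1)])
  have ce: "e' (c 0 x) = e' x" if "x \<in> carrier (Q 0)" for x
    using that f(2)[OF Hom_closed[OF g(1) that]] g(2)[OF that] by (simp add: c_def)
  have cd: "d' n (c (Suc n) x) = c n (d' n x)" if "x \<in> carrier (Q (Suc n))" for n x
    using that f(3)[OF Hom_closed[OF g(1) that]] g(3)[OF that] Hom_closed[OF q(3) that] by (simp add: c_def)
  obtain s where s: "\<And>n. s n \<in> Hom A (Q n) (Q (Suc n))"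
    "\<And>n x. x \<in> carrier (Q (Suc n)) \<Longrightarrow>
      d' (Suc n) (s (Suc n) x) = c (Suc n) x \<ominus>\<^bsub>Q (Suc n)\<^esub> x \<ominus>\<^bsub>Q (Suc n)\<^esub> s n (d' n x)"
    using chain_homotopy_exists[OF X Q c ce cd] by metis
  have "(\<lambda>x\<in>carrier (P (Suc n)). z (f (Suc n) x)) \<in> cocycles A P d Y (Suc n)"
    unfolding cocycles_def
  proof (intro CollectI conjI ballI)
    show "(\<lambda>x\<in>carrier (P (Suc n)). z (f (Suc n) x)) \<in> Hom A (P (Suc n)) Y" by (rule Hom_comp[OF p(2) f(1) z(1)])
    fix x assume x: "x \<in> carrier (P (Suc (Suc n)))"
    then have "z (f (Suc n) (d (Suc n) x)) = \<zero>\<^bsub>Y\<^esub>"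
      using z(2)[OF Hom_closed[OF f(1) x]] f(3)[OF x] by simp
    then show "(\<lambda>x\<in>carrier (P (Suc n)). z (f (Suc n) x)) (d (Suc n) x) = \<zero>\<^bsub>Y\<^esub>"
      using Hom_closed[OF p(3) x] by simp
  qed
  then obtain w where w: "w \<in> Hom A (P n) Y"
    "(\<lambda>x\<in>carrier (P (Suc n)). z (f (Suc n) x)) = (\<lambda>x\<in>carrier (P (Suc n)). w (d n x))"
    using sub by auto
  have zf: "z (f (Suc n) x) = w (d n x)" if "x \<in> carrier (P (Suc n))" for x
    using fun_cong[OF w(2), of x] that by simp
  \<comment> \<open>Applying \<open>z\<close> to the homotopy identity removes the term
    \<open>z d' s\<close>, and \<open>z f g = w d g = w g d'\<close>; this leaves
    \<open>z = (w g - z s) d'\<close>.\<close>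
  let ?v = "\<lambda>x\<in>carrier (Q n). (\<lambda>x\<in>carrier (Q n). w (g n x)) x \<ominus>\<^bsub>Y\<^esub> (\<lambda>x\<in>carrier (Q n). z (s n x)) x"
  have v: "?v \<in> Hom A (Q n) Y"
    by (rule Hom_sub[OF q(2) Y Hom_comp[OF q(2) g(1) w(1)] Hom_comp[OF q(2) s(1) z(1)]])
  have "z x = ?v (d' n x)" if x: "x \<in> carrier (Q (Suc n))" for x
  proof -
    interpret QS: right_module A "Q (Suc n)" by (rule q(2))
    have dx: "d' n x \<in> carrier (Q n)" by (rule Hom_closed[OF q(3) x])
    have cx: "c (Suc n) x \<in> carrier (Q (Suc n))" by (rule Hom_closed[OF c x])
    have sdx: "s n (d' n x) \<in> carrier (Q (Suc n))" by (rule Hom_closed[OF s(1) dx])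
    have zc: "z (c (Suc n) x) \<in> carrier Y" "z x \<in> carrier Y" "z (s n (d' n x)) \<in> carrier Y"
      using Hom_closed[OF z(1)] cx x sdx by auto
    have "z (d' (Suc n) (s (Suc n) x)) = \<zero>\<^bsub>Y\<^esub>" by (rule z(2)[OF Hom_closed[OF s(1) x]])
    then have "z (c (Suc n) x) \<ominus>\<^bsub>Y\<^esub> z x \<ominus>\<^bsub>Y\<^esub> z (s n (d' n x)) = \<zero>\<^bsub>Y\<^esub>"
      using s(2)[OF x] cx x sdx by (simp add: Hom_diff[OF q(2) Y z(1)])
    then have "z (c (Suc n) x) \<ominus>\<^bsub>Y\<^esub> z x = z (s n (d' n x))"
      using zc by (simp add: Y.minus_eq_zero_iff)
    then have "z (c (Suc n) x) \<ominus>\<^bsub>Y\<^esub> z (s n (d' n x)) = z (c (Suc n) x) \<ominus>\<^bsub>Y\<^esub> (z (c (Suc n) x) \<ominus>\<^bsub>Y\<^esub> z x)" by simp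
    also have "\<dots> = z x" using zc by (simp add: a_minus_def Y.minus_add Y.r_neg1 Y.r_neg2)
    finally have zx: "z x = z (c (Suc n) x) \<ominus>\<^bsub>Y\<^esub> z (s n (d' n x))" by simp
    have "z (c (Suc n) x) = w (d n (g (Suc n) x))"
      using zf[OF Hom_closed[OF g(1) x]] x by (simp add: c_def)
    then show ?thesis using zx g(3)[OF x] dx by simp
  qed
  then have "z = (\<lambda>x\<in>carrier (Q (Suc n)). ?v (d' n x))"
    by (intro Hom_ext[OF z(1) Hom_comp[OF q(2) q(3) v]]) simp
  then show "z \<in> coboundaries A Q d' Y (Suc n)" using coboundaries_SucI[where P = Q and d = d' and n = n, OF v] by (simp only:)
qed

lemma coboundaries_subset_cocycles:
  assumes "right_module A Y" "projective_resolution A X P d e"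
  shows "coboundaries A P d Y (Suc n) \<subseteq> cocycles A P d Y (Suc n)"
proof
  note p = projective_resolutionD[OF assms(2)]
  fix z assume "z \<in> coboundaries A P d Y (Suc n)"
  then obtain w where w: "w \<in> Hom A (P n) Y" "z = (\<lambda>x\<in>carrier (P (Suc n)). w (d n x))" by auto
  have "z (d (Suc n) x) = \<zero>\<^bsub>Y\<^esub>" if x: "x \<in> carrier (P (Suc (Suc n)))" for x
    using projective_resolution_square[OF assms(2) x] Hom_closed[OF p(3) x] Hom_zero[OF p(2) assms(1) w(1)]
    by (simp add: w(2))
  then show "z \<in> cocycles A P d Y (Suc n)"
    unfolding cocycles_def using Hom_comp[OF p(2) p(3) w(1)] by (simp add: w(2))
qed

text \<open>If the quotient is trivial, the coset of \<open>z\<close> is \<open>B\<close>, and it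
  contains \<open>0 + z\<close>. Conversely, \<open>trivial_group\<close> also asks for the group
  laws; they hold because \<open>Z = B\<close> leaves the single coset \<open>B\<close>, which is
  idempotent.\<close>

lemma trivial_Hom_factor_iff:
  assumes P: "right_module A P" and Y: "right_module A Y" and Z: "Z \<subseteq> Hom A P Y" and B: "B \<subseteq> Z"
    and zero: "(\<lambda>x\<in>carrier P. \<zero>\<^bsub>Y\<^esub>) \<in> B"
    and diff: "\<And>f g. f \<in> B \<Longrightarrow> g \<in> B \<Longrightarrow> (\<lambda>x\<in>carrier P. f x \<ominus>\<^bsub>Y\<^esub> g x) \<in> B"
  shows "trivial_group ((Hom_group A P Y)\<lparr>carrier := Z\<rparr> Mod B) \<longleftrightarrow> Z \<subseteq> B"
proof
  interpret Y: right_module A Y by (rule Y)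
  let ?G = "(Hom_group A P Y)\<lparr>carrier := Z\<rparr>"
  let ?add = "\<lambda>f g. \<lambda>x\<in>carrier P. f x \<oplus>\<^bsub>Y\<^esub> g x"
  have cos: "B #>\<^bsub>?G\<^esub> z = (\<lambda>f. ?add f z) ` B" for z by (auto simp: r_coset_def Hom_group_def)
  have YB: "f x \<in> carrier Y" if "f \<in> Z" "x \<in> carrier P" for f x    using Hom_closed[OF subsetD[OF Z that(1)] that(2)] .
  {
    assume "trivial_group (?G Mod B)"
    then have one: "carrier (?G Mod B) = {B}" by (simp add: trivial_group_def FactGroup_def)
    show "Z \<subseteq> B"
    proof
      fix z assume z: "z \<in> Z"
      then have "B #>\<^bsub>?G\<^esub> z \<in> carrier (?G Mod B)" by (auto simp: FactGroup_def RCOSETS_def)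
      then have "B #>\<^bsub>?G\<^esub> z = B" using one by blast
      then have mem: "?add (\<lambda>x\<in>carrier P. \<zero>\<^bsub>Y\<^esub>) z \<in> B" unfolding cos using zero by blast
      have zH: "z \<in> Hom A P Y" using z Z by blast
      have "?add (\<lambda>x\<in>carrier P. \<zero>\<^bsub>Y\<^esub>) z = z"
        using YB[OF z] by (intro Hom_ext[OF Hom_plus[OF P Y Hom_null[OF P Y] zH] zH]) simp
      then show "z \<in> B" using mem by simp
    qed
  next
    assume "Z \<subseteq> B"
    then have ZB: "Z = B" using B by blast
    have neg: "(\<lambda>x\<in>carrier P. \<ominus>\<^bsub>Y\<^esub> f x) \<in> B" if f: "f \<in> B" for f
    proof -
      have "(\<lambda>x\<in>carrier P. (\<lambda>x\<in>carrier P. \<zero>\<^bsub>Y\<^esub>) x \<ominus>\<^bsub>Y\<^esub> f x) \<in> B" by (rule diff[OF zero f])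
      moreover have "(\<lambda>x\<in>carrier P. (\<lambda>x\<in>carrier P. \<zero>\<^bsub>Y\<^esub>) x \<ominus>\<^bsub>Y\<^esub> f x) = (\<lambda>x\<in>carrier P. \<ominus>\<^bsub>Y\<^esub> f x)"
        using YB f ZB by (intro restrict_ext) (simp add: a_minus_def)
      ultimately show ?thesis by simp
    qed
    have addB: "?add f g \<in> B" if f: "f \<in> B" and g: "g \<in> B" for f g
    proof -
      have "(\<lambda>x\<in>carrier P. f x \<ominus>\<^bsub>Y\<^esub> (\<lambda>x\<in>carrier P. \<ominus>\<^bsub>Y\<^esub> g x) x) \<in> B" by (rule diff[OF f neg[OF g]])
      moreover have "(\<lambda>x\<in>carrier P. f x \<ominus>\<^bsub>Y\<^esub> (\<lambda>x\<in>carrier P. \<ominus>\<^bsub>Y\<^esub> g x) x) = ?add f g"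
        using YB g ZB by (intro restrict_ext) (simp add: a_minus_def)
      ultimately show ?thesis by simp
    qed
    have sub: "(\<lambda>f. ?add f z) ` B = B" if z: "z \<in> B" for z
    proof
      show "(\<lambda>f. ?add f z) ` B \<subseteq> B" using addB z by blast
      show "B \<subseteq> (\<lambda>f. ?add f z) ` B"
      proof
        fix f assume f: "f \<in> B"
        have fH: "f \<in> extensional (carrier P)" by (rule Hom_extensional[OF subsetD[OF Z subsetD[OF B f]]])
        have "f = ?add (\<lambda>x\<in>carrier P. f x \<ominus>\<^bsub>Y\<^esub> z x) z"
        proof (rule extensionalityI[OF fH])
          fix x assume x: "x \<in> carrier P"
          then show "f x = ?add (\<lambda>x\<in>carrier P. f x \<ominus>\<^bsub>Y\<^esub> z x) z x"
            using YB[of f x] YB[of z x] f z ZB by (simp add: a_minus_def Y.a_assoc Y.l_neg)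
        qed simp
        then show "f \<in> (\<lambda>f. ?add f z) ` B" using diff[OF f z] by blast
      qed
    qed
    have "carrier (?G Mod B) = (\<Union>a\<in>carrier ?G. {B #>\<^bsub>?G\<^esub> a})"
      by (simp only: FactGroup_def RCOSETS_def partial_object.select_convs)
    also have "\<dots> = (\<Union>a\<in>B. {(\<lambda>f. ?add f a) ` B})" unfolding cos by (simp add: ZB)
    also have "\<dots> = (\<Union>a\<in>B. {B})" using sub by (simp cong: SUP_cong_simp)
    also have "\<dots> = {B}" using zero by blast
    finally have one: "carrier (?G Mod B) = {B}" "\<one>\<^bsub>?G Mod B\<^esub> = B" by (simp_all add: FactGroup_def)
    have "set_mult ?G B B = (\<Union>z\<in>B. (\<lambda>f. ?add f z) ` B)"
      unfolding set_mult_def by (auto simp: Hom_group_def)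
    also have "\<dots> = (\<Union>z\<in>B. B)" using sub by (simp cong: SUP_cong_simp)
    also have "\<dots> = B" using zero by blast
    finally have mult: "B \<otimes>\<^bsub>?G Mod B\<^esub> B = B" by (simp add: FactGroup_def)
    define G where "G = ?G Mod B"
    have G: "carrier G = {B}" "\<one>\<^bsub>G\<^esub> = B" "B \<otimes>\<^bsub>G\<^esub> B = B" unfolding G_def by (fact one mult)+
    have "group G" by (rule groupI) (simp_all add: G)
    then show "trivial_group (?G Mod B)" unfolding G_def[symmetric] by (simp add: trivial_group_def G)
  }
qed

text \<open>\<open>Ext\<close> is computed from a resolution chosen by \<open>SOME\<close>. Transfer
  in both directions shows that its vanishing can be tested on any other resolution on the same
  type.\<close>

lemma trivial_Ext_iff:
  fixes P :: "nat \<Rightarrow> ('a, nat \<Rightarrow> 'a) module"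
  assumes X: "right_module A X" and Y: "right_module A Y" and P: "projective_resolution A X P d e"
  shows "trivial_group (Ext A (Suc n) X Y) \<longleftrightarrow> cocycles A P d Y (Suc n) \<subseteq> coboundaries A P d Y (Suc n)"
proof -
  define R where "R = (SOME (P :: nat \<Rightarrow> ('a, nat \<Rightarrow> 'a) module, d, e). projective_resolution A X P d e)"
  obtain P' d' e' where R': "R = (P', d', e')" by (cases R)
  have "\<exists>R. case R of (P :: nat \<Rightarrow> ('a, nat \<Rightarrow> 'a) module, d, e) \<Rightarrow> projective_resolution A X P d e"
    using P by auto
  from someI_ex[OF this] have P': "projective_resolution A X P' d' e'"
    using R' unfolding R_def[symmetric] by simp
  note p = projective_resolutionD[OF P']
  interpret Y: right_module A Y by (rule Y)
  have "Ext A (Suc n) X Y =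
      (Hom_group A (P' (Suc n)) Y)\<lparr>carrier := cocycles A P' d' Y (Suc n)\<rparr> Mod coboundaries A P' d' Y (Suc n)"
    unfolding Ext_def R_def[symmetric] R' by simp
  moreover have "trivial_group \<dots> \<longleftrightarrow> cocycles A P' d' Y (Suc n) \<subseteq> coboundaries A P' d' Y (Suc n)"
  proof (rule trivial_Hom_factor_iff[OF p(2) Y])
    show "cocycles A P' d' Y (Suc n) \<subseteq> Hom A (P' (Suc n)) Y" by (auto simp: cocycles_def)
    show "coboundaries A P' d' Y (Suc n) \<subseteq> cocycles A P' d' Y (Suc n)"
      by (rule coboundaries_subset_cocycles[OF Y P'])
    have "(\<lambda>x\<in>carrier (P' (Suc n)). \<zero>\<^bsub>Y\<^esub>) = (\<lambda>x\<in>carrier (P' (Suc n)). (\<lambda>x\<in>carrier (P' n). \<zero>\<^bsub>Y\<^esub>) (d' n x))"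
      using Hom_closed[OF p(3)] by (intro restrict_ext) simp
    then show "(\<lambda>x\<in>carrier (P' (Suc n)). \<zero>\<^bsub>Y\<^esub>) \<in> coboundaries A P' d' Y (Suc n)"
      using coboundaries_SucI[where P = P' and d = d' and n = n, OF Hom_null[OF p(2) Y]] by (simp only:)
    fix f g assume "f \<in> coboundaries A P' d' Y (Suc n)" "g \<in> coboundaries A P' d' Y (Suc n)"
    then obtain v w where vw: "v \<in> Hom A (P' n) Y" "w \<in> Hom A (P' n) Y"
      "f = (\<lambda>x\<in>carrier (P' (Suc n)). v (d' n x))" "g = (\<lambda>x\<in>carrier (P' (Suc n)). w (d' n x))" by auto
    have "(\<lambda>x\<in>carrier (P' (Suc n)). f x \<ominus>\<^bsub>Y\<^esub> g x) =
        (\<lambda>x\<in>carrier (P' (Suc n)). (\<lambda>x\<in>carrier (P' n). v x \<ominus>\<^bsub>Y\<^esub> w x) (d' n x))"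
      using Hom_closed[OF p(3)] by (intro restrict_ext) (simp add: vw(3,4))
    then show "(\<lambda>x\<in>carrier (P' (Suc n)). f x \<ominus>\<^bsub>Y\<^esub> g x) \<in> coboundaries A P' d' Y (Suc n)"
      using coboundaries_SucI[where P = P' and d = d' and n = n, OF Hom_sub[OF p(2) Y vw(1,2)]] by (simp only:)
  qed
  moreover have "cocycles A P' d' Y (Suc n) \<subseteq> coboundaries A P' d' Y (Suc n) \<longleftrightarrow>
      cocycles A P d Y (Suc n) \<subseteq> coboundaries A P d Y (Suc n)"
    using cocycles_coboundaries_transfer[OF X Y P P'] cocycles_coboundaries_transfer[OF X Y P' P] by blast
  ultimately show ?thesis by simp
qed

text \<open>The covers of the iterated syzygies are spliced. In this resolution the first
  differential is the very map used by \<open>AB_transpose\<close>, and its kernel carries the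
  second syzygy, so no uniqueness of projective covers is called for.\<close>

lemma syzygy_resolution:
  assumes FA: "finite_length A (regular_module A)" and X: "fg_module A X"
  defines "Y \<equiv> \<lambda>n. ((syzygy A) ^^ n) (syzygy A X)"
  shows "projective_resolution A X
    (\<lambda>n. case n of 0 \<Rightarrow> fst (proj_cover A X) | Suc n \<Rightarrow> fst (proj_cover A (Y n)))
    (\<lambda>n. snd (proj_cover A (Y n))) (snd (proj_cover A X))"
proof -
  let ?P = "\<lambda>n. case n of 0 \<Rightarrow> fst (proj_cover A X) | Suc n \<Rightarrow> fst (proj_cover A (Y n))"
  have fgY: "fg_module A (Y n)" for n
    by (induction n) (simp_all add: Y_def fg_syzygy[OF FA] X)
  note pX = projective_coverD[OF proj_cover[OF FA X]]
  note pY = projective_coverD[OF proj_cover[OF FA fgY]]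
  have YP: "Y n = (?P n)\<lparr>carrier := carrier (Y n)\<rparr>" for n
    by (cases n) (simp_all add: Y_def syzygy_eq)
  have subY: "carrier (Y n) \<subseteq> carrier (?P n)" for n
    by (cases n) (auto simp: Y_def syzygy_eq a_kernel_eq)
  have dH: "snd (proj_cover A (Y n)) \<in> Hom A (?P (Suc n)) (?P n)" for n
    by (rule Hom_from_into_submodule[OF _ subY]) (use pY(2)[of n] YP[of n] in auto)
  have ker0: "a_kernel (?P 0) X (snd (proj_cover A X)) = carrier (Y 0)"
    by (simp add: Y_def syzygy_eq)
  have zeroY: "\<zero>\<^bsub>Y n\<^esub> = \<zero>\<^bsub>?P n\<^esub>" for n by (subst YP) simp
  have ker: "a_kernel (?P (Suc n)) (?P n) (snd (proj_cover A (Y n))) = carrier (Y (Suc n))" for n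
  proof -
    have YS: "Y (Suc n) = syzygy A (Y n)" by (simp add: Y_def)
    show ?thesis unfolding YS syzygy_eq[of A "Y n"] a_kernel_eq zeroY by simp
  qed
  show ?thesis
    unfolding projective_resolution_def
  proof (intro conjI allI)
    show "fg_projective A (?P n)" for n using pX(1) pY(1) by (cases n) auto
    show "snd (proj_cover A (Y n)) \<in> Hom A (?P (Suc n)) (?P n)" for n by (rule dH)
    show "snd (proj_cover A X) \<in> Hom A (?P 0) X" "snd (proj_cover A X) ` carrier (?P 0) = carrier X" using pX by auto
    show "a_kernel (?P 0) X (snd (proj_cover A X)) = snd (proj_cover A (Y 0)) ` carrier (?P (Suc 0))"
      using ker0 pY(3)[of 0] by simp
    show "a_kernel (?P (Suc n)) (?P n) (snd (proj_cover A (Y n))) =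
        snd (proj_cover A (Y (Suc n))) ` carrier (?P (Suc (Suc n)))" for n
      using ker[of n] pY(3)[of "Suc n"] by simp
  qed
qed

section \<open>The transpose and its dual\<close>

lemma dual_simps [simp]:
  "carrier (dual A M) = Hom A M (regular_module A)" "zero (dual A M) = (\<lambda>x\<in>carrier M. \<zero>\<^bsub>A\<^esub>)"
  "add (dual A M) = (\<lambda>f g. \<lambda>x\<in>carrier M. f x \<oplus>\<^bsub>A\<^esub> g x)"
  "smult (dual A M) = (\<lambda>a f. \<lambda>x\<in>carrier M. a \<otimes>\<^bsub>A\<^esub> f x)"
  by (simp_all add: dual_def)

lemma finsum_regular: "finsum (regular_module A) f I = finsum A f I"
  and finsum_opp: "finsum (opp_ring A) f I = finsum A f I"
  by (simp_all add: finsum_def finprod_def)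

lemma dual_closed: "f \<in> Hom A M (regular_module A) \<Longrightarrow> x \<in> carrier M \<Longrightarrow> f x \<in> carrier A"
  using Hom_closed[of f A M "regular_module A" x] by simp

text \<open>Multiplying values on the left does not disturb right linearity. The product
  \<open>b a\<close> acts as \<open>a\<close> followed by \<open>b\<close>, which is the law of a
  right module over \<open>opp_ring A\<close>.\<close>

lemma right_module_dual:
  assumes M: "right_module A M" shows "right_module (opp_ring A) (dual A M)"
proof -
  interpret M: right_module A M by fact
  have R: "ring A" by (rule M.R.ring_axioms)
  have AA: "right_module A (regular_module A)" by (rule right_module_regular[OF R])
  note cl = dual_closed
  have ext: "f \<in> extensional (carrier M)" if "f \<in> Hom A M (regular_module A)" for f
    using Hom_extensional[OF that] .
  have sm: "(\<lambda>x\<in>carrier M. a \<otimes>\<^bsub>A\<^esub> f x) \<in> Hom A M (regular_module A)"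
    if f: "f \<in> Hom A M (regular_module A)" and a: "a \<in> carrier A" for a f
    using a cl[OF f] by (intro restrict_HomI[OF M])
      (simp_all add: Hom_add[OF f] Hom_smult[OF f] M.R.r_distr M.R.m_assoc)
  have plus: "(\<lambda>x\<in>carrier M. f x \<oplus>\<^bsub>A\<^esub> g x) \<in> Hom A M (regular_module A)"
    if "f \<in> Hom A M (regular_module A)" "g \<in> Hom A M (regular_module A)" for f g
    using Hom_plus[OF M AA that] by simp
  have "abelian_group (dual A M)"
  proof (rule abelian_groupI)
    fix f g assume "f \<in> carrier (dual A M)" "g \<in> carrier (dual A M)"
    then have f: "f \<in> Hom A M (regular_module A)" and g: "g \<in> Hom A M (regular_module A)" by simp_all
    show "f \<oplus>\<^bsub>dual A M\<^esub> g \<in> carrier (dual A M)" using plus[OF f g] by simp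
    show "f \<oplus>\<^bsub>dual A M\<^esub> g = g \<oplus>\<^bsub>dual A M\<^esub> f"
      using cl[OF f] cl[OF g] by (simp add: M.R.a_comm cong: restrict_cong)
    fix h assume "h \<in> carrier (dual A M)"
    then have h: "h \<in> Hom A M (regular_module A)" by simp
    show "f \<oplus>\<^bsub>dual A M\<^esub> g \<oplus>\<^bsub>dual A M\<^esub> h = f \<oplus>\<^bsub>dual A M\<^esub> (g \<oplus>\<^bsub>dual A M\<^esub> h)"
      using cl[OF f] cl[OF g] cl[OF h] by (simp add: M.R.a_assoc cong: restrict_cong)
  next
    show "\<zero>\<^bsub>dual A M\<^esub> \<in> carrier (dual A M)" using Hom_null[OF M AA] by simp
  next
    fix f assume "f \<in> carrier (dual A M)"
    then have f: "f \<in> Hom A M (regular_module A)" by simp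
    show "\<zero>\<^bsub>dual A M\<^esub> \<oplus>\<^bsub>dual A M\<^esub> f = f"
      using cl[OF f] by (intro extensionalityI[OF _ ext[OF f]]) simp_all
    have m: "(\<lambda>x\<in>carrier M. \<ominus>\<^bsub>A\<^esub> \<one>\<^bsub>A\<^esub> \<otimes>\<^bsub>A\<^esub> f x) \<in> carrier (dual A M)"
      using sm[OF f] by simp
    have "(\<lambda>x\<in>carrier M. \<ominus>\<^bsub>A\<^esub> \<one>\<^bsub>A\<^esub> \<otimes>\<^bsub>A\<^esub> f x) \<oplus>\<^bsub>dual A M\<^esub> f = \<zero>\<^bsub>dual A M\<^esub>"
      using cl[OF f] by (simp add: M.R.l_minus M.R.l_neg cong: restrict_cong)
    then show "\<exists>g\<in>carrier (dual A M). g \<oplus>\<^bsub>dual A M\<^esub> f = \<zero>\<^bsub>dual A M\<^esub>" using m by blast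
  qed
  moreover have "right_module_axioms (opp_ring A) (dual A M)"
  proof
    fix a f assume a': "a \<in> carrier (opp_ring A)" and "f \<in> carrier (dual A M)"
    then have a: "a \<in> carrier A" and f: "f \<in> Hom A M (regular_module A)" by simp_all
    show "a \<odot>\<^bsub>dual A M\<^esub> f \<in> carrier (dual A M)" using sm[OF f a] by simp
    {
      fix g assume "g \<in> carrier (dual A M)"
      then have g: "g \<in> Hom A M (regular_module A)" by simp
      show "a \<odot>\<^bsub>dual A M\<^esub> (f \<oplus>\<^bsub>dual A M\<^esub> g) = a \<odot>\<^bsub>dual A M\<^esub> f \<oplus>\<^bsub>dual A M\<^esub> a \<odot>\<^bsub>dual A M\<^esub> g"
        using cl[OF f] cl[OF g] a by (simp add: M.R.r_distr cong: restrict_cong)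
    }
    fix b assume "b \<in> carrier (opp_ring A)"
    then have b: "b \<in> carrier A" by simp
    show "(a \<oplus>\<^bsub>opp_ring A\<^esub> b) \<odot>\<^bsub>dual A M\<^esub> f = a \<odot>\<^bsub>dual A M\<^esub> f \<oplus>\<^bsub>dual A M\<^esub> b \<odot>\<^bsub>dual A M\<^esub> f"
      using cl[OF f] a b by (simp add: M.R.l_distr cong: restrict_cong)
    show "(a \<otimes>\<^bsub>opp_ring A\<^esub> b) \<odot>\<^bsub>dual A M\<^esub> f = b \<odot>\<^bsub>dual A M\<^esub> (a \<odot>\<^bsub>dual A M\<^esub> f)"
      using cl[OF f] a b by (simp add: M.R.m_assoc cong: restrict_cong)
  next
    fix f assume "f \<in> carrier (dual A M)"
    then have f: "f \<in> Hom A M (regular_module A)" by simp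
    show "\<one>\<^bsub>opp_ring A\<^esub> \<odot>\<^bsub>dual A M\<^esub> f = f"
      using cl[OF f] by (intro extensionalityI[OF _ ext[OF f]]) simp_all
  qed
  ultimately show ?thesis using ring_opp[OF R] by (simp add: right_module_def)
qed

lemma dual_map_Hom:
  assumes M: "right_module A M" and N: "right_module A N" and g: "g \<in> Hom A M N"
  shows "dual_map A M N g \<in> Hom (opp_ring A) (dual A N) (dual A M)"
proof -
  have "(\<lambda>f\<in>carrier (dual A N). \<lambda>x\<in>carrier M. f (g x)) \<in> Hom (opp_ring A) (dual A N) (dual A M)"
    using Hom_closed[OF g] Hom_comp[OF M g]
    by (intro restrict_HomI[OF right_module_dual[OF N]]) (simp_all cong: restrict_cong)
  then show ?thesis by (simp add: dual_map_def)
qed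

lemma evaluation_at_Hom:
  assumes M: "right_module A M" and x: "x \<in> carrier M"
  shows "(\<lambda>f\<in>carrier (dual A M). f x) \<in> Hom (opp_ring A) (dual A M) (regular_module (opp_ring A))"
  using x by (intro restrict_HomI[OF right_module_dual[OF M]]) (simp_all add: dual_closed)

lemma evaluation_Hom:
  assumes M: "right_module A M"
  shows "evaluation A M \<in> Hom A M (dual (opp_ring A) (dual A M))"
proof -
  interpret M: right_module A M by fact
  have "(\<lambda>x\<in>carrier M. \<lambda>f\<in>carrier (dual A M). f x) \<in> Hom A M (dual (opp_ring A) (dual A M))"
  proof (rule restrict_HomI[OF M])
    fix x assume x: "x \<in> carrier M"
    show "(\<lambda>f\<in>carrier (dual A M). f x) \<in> carrier (dual (opp_ring A) (dual A M))"
      using evaluation_at_Hom[OF M x] by simp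
    fix y assume y: "y \<in> carrier M"
    show "(\<lambda>f\<in>carrier (dual A M). f (x \<oplus>\<^bsub>M\<^esub> y)) =
      (\<lambda>f\<in>carrier (dual A M). f x) \<oplus>\<^bsub>dual (opp_ring A) (dual A M)\<^esub> (\<lambda>f\<in>carrier (dual A M). f y)"
      using x y by (simp add: Hom_add cong: restrict_cong)
  next
    fix a x assume "a \<in> carrier A" "x \<in> carrier M"
    then show "(\<lambda>f\<in>carrier (dual A M). f (a \<odot>\<^bsub>M\<^esub> x)) =
      a \<odot>\<^bsub>dual (opp_ring A) (dual A M)\<^esub> (\<lambda>f\<in>carrier (dual A M). f x)"
      by (simp add: Hom_smult cong: restrict_cong)
  qed
  then show ?thesis by (simp add: evaluation_def)
qed

section \<open>Duals of finitely generated projective modules\<close>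

lemma dual_basis_separates:
  assumes P: "right_module A P" and db: "dual_basis A P n e \<phi>"
    and x: "x \<in> carrier P" and z: "\<And>f. f \<in> Hom A P (regular_module A) \<Longrightarrow> f x = \<zero>\<^bsub>A\<^esub>"
  shows "x = \<zero>\<^bsub>P\<^esub>"
proof -
  interpret P: right_module A P by fact
  note d = dual_basisD[OF db]
  have "x = finsum P (\<lambda>i. \<phi> i x \<odot>\<^bsub>P\<^esub> e i) {..<n}" using d(3)[OF x] by simp
  also have "\<dots> = finsum P (\<lambda>i. \<zero>\<^bsub>P\<^esub>) {..<n}"
    using d(1) z[OF d(2)] by (intro P.finsum_cong') auto
  also have "\<dots> = \<zero>\<^bsub>P\<^esub>" by (rule P.finsum_zero)
  finally show ?thesis .
qed

text \<open>Applying \<open>f\<close> to the expansion of \<open>x\<close> gives the sum of the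
  products of \<open>f (e i)\<close> and \<open>\<phi> i x\<close>. So the \<open>\<phi> i\<close>
  generate the dual, with the values at the \<open>e i\<close> as coordinates. Evaluation at
  \<open>x\<close>, being a homomorphism, moves the sum of functionals inside.\<close>

lemma dual_basis_expand:
  assumes P: "right_module A P" and db: "dual_basis A P n e \<phi>" and f: "f \<in> Hom A P (regular_module A)"
  shows "f = finsum (dual A P) (\<lambda>i. f (e i) \<odot>\<^bsub>dual A P\<^esub> \<phi> i) {..<n}"
proof -
  interpret P: right_module A P by fact
  interpret D: right_module "opp_ring A" "dual A P" by (rule right_module_dual[OF P])
  have R: "ring A" by (rule P.R.ring_axioms)
  have AA: "right_module A (regular_module A)" by (rule right_module_regular[OF R])
  have AO: "right_module (opp_ring A) (regular_module (opp_ring A))" by (rule right_module_regular[OF ring_opp[OF R]])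
  note d = dual_basisD[OF db]
  have tm: "f (e i) \<odot>\<^bsub>dual A P\<^esub> \<phi> i \<in> carrier (dual A P)" if "i \<in> {..<n}" for i
    using that d(2)[of i] dual_closed[OF f d(1)[of i]] by (intro D.smult_closed) simp_all
  let ?s = "finsum (dual A P) (\<lambda>i. f (e i) \<odot>\<^bsub>dual A P\<^esub> \<phi> i) {..<n}"
  have s: "?s \<in> carrier (dual A P)" using tm by (intro D.finsum_closed) blast
  show ?thesis
  proof (rule Hom_ext[OF f])
    show "?s \<in> Hom A P (regular_module A)" using s by simp
    fix x assume x: "x \<in> carrier P"
    have "f x = f (finsum P (\<lambda>i. \<phi> i x \<odot>\<^bsub>P\<^esub> e i) {..<n})" using d(3)[OF x] by simp
    also have "\<dots> = finsum (regular_module A) (\<lambda>i. f (\<phi> i x \<odot>\<^bsub>P\<^esub> e i)) {..<n}"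
      using d(1) d(4) x by (intro Hom_finsum[OF P AA f]) auto
    also have "\<dots> = finsum A (\<lambda>i. f (e i) \<otimes>\<^bsub>A\<^esub> \<phi> i x) {..<n}"
      unfolding finsum_regular using d(1) d(4) x dual_closed[OF f]
      by (intro P.R.finsum_cong') (auto simp: Hom_smult[OF f])
    also have "\<dots> = finsum (regular_module (opp_ring A)) (\<lambda>i. (\<lambda>f\<in>carrier (dual A P). f x) (f (e i) \<odot>\<^bsub>dual A P\<^esub> \<phi> i)) {..<n}"
      unfolding finsum_regular finsum_opp using d(1) d(4) x dual_closed[OF f] tm
      by (intro P.R.finsum_cong') auto
    also have "\<dots> = (\<lambda>f\<in>carrier (dual A P). f x) ?s"
      by (intro Hom_finsum[OF D.right_module_axioms AO evaluation_at_Hom[OF P x], symmetric] tm) auto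
    also have "\<dots> = ?s x" using s by simp
    finally show "f x = ?s x" .
  qed
qed

lemma dual_basis_fg_dual:
  assumes P: "right_module A P" and db: "dual_basis A P n e \<phi>"
  shows "fg_module (opp_ring A) (dual A P)"
  unfolding fg_module_iff_generators
proof (intro conjI exI allI ballI impI)
  interpret D: right_module "opp_ring A" "dual A P" by (rule right_module_dual[OF P])
  note d = dual_basisD[OF db]
  show "right_module (opp_ring A) (dual A P)" by (rule right_module_dual[OF P])
  show "\<phi> i \<in> carrier (dual A P)" if "i < n" for i using d(2)[OF that] by simp
  fix f assume "f \<in> carrier (dual A P)"
  then have f: "f \<in> Hom A P (regular_module A)" by simp
  have "f = finsum (dual A P) (\<lambda>i. f (e i) \<odot>\<^bsub>dual A P\<^esub> \<phi> i) {..<n}" by (rule dual_basis_expand[OF P db f])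
  also have "\<dots> = finsum (dual A P) (\<lambda>i. (\<lambda>i\<in>{..<n}. f (e i)) i \<odot>\<^bsub>dual A P\<^esub> \<phi> i) {..<n}"
  proof (rule D.finsum_cong'[OF refl])
    show "(\<lambda>i. (\<lambda>i\<in>{..<n}. f (e i)) i \<odot>\<^bsub>dual A P\<^esub> \<phi> i) \<in> {..<n} \<rightarrow> carrier (dual A P)"
    proof
      fix i assume "i \<in> {..<n}"
      then show "(\<lambda>i\<in>{..<n}. f (e i)) i \<odot>\<^bsub>dual A P\<^esub> \<phi> i \<in> carrier (dual A P)"
        using d(2)[of i] dual_closed[OF f d(1)[of i]] by (intro D.smult_closed) simp_all
    qed
  qed simp
  finally show "\<exists>c\<in>{..<n} \<rightarrow>\<^sub>E carrier (opp_ring A). f = finsum (dual A P) (\<lambda>i. c i \<odot>\<^bsub>dual A P\<^esub> \<phi> i) {..<n}"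
    by (rule bexI[of _ "\<lambda>i\<in>{..<n}. f (e i)"]) (use dual_closed[OF f] d(1) in auto)
qed

text \<open>Applying \<open>F\<close> to the expansion of \<open>f\<close> in the
  \<open>\<phi> i\<close> gives the sum of the products of \<open>f (e i)\<close> and
  \<open>F (\<phi> i)\<close>, which is \<open>f\<close> of the combination of the
  \<open>e i\<close> with coefficients \<open>F (\<phi> i)\<close>. That combination is the witness,
  and it does not involve \<open>f\<close>.\<close>

lemma dual_basis_reflexive:
  assumes P: "right_module A P" and db: "dual_basis A P n e \<phi>"
    and F: "F \<in> Hom (opp_ring A) (dual A P) (regular_module (opp_ring A))"
  shows "\<exists>x\<in>carrier P. \<forall>f\<in>Hom A P (regular_module A). F f = f x"
proof (intro bexI ballI)
  interpret P: right_module A P by fact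
  interpret D: right_module "opp_ring A" "dual A P" by (rule right_module_dual[OF P])
  have R: "ring A" by (rule P.R.ring_axioms)
  have AA: "right_module A (regular_module A)" by (rule right_module_regular[OF R])
  have AO: "right_module (opp_ring A) (regular_module (opp_ring A))" by (rule right_module_regular[OF ring_opp[OF R]])
  note d = dual_basisD[OF db]
  have F\<phi>: "F (\<phi> i) \<in> carrier A" if "i < n" for i using Hom_closed[OF F, of "\<phi> i"] d(2)[OF that] by simp
  let ?x = "finsum P (\<lambda>i. F (\<phi> i) \<odot>\<^bsub>P\<^esub> e i) {..<n}"
  show "?x \<in> carrier P" using F\<phi> d(1) by (intro P.finsum_closed) auto
  fix f assume f: "f \<in> Hom A P (regular_module A)"
  have fe: "f (e i) \<in> carrier A" if "i < n" for i using dual_closed[OF f d(1)[OF that]] .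
  have tm: "f (e i) \<odot>\<^bsub>dual A P\<^esub> \<phi> i \<in> carrier (dual A P)" if "i \<in> {..<n}" for i
    using that d(2)[of i] fe by (intro D.smult_closed) simp_all
  have "F f = F (finsum (dual A P) (\<lambda>i. f (e i) \<odot>\<^bsub>dual A P\<^esub> \<phi> i) {..<n})"
    using dual_basis_expand[OF P db f] by simp
  also have "\<dots> = finsum (regular_module (opp_ring A)) (\<lambda>i. F (f (e i) \<odot>\<^bsub>dual A P\<^esub> \<phi> i)) {..<n}"
    by (intro Hom_finsum[OF D.right_module_axioms AO F] tm) auto
  also have "\<dots> = finsum A (\<lambda>i. f (e i) \<otimes>\<^bsub>A\<^esub> F (\<phi> i)) {..<n}"
    unfolding finsum_regular finsum_opp
  proof (rule P.R.finsum_cong'[OF refl])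
    fix i assume "i \<in> {..<n}"
    then show "F (f (e i) \<odot>\<^bsub>dual A P\<^esub> \<phi> i) = f (e i) \<otimes>\<^bsub>A\<^esub> F (\<phi> i)"
      using Hom_smult[OF F, of "f (e i)" "\<phi> i"] fe[of i] d(2)[of i] by simp
  qed (use fe F\<phi> in auto)
  also have "\<dots> = finsum (regular_module A) (\<lambda>i. f (F (\<phi> i) \<odot>\<^bsub>P\<^esub> e i)) {..<n}"
    unfolding finsum_regular using d(1) fe F\<phi>
    by (intro P.R.finsum_cong') (auto simp: Hom_smult[OF f])
  also have "\<dots> = f ?x"
    using d(1) F\<phi> by (intro Hom_finsum[OF P AA f, symmetric]) auto
  finally show "F f = f ?x" .
qed

text \<open>Composition with a map from a free module onto \<open>M\<close> embeds the dual of
  \<open>M\<close> into the dual of the free module, which is finitely generated over the opposite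
  ring.\<close>

lemma finite_length_dual:
  assumes fg: "fg_module A M" and FO: "finite_length (opp_ring A) (regular_module (opp_ring A))"
  shows "finite_length (opp_ring A) (dual A M)"
proof -
  have M: "right_module A M" using fg by (rule fg_moduleD)
  have R: "ring A" using M by (rule right_module_ring)
  from fg obtain n :: nat and m where m: "\<forall>i<n. m i \<in> carrier M"
    and gen: "\<forall>x\<in>carrier M. \<exists>c\<in>{..<n} \<rightarrow>\<^sub>E carrier A. x = finsum M (\<lambda>i. c i \<odot>\<^bsub>M\<^esub> m i) {..<n}"
    unfolding fg_module_iff_generators by (elim conjE exE)
  define F where "F = free_module A n"
  have F: "right_module A F" unfolding F_def by (rule right_module_free[OF R])
  define l where "l = (\<lambda>c\<in>carrier F. finsum M (\<lambda>i. c i \<odot>\<^bsub>M\<^esub> m i) {..<n})"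
  have l: "l \<in> Hom A F M" unfolding l_def F_def using lincomb_Hom[OF M] m by blast
  have lsurj: "\<exists>c\<in>carrier F. x = l c" if "x \<in> carrier M" for x
    using gen[rule_format, OF that] by (auto simp: l_def F_def)
  have inj: "inj_on (dual_map A F M l) (carrier (dual A M))"
  proof (rule inj_onI)
    fix f h assume "f \<in> carrier (dual A M)" "h \<in> carrier (dual A M)"
      and eq: "dual_map A F M l f = dual_map A F M l h"
    then have f: "f \<in> Hom A M (regular_module A)" and h: "h \<in> Hom A M (regular_module A)" by simp_all
    show "f = h"
    proof (rule Hom_ext[OF f h])
      fix x assume "x \<in> carrier M"
      then obtain c where "c \<in> carrier F" "x = l c" using lsurj by blast
      then show "f x = h x" using fun_cong[OF eq, of c] f h by (simp add: dual_map_def)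
    qed
  qed
  have "fg_module (opp_ring A) (dual A F)"
    unfolding F_def by (rule dual_basis_fg_dual[OF right_module_free[OF R] dual_basis_free[OF R]])
  then have "finite_length (opp_ring A) (dual A F)" by (rule fg_finite_length[OF FO])
  then show ?thesis
    by (rule finite_length_inj[OF right_module_dual[OF M] right_module_dual[OF F] dual_map_Hom[OF F M l] inj])
qed

text \<open>\<open>Trm\<close> is \<open>coker g\<^sup>*\<close>, and \<open>kappa\<close> identifies the kernel \<open>K\<close> of \<open>g\<close> with its dual.\<close>

locale presentation =
  fixes A :: "('a, 'r) ring_scheme" and P1 :: "('a, 'p, 'e) module_scheme"
    and P0 :: "('a, 'q, 'f) module_scheme" and g :: "'p \<Rightarrow> 'q"
  assumes P1: "fg_projective A P1" and P0: "fg_projective A P0" and g: "g \<in> Hom A P1 P0"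
begin

lemma rP1: "right_module A P1" and rP0: "right_module A P0"
  using projectiveD(2) P1 P0 by blast+

lemma ring_A: "ring A" by (rule right_module_ring[OF rP1])

sublocale P1: right_module A P1 by (rule rP1)
sublocale P0: right_module A P0 by (rule rP0)
sublocale D1: right_module "opp_ring A" "dual A P1" by (rule right_module_dual[OF rP1])

definition "im = dual_map A P1 P0 g ` carrier (dual A P0)"
definition "Trm = quotient_module (dual A P1) im"
definition "K = a_kernel P1 P0 g"
definition "KM = P1\<lparr>carrier := K\<rparr>"

lemma im_submodule: "submodule im (opp_ring A) (dual A P1)"
  unfolding im_def
  by (rule Hom_image_submodule[OF right_module_dual[OF rP0] right_module_dual[OF rP1] dual_map_Hom[OF rP1 rP0 g]
        right_module.carrier_submodule[OF right_module_dual[OF rP0]]])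

lemma right_module_Trm: "right_module (opp_ring A) Trm"
  unfolding Trm_def by (rule D1.right_module_quotient[OF im_submodule])

lemma K_submodule: "submodule K A P1"
  unfolding K_def by (rule Hom_kernel_submodule[OF rP1 rP0 g])

lemma right_module_KM: "right_module A KM"
  unfolding KM_def by (rule submodule_right_module[OF rP1 K_submodule])

lemma KM_simps [simp]: "carrier KM = K" "add KM = add P1" "smult KM = smult P1" "zero KM = zero P1"
  by (simp_all add: KM_def)

lemma K_closed: "x \<in> K \<Longrightarrow> x \<in> carrier P1"
  using K_submodule by (auto simp: P1.submodule_iff)

lemma im_vanishes: "\<phi> \<in> im \<Longrightarrow> x \<in> K \<Longrightarrow> \<phi> x = \<zero>\<^bsub>A\<^esub>"
  using Hom_zero[OF rP0 right_module_regular[OF ring_A]]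
  by (auto simp: im_def K_def a_kernel_eq dual_map_def)

definition "cls \<phi> = im +>\<^bsub>dual A P1\<^esub> \<phi>"

lemma carrier_Trm: "carrier Trm = cls ` Hom A P1 (regular_module A)"
  unfolding Trm_def cls_def using D1.quotient_simps(1)[OF im_submodule] by simp

lemma cls_Hom: "(\<lambda>\<phi>\<in>carrier (dual A P1). cls \<phi>) \<in> Hom (opp_ring A) (dual A P1) Trm"
  unfolding Trm_def cls_def by (rule D1.quotient_Hom[OF im_submodule])

lemma cls_zero_iff: "\<phi> \<in> Hom A P1 (regular_module A) \<Longrightarrow> cls \<phi> = \<zero>\<^bsub>Trm\<^esub> \<longleftrightarrow> \<phi> \<in> im"
  unfolding Trm_def cls_def using D1.quotient_zero_iff[OF im_submodule] by simp

lemma cls_mem: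
  assumes \<phi>: "\<phi> \<in> Hom A P1 (regular_module A)" and x: "x \<in> K"
  shows "\<phi> \<in> cls \<phi>" "\<psi> \<in> cls \<phi> \<Longrightarrow> \<psi> x = \<phi> x"
proof -
  have \<phi>': "\<phi> \<in> carrier (dual A P1)" using \<phi> by simp
  have eq: "cls \<phi> = {\<psi> \<in> carrier (dual A P1). \<psi> \<ominus>\<^bsub>dual A P1\<^esub> \<phi> \<in> im}"
    unfolding cls_def by (rule D1.coset_eq[OF im_submodule \<phi>'])
  have "\<phi> \<ominus>\<^bsub>dual A P1\<^esub> \<phi> = \<zero>\<^bsub>dual A P1\<^esub>" using D1.minus_eq_zero_iff[OF \<phi>' \<phi>'] by simp
  then have "\<phi> \<ominus>\<^bsub>dual A P1\<^esub> \<phi> \<in> im" using im_submodule unfolding D1.submodule_iff by simp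
  then show "\<phi> \<in> cls \<phi>" unfolding eq using \<phi>' by blast
  assume "\<psi> \<in> cls \<phi>"
  then have \<psi>: "\<psi> \<in> carrier (dual A P1)" "\<psi> \<ominus>\<^bsub>dual A P1\<^esub> \<phi> \<in> im" unfolding eq by auto
  have "\<psi> = (\<psi> \<ominus>\<^bsub>dual A P1\<^esub> \<phi>) \<oplus>\<^bsub>dual A P1\<^esub> \<phi>"
    using \<psi>(1) \<phi>' by (simp only: a_minus_def D1.M.a_assoc D1.M.a_inv_closed D1.M.l_neg D1.M.r_zero)
  then have "\<psi> x = ((\<psi> \<ominus>\<^bsub>dual A P1\<^esub> \<phi>) \<oplus>\<^bsub>dual A P1\<^esub> \<phi>) x" by simp
  also have "\<dots> = (\<psi> \<ominus>\<^bsub>dual A P1\<^esub> \<phi>) x \<oplus>\<^bsub>A\<^esub> \<phi> x" using K_closed[OF x] by simp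
  also have "\<dots> = \<phi> x" using im_vanishes[OF \<psi>(2) x] dual_closed[OF \<phi> K_closed[OF x]] by simp
  finally show "\<psi> x = \<phi> x" .
qed

text \<open>The choice of the representative does not matter, since \<open>im\<close> vanishes on \<open>K\<close>.\<close>

definition "kappa x = (\<lambda>t\<in>carrier Trm. (SOME \<phi>. \<phi> \<in> t) x)"

lemma kappa_cls:
  assumes "\<phi> \<in> Hom A P1 (regular_module A)" "x \<in> K"
  shows "kappa x (cls \<phi>) = \<phi> x"
proof -
  have "(SOME \<psi>. \<psi> \<in> cls \<phi>) \<in> cls \<phi>"     by (rule someI[of "\<lambda>\<psi>. \<psi> \<in> cls \<phi>", OF cls_mem(1)[OF assms]])
  then show ?thesis
    using cls_mem(2)[OF assms] assms by (simp add: kappa_def carrier_Trm)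
qed

lemma cls_closed: "\<phi> \<in> Hom A P1 (regular_module A) \<Longrightarrow> cls \<phi> \<in> carrier Trm"
  by (simp add: carrier_Trm)

lemma cls_add: "\<phi> \<in> Hom A P1 (regular_module A) \<Longrightarrow> \<psi> \<in> Hom A P1 (regular_module A) \<Longrightarrow>
  cls \<phi> \<oplus>\<^bsub>Trm\<^esub> cls \<psi> = cls (\<phi> \<oplus>\<^bsub>dual A P1\<^esub> \<psi>)"
  unfolding Trm_def cls_def by (rule D1.quotient_simps(3)[OF im_submodule]) simp_all

lemma cls_smult: "a \<in> carrier A \<Longrightarrow> \<phi> \<in> Hom A P1 (regular_module A) \<Longrightarrow>
  a \<odot>\<^bsub>Trm\<^esub> cls \<phi> = cls (a \<odot>\<^bsub>dual A P1\<^esub> \<phi>)"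
  unfolding Trm_def cls_def by (rule D1.quotient_simps(4)[OF im_submodule]) simp_all

lemma Trm_cases:
  assumes "t \<in> carrier Trm" obtains \<phi> where "\<phi> \<in> Hom A P1 (regular_module A)" "t = cls \<phi>"
  using assms by (auto simp: carrier_Trm)

lemma kappa_closed:
  assumes x: "x \<in> K" shows "kappa x \<in> Hom (opp_ring A) Trm (regular_module (opp_ring A))"
proof (rule HomI)
  note xP = K_closed[OF x]
  fix t assume "t \<in> carrier Trm"
  then obtain \<phi> where \<phi>: "\<phi> \<in> Hom A P1 (regular_module A)" "t = cls \<phi>" by (rule Trm_cases)
  show "kappa x t \<in> carrier (regular_module (opp_ring A))"
    using kappa_cls[OF \<phi>(1) x] dual_closed[OF \<phi>(1) xP] \<phi>(2) by simp
  {
    fix s assume "s \<in> carrier Trm"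
    then obtain \<psi> where \<psi>: "\<psi> \<in> Hom A P1 (regular_module A)" "s = cls \<psi>" by (rule Trm_cases)
    have "\<phi> \<oplus>\<^bsub>dual A P1\<^esub> \<psi> \<in> carrier (dual A P1)" using \<phi>(1) \<psi>(1) by (intro D1.M.a_closed) simp_all
    then have c: "\<phi> \<oplus>\<^bsub>dual A P1\<^esub> \<psi> \<in> Hom A P1 (regular_module A)" by simp
    show "kappa x (t \<oplus>\<^bsub>Trm\<^esub> s) = kappa x t \<oplus>\<^bsub>regular_module (opp_ring A)\<^esub> kappa x s"
      unfolding \<phi>(2) \<psi>(2) cls_add[OF \<phi>(1) \<psi>(1)] kappa_cls[OF c x] kappa_cls[OF \<phi>(1) x] kappa_cls[OF \<psi>(1) x]
      using xP by simp
  }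
  {
    fix a assume "a \<in> carrier (opp_ring A)"
    then have a: "a \<in> carrier A" by simp
    have "a \<odot>\<^bsub>dual A P1\<^esub> \<phi> \<in> carrier (dual A P1)" using \<phi>(1) a by (intro D1.smult_closed) simp_all
    then have c: "a \<odot>\<^bsub>dual A P1\<^esub> \<phi> \<in> Hom A P1 (regular_module A)" by simp
    show "kappa x (a \<odot>\<^bsub>Trm\<^esub> t) = a \<odot>\<^bsub>regular_module (opp_ring A)\<^esub> kappa x t"
      unfolding \<phi>(2) cls_smult[OF a \<phi>(1)] kappa_cls[OF c x] kappa_cls[OF \<phi>(1) x]
      using xP by simp
  }
qed (simp add: kappa_def)

text \<open>Pulled back along \<open>cls\<close>, the functional becomes one on the dual of
  \<open>P1\<close>, hence evaluation at some \<open>x\<close> of \<open>P1\<close>. It kills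
  \<open>f\<close> composed with \<open>g\<close> for every functional \<open>f\<close> on
  \<open>P0\<close>, and those functionals separate the points of the projective \<open>P0\<close>;
  so \<open>g x\<close> is zero and \<open>x\<close> lies in \<open>K\<close>.\<close>

lemma kappa_surj:
  assumes F: "F \<in> Hom (opp_ring A) Trm (regular_module (opp_ring A))"
  shows "\<exists>x\<in>K. F = kappa x"
proof -
  obtain n1 e1 \<phi>1 where db1: "dual_basis A P1 n1 e1 \<phi>1" using projective_dual_basis[OF P1] by blast
  obtain n0 e0 \<phi>0 where db0: "dual_basis A P0 n0 e0 \<phi>0" using projective_dual_basis[OF P0] by blast
  have AO: "right_module (opp_ring A) (regular_module (opp_ring A))"
    by (rule right_module_regular[OF ring_opp[OF ring_A]])
  have "(\<lambda>\<phi>\<in>carrier (dual A P1). F ((\<lambda>\<phi>\<in>carrier (dual A P1). cls \<phi>) \<phi>))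
    \<in> Hom (opp_ring A) (dual A P1) (regular_module (opp_ring A))"
    by (rule Hom_comp[OF D1.right_module_axioms cls_Hom F])
  from dual_basis_reflexive[OF rP1 db1 this]
  obtain x where x: "x \<in> carrier P1" "\<And>\<phi>. \<phi> \<in> Hom A P1 (regular_module A) \<Longrightarrow> F (cls \<phi>) = \<phi> x" by auto
  have "g x = \<zero>\<^bsub>P0\<^esub>"
  proof (rule dual_basis_separates[OF rP0 db0 Hom_closed[OF g x(1)]])
    fix f assume f: "f \<in> Hom A P0 (regular_module A)"
    let ?f = "dual_map A P1 P0 g f"
    have fi: "?f \<in> im" unfolding im_def using f by simp
    then have fH: "?f \<in> Hom A P1 (regular_module A)" using im_submodule unfolding D1.submodule_iff by auto
    have "f (g x) = ?f x" using f x(1) by (simp add: dual_map_def)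
    also have "\<dots> = F (cls ?f)" using x(2)[OF fH] by simp
    also have "\<dots> = F \<zero>\<^bsub>Trm\<^esub>" using cls_zero_iff[OF fH] fi by simp
    also have "\<dots> = \<zero>\<^bsub>A\<^esub>" using Hom_zero[OF right_module_Trm AO F] by simp
    finally show "f (g x) = \<zero>\<^bsub>A\<^esub>" .
  qed
  then have xK: "x \<in> K" using x(1) by (simp add: K_def a_kernel_eq)
  have "F = kappa x"
  proof (rule Hom_ext[OF F kappa_closed[OF xK]])
    fix t assume "t \<in> carrier Trm"
    then obtain \<phi> where "\<phi> \<in> Hom A P1 (regular_module A)" "t = cls \<phi>" by (rule Trm_cases)
    then show "F t = kappa x t" using x(2) kappa_cls[OF _ xK] by simp
  qed
  then show ?thesis using xK by blast
qed

lemma kappa_add: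
  assumes "x \<in> K" "y \<in> K"
  shows "kappa (x \<oplus>\<^bsub>P1\<^esub> y) = kappa x \<oplus>\<^bsub>dual (opp_ring A) Trm\<^esub> kappa y"
proof (rule extensionalityI)
  have xy: "x \<oplus>\<^bsub>P1\<^esub> y \<in> K" using K_submodule assms by (simp add: P1.submodule_iff)
  fix t assume t: "t \<in> carrier Trm"
  then obtain \<phi> where \<phi>: "\<phi> \<in> Hom A P1 (regular_module A)" "t = cls \<phi>" by (rule Trm_cases)
  show "kappa (x \<oplus>\<^bsub>P1\<^esub> y) t = (kappa x \<oplus>\<^bsub>dual (opp_ring A) Trm\<^esub> kappa y) t"
    using t unfolding \<phi>(2) by (simp add: kappa_cls \<phi>(1) xy assms Hom_add[OF \<phi>(1)] K_closed)
qed (simp_all add: kappa_def)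

lemma kappa_smult:
  assumes "x \<in> K" "a \<in> carrier A"
  shows "kappa (a \<odot>\<^bsub>P1\<^esub> x) = a \<odot>\<^bsub>dual (opp_ring A) Trm\<^esub> kappa x"
proof (rule extensionalityI)
  have xy: "a \<odot>\<^bsub>P1\<^esub> x \<in> K" using K_submodule assms by (simp add: P1.submodule_iff)
  fix t assume t: "t \<in> carrier Trm"
  then obtain \<phi> where \<phi>: "\<phi> \<in> Hom A P1 (regular_module A)" "t = cls \<phi>" by (rule Trm_cases)
  show "kappa (a \<odot>\<^bsub>P1\<^esub> x) t = (a \<odot>\<^bsub>dual (opp_ring A) Trm\<^esub> kappa x) t"
    using t unfolding \<phi>(2) by (simp add: kappa_cls \<phi>(1) xy assms Hom_smult[OF \<phi>(1)] K_closed)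
qed (simp_all add: kappa_def)

text \<open>Surjectivity is \<open>kappa_surj\<close>. For injectivity, an \<open>x\<close> in
  \<open>K\<close> with \<open>kappa x\<close> zero is killed by every functional on the projective
  \<open>P1\<close>.\<close>

lemma kappa_iso: "(\<lambda>x\<in>carrier KM. kappa x) \<in> module_iso A KM (dual (opp_ring A) Trm)" (is "?k \<in> _")
proof -
  have H: "?k \<in> Hom A KM (dual (opp_ring A) Trm)"
    using kappa_closed kappa_add kappa_smult by (intro restrict_HomI[OF right_module_KM]) (simp_all only: KM_simps dual_simps(1))
  obtain n1 e1 \<phi>1 where db1: "dual_basis A P1 n1 e1 \<phi>1" using projective_dual_basis[OF P1] by blast
  have D: "right_module A (dual (opp_ring A) Trm)" using right_module_dual[OF right_module_Trm] by simp
  have "inj_on ?k (carrier KM)"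
    unfolding Hom_inj_on_iff[OF right_module_KM D H]
  proof (intro ballI impI)
    fix x assume "x \<in> carrier KM" and z: "?k x = \<zero>\<^bsub>dual (opp_ring A) Trm\<^esub>"
    then have x: "x \<in> K" by simp
    have "x = \<zero>\<^bsub>P1\<^esub>"
    proof (rule dual_basis_separates[OF rP1 db1 K_closed[OF x]])
      fix f assume f: "f \<in> Hom A P1 (regular_module A)"
      have "f x = kappa x (cls f)" using kappa_cls[OF f x] by simp
      also have "\<dots> = \<zero>\<^bsub>A\<^esub>" using fun_cong[OF z, of "cls f"] x cls_closed[OF f] by simp
      finally show "f x = \<zero>\<^bsub>A\<^esub>" .
    qed
    then show "x = \<zero>\<^bsub>KM\<^esub>" by simp
  qed
  moreover have "?k ` carrier KM = carrier (dual (opp_ring A) Trm)"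
    using kappa_surj kappa_closed by (auto simp: image_iff)
  ultimately show ?thesis using H by (simp add: module_iso_def bij_betw_def)
qed

text \<open>Written through \<open>kappa\<close>, the map is a function of the class from the start;
  \<open>u_cls\<close> recovers the restriction to \<open>K\<close>.\<close>

definition "u = (\<lambda>t\<in>carrier Trm. \<lambda>x\<in>K. kappa x t)"

lemma u_cls: "\<phi> \<in> Hom A P1 (regular_module A) \<Longrightarrow> u (cls \<phi>) = (\<lambda>x\<in>K. \<phi> x)"
  by (simp add: u_def cls_closed kappa_cls cong: restrict_cong)

lemma u_Hom: "u \<in> Hom (opp_ring A) Trm (dual A KM)"
  unfolding u_def
proof (rule restrict_HomI[OF right_module_Trm])
  fix t assume t: "t \<in> carrier Trm"
  then obtain \<phi> where \<phi>: "\<phi> \<in> Hom A P1 (regular_module A)" "t = cls \<phi>" by (rule Trm_cases)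
  have "(\<lambda>x\<in>K. \<phi> x) \<in> Hom A KM (regular_module A)"
    unfolding KM_def by (rule Hom_restrict[OF rP1 K_submodule \<phi>(1)])
  then show "(\<lambda>x\<in>K. kappa x t) \<in> carrier (dual A KM)"
    using u_cls[OF \<phi>(1)] t \<phi>(2) by (simp add: u_def)
  {
    fix s assume "s \<in> carrier Trm"
    then show "(\<lambda>x\<in>K. kappa x (t \<oplus>\<^bsub>Trm\<^esub> s)) = (\<lambda>x\<in>K. kappa x t) \<oplus>\<^bsub>dual A KM\<^esub> (\<lambda>x\<in>K. kappa x s)"
      using t by (simp add: Hom_add[OF kappa_closed] cong: restrict_cong)
  }
  {
    fix a assume "a \<in> carrier (opp_ring A)"
    then show "(\<lambda>x\<in>K. kappa x (a \<odot>\<^bsub>Trm\<^esub> t)) = a \<odot>\<^bsub>dual A KM\<^esub> (\<lambda>x\<in>K. kappa x t)"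
      using t by (simp add: Hom_smult[OF kappa_closed] cong: restrict_cong)
  }
qed

lemma right_module_KM_dual: "right_module (opp_ring A) (dual A KM)"
  by (rule right_module_dual[OF right_module_KM])

text \<open>Both conditions speak of the presentation alone. In a resolution that starts with it,
  the next term covers \<open>K\<close>; then functionals on \<open>P1\<close> that vanish on
  \<open>K\<close> are the 1-cocycles, and functionals on \<open>K\<close> correspond to the
  2-cocycles, so \<open>vanishing\<close> and \<open>extending\<close> express that the first and
  the second Ext are zero.\<close>

definition "vanishing \<longleftrightarrow> (\<forall>\<phi>\<in>Hom A P1 (regular_module A). (\<forall>x\<in>K. \<phi> x = \<zero>\<^bsub>A\<^esub>) \<longrightarrow> \<phi> \<in> im)"
definition "extending \<longleftrightarrow> (\<forall>f\<in>Hom A KM (regular_module A). \<exists>\<phi>\<in>Hom A P1 (regular_module A). \<forall>x\<in>K. \<phi> x = f x)"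

lemma u_inj_iff: "inj_on u (carrier Trm) \<longleftrightarrow> vanishing"
proof -
  have "(\<forall>t\<in>carrier Trm. u t = \<zero>\<^bsub>dual A KM\<^esub> \<longrightarrow> t = \<zero>\<^bsub>Trm\<^esub>) \<longleftrightarrow>
    (\<forall>\<phi>\<in>Hom A P1 (regular_module A). u (cls \<phi>) = \<zero>\<^bsub>dual A KM\<^esub> \<longrightarrow> cls \<phi> = \<zero>\<^bsub>Trm\<^esub>)"
    unfolding carrier_Trm by blast
  also have "\<dots> \<longleftrightarrow> vanishing"
    unfolding vanishing_def
  proof (intro ball_cong refl)
    fix \<phi> assume \<phi>: "\<phi> \<in> Hom A P1 (regular_module A)"
    have "(\<lambda>x\<in>K. \<phi> x) = (\<lambda>x\<in>K. \<zero>\<^bsub>A\<^esub>) \<longleftrightarrow> (\<forall>x\<in>K. \<phi> x = \<zero>\<^bsub>A\<^esub>)"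
      by (metis restrict_apply' restrict_ext)
    then show "(u (cls \<phi>) = \<zero>\<^bsub>dual A KM\<^esub> \<longrightarrow> cls \<phi> = \<zero>\<^bsub>Trm\<^esub>) \<longleftrightarrow> ((\<forall>x\<in>K. \<phi> x = \<zero>\<^bsub>A\<^esub>) \<longrightarrow> \<phi> \<in> im)"
      by (simp add: u_cls[OF \<phi>] cls_zero_iff[OF \<phi>])
  qed
  finally show ?thesis by (simp add: Hom_inj_on_iff[OF right_module_Trm right_module_KM_dual u_Hom])
qed

lemma u_surj_iff: "u ` carrier Trm = carrier (dual A KM) \<longleftrightarrow> extending"
proof -
  have "u ` carrier Trm = carrier (dual A KM) \<longleftrightarrow> (\<forall>f\<in>carrier (dual A KM). f \<in> u ` carrier Trm)"
    using Hom_closed[OF u_Hom] by blast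
  also have "\<dots> \<longleftrightarrow> extending"
    unfolding extending_def dual_simps
  proof (intro ball_cong refl)
    fix f assume f: "f \<in> Hom A KM (regular_module A)"
    have "f \<in> u ` carrier Trm \<longleftrightarrow> (\<exists>\<phi>\<in>Hom A P1 (regular_module A). f = u (cls \<phi>))"
      unfolding carrier_Trm by blast
    also have "\<dots> \<longleftrightarrow> (\<exists>\<phi>\<in>Hom A P1 (regular_module A). \<forall>x\<in>K. \<phi> x = f x)"
    proof (intro bex_cong refl)
      fix \<phi> assume \<phi>: "\<phi> \<in> Hom A P1 (regular_module A)"
      have "f \<in> extensional K" using Hom_extensional[OF f] by simp
      then have "f = (\<lambda>x\<in>K. \<phi> x) \<longleftrightarrow> (\<forall>x\<in>K. \<phi> x = f x)"
        by (metis extensional_restrict restrict_apply' restrict_ext)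
      then show "f = u (cls \<phi>) \<longleftrightarrow> (\<forall>x\<in>K. \<phi> x = f x)" by (simp add: u_cls[OF \<phi>])
    qed
    finally show "f \<in> u ` carrier Trm \<longleftrightarrow> (\<exists>\<phi>\<in>Hom A P1 (regular_module A). \<forall>x\<in>K. \<phi> x = f x)" .
  qed
  finally show ?thesis .
qed

lemma u_iso_iff: "u \<in> module_iso (opp_ring A) Trm (dual A KM) \<longleftrightarrow> vanishing \<and> extending"
  using u_Hom by (simp only: module_iso_def bij_betw_def mem_Collect_eq u_inj_iff u_surj_iff simp_thms)

text \<open>Composed with the isomorphism \<open>E\<close> dual to \<open>kappa\<close>, the evaluation map becomes \<open>u\<close>.\<close>

lemma reflexive_iff: "reflexive (opp_ring A) Trm \<longleftrightarrow> u \<in> module_iso (opp_ring A) Trm (dual A KM)"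
proof -
  let ?T' = "dual (opp_ring A) Trm"
  let ?k = "\<lambda>x\<in>carrier KM. kappa x"
  have kH: "?k \<in> Hom A KM ?T'" and kbij: "bij_betw ?k (carrier KM) (carrier ?T')"
    using kappa_iso by (simp_all add: module_iso_def)
  have T': "right_module A ?T'" using right_module_dual[OF right_module_Trm] by simp
  define E where "E = dual_map A KM ?T' ?k"
  have EH: "E \<in> Hom (opp_ring A) (dual A ?T') (dual A KM)"
    unfolding E_def by (rule dual_map_Hom[OF right_module_KM T' kH])
  have E: "E f x = f (kappa x)" if "f \<in> carrier (dual A ?T')" "x \<in> K" for f x
    using that by (simp add: E_def dual_map_def)
  let ?ev = "evaluation (opp_ring A) Trm"
  have ev: "?ev \<in> Hom (opp_ring A) Trm (dual A ?T')"
    using evaluation_Hom[OF right_module_Trm] by simp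
  have Einj: "inj_on E (carrier (dual A ?T'))"
  proof (rule inj_onI)
    fix f h assume f: "f \<in> carrier (dual A ?T')" and h: "h \<in> carrier (dual A ?T')" and eq: "E f = E h"
    show "f = h"
    proof (rule Hom_ext[of f A ?T' "regular_module A" h "regular_module A"])
      fix F assume "F \<in> carrier ?T'"
      then obtain x where x: "x \<in> K" "F = kappa x" using kappa_surj by auto
      show "f F = h F" using E[OF f x(1)] E[OF h x(1)] eq x(2) by simp
    qed (use f h in auto)
  qed
  have Esurj: "E ` carrier (dual A ?T') = carrier (dual A KM)"
  proof
    show "E ` carrier (dual A ?T') \<subseteq> carrier (dual A KM)" using Hom_closed[OF EH] by blast
    show "carrier (dual A KM) \<subseteq> E ` carrier (dual A ?T')"
    proof
      fix f assume "f \<in> carrier (dual A KM)"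
      then have f: "f \<in> Hom A KM (regular_module A)" by simp
      \<comment> \<open>The preimage of \<open>f\<close> under \<open>E\<close> is \<open>f\<close>
        composed with the inverse of \<open>kappa\<close>.\<close>
      let ?i = "\<lambda>y\<in>carrier ?T'. inv_into (carrier KM) ?k y"
      have i: "?i \<in> Hom A ?T' KM" using module_iso_inv[OF right_module_KM T' kappa_iso] by (simp add: module_iso_def)
      let ?h = "\<lambda>y\<in>carrier ?T'. f (?i y)"
      have h: "?h \<in> Hom A ?T' (regular_module A)" by (rule Hom_comp[OF T' i f])
      have hc: "?h \<in> carrier (dual A ?T')" using h by simp
      have "E ?h = f"
      proof (rule Hom_ext[OF _ f])
        show "E ?h \<in> Hom A KM (regular_module A)" using Hom_closed[OF EH hc] by simp
        fix x assume x: "x \<in> carrier KM"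
        have kx: "kappa x \<in> carrier ?T'" using kappa_closed x by simp
        have inv: "inv_into (carrier KM) ?k (?k x) = x" by (rule bij_betw_inv_into_left[OF kbij x])
        have xK: "x \<in> K" using x by simp
        have "?k x = kappa x" using x by (rule restrict_apply')
        then have "?i (kappa x) = x" using inv restrict_apply'[OF kx, of "inv_into (carrier KM) ?k"] by (simp only:)
        then have "f x = f (?i (kappa x))" by (simp only:)
        also have "\<dots> = ?h (kappa x)" by (rule restrict_apply'[OF kx, symmetric])
        also have "\<dots> = E ?h x" by (rule E[OF hc xK, symmetric])
        finally show "E ?h x = f x" by (rule sym)
      qed
      then show "f \<in> E ` carrier (dual A ?T')" by (rule image_eqI[OF sym hc])
    qed
  qed
  have Eev: "E (?ev t) = u t" if t: "t \<in> carrier Trm" for t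
  proof -
    have et: "?ev t \<in> carrier (dual A ?T')" by (rule Hom_closed[OF ev t])
    show ?thesis
    proof (rule Hom_ext[of _ A KM "regular_module A" _ "regular_module A"])
      show "E (?ev t) \<in> Hom A KM (regular_module A)" using Hom_closed[OF EH et] by simp
      show "u t \<in> Hom A KM (regular_module A)" using Hom_closed[OF u_Hom t] by simp
      fix x assume "x \<in> carrier KM"
      then have x: "x \<in> K" by simp
      show "E (?ev t) x = u t x"
        using E[OF et x] t x kappa_closed[OF x] by (simp add: evaluation_def u_def)
    qed
  qed
  have "bij_betw ?ev (carrier Trm) (carrier (dual A ?T')) \<longleftrightarrow> bij_betw u (carrier Trm) (carrier (dual A KM))"
  proof -
    have Ebij: "bij_betw E (carrier (dual A ?T')) (carrier (dual A KM))"
      using Einj Esurj by (simp add: bij_betw_def)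
    have evs: "?ev ` carrier Trm \<subseteq> carrier (dual A ?T')" using Hom_closed[OF ev] by blast
    have "bij_betw ?ev (carrier Trm) (carrier (dual A ?T')) \<longleftrightarrow>
        bij_betw (E \<circ> ?ev) (carrier Trm) (carrier (dual A KM))"
      by (rule bij_betw_comp_iff2[OF Ebij evs])
    also have "\<dots> \<longleftrightarrow> bij_betw u (carrier Trm) (carrier (dual A KM))"
      by (rule bij_betw_cong) (simp add: Eev)
    finally show ?thesis .
  qed
  then show ?thesis
    using ev u_Hom by (simp add: reflexive_def module_iso_def)
qed

text \<open>For \<open>x \<in> K\<close> the map \<open>t \<mapsto> l t x\<close> lies in the dual of \<open>Trm\<close>, so it is \<open>kappa y\<close> for some \<open>y \<in> K\<close>:
  if \<open>\<phi>\<close> vanishes on \<open>K\<close>, then so does \<open>l (cls \<phi>)\<close>. Thus \<open>u\<close> is injective, and \<open>l\<inverse> u\<close> is an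
  injective endomorphism of a module of finite length.\<close>

lemma iso_imp_u_iso:
  assumes FT: "finite_length (opp_ring A) Trm" and l: "l \<in> module_iso (opp_ring A) Trm (dual A KM)"
  shows "u \<in> module_iso (opp_ring A) Trm (dual A KM)"
proof -
  have lH: "l \<in> Hom (opp_ring A) Trm (dual A KM)" and lbij: "bij_betw l (carrier Trm) (carrier (dual A KM))"
    using l by (simp_all add: module_iso_def)
  interpret T: right_module "opp_ring A" Trm by (rule right_module_Trm)
  have v: vanishing
    unfolding vanishing_def
  proof (intro ballI impI)
    fix \<phi> assume \<phi>: "\<phi> \<in> Hom A P1 (regular_module A)" and z: "\<forall>x\<in>K. \<phi> x = \<zero>\<^bsub>A\<^esub>"
    have "l (cls \<phi>) = \<zero>\<^bsub>dual A KM\<^esub>"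
    proof (rule Hom_ext[of _ A KM "regular_module A" _ "regular_module A"])
      show "l (cls \<phi>) \<in> Hom A KM (regular_module A)" using Hom_closed[OF lH cls_closed[OF \<phi>]] by simp
      show "\<zero>\<^bsub>dual A KM\<^esub> \<in> Hom A KM (regular_module A)"
        using right_module.carrier_submodule[OF right_module_KM_dual]
        unfolding right_module.submodule_iff[OF right_module_KM_dual] by simp
      fix x assume x: "x \<in> carrier KM"
      have "(\<lambda>s\<in>carrier Trm. (\<lambda>f\<in>carrier (dual A KM). f x) (l s)) \<in> Hom (opp_ring A) Trm (regular_module (opp_ring A))"
        by (rule Hom_comp[OF right_module_Trm lH evaluation_at_Hom[OF right_module_KM x]])
      then obtain y where y: "y \<in> K" "(\<lambda>s\<in>carrier Trm. (\<lambda>f\<in>carrier (dual A KM). f x) (l s)) = kappa y"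
        using kappa_surj by blast
      have "l (cls \<phi>) x = kappa y (cls \<phi>)"
        using fun_cong[OF y(2), of "cls \<phi>"] cls_closed[OF \<phi>] Hom_closed[OF lH cls_closed[OF \<phi>]] by simp
      also have "\<dots> = \<zero>\<^bsub>A\<^esub>" using kappa_cls[OF \<phi> y(1)] z y(1) by simp
      finally show "l (cls \<phi>) x = \<zero>\<^bsub>dual A KM\<^esub> x" using x by simp
    qed
    then have "cls \<phi> = \<zero>\<^bsub>Trm\<^esub>"
      using lbij Hom_inj_on_iff[OF right_module_Trm right_module_KM_dual lH] cls_closed[OF \<phi>]
      unfolding bij_betw_def by blast
    then show "\<phi> \<in> im" using cls_zero_iff[OF \<phi>] by simp
  qed
  have uinj: "inj_on u (carrier Trm)" using v u_inj_iff by blast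
  define i where "i = (\<lambda>y\<in>carrier (dual A KM). inv_into (carrier Trm) l y)"
  have i: "i \<in> module_iso (opp_ring A) (dual A KM) Trm"
    unfolding i_def by (rule module_iso_inv[OF right_module_Trm right_module_KM_dual l])
  have iH: "i \<in> Hom (opp_ring A) (dual A KM) Trm" and ibij: "bij_betw i (carrier (dual A KM)) (carrier Trm)"
    using i by (simp_all add: module_iso_def)
  let ?m = "\<lambda>t\<in>carrier Trm. i (u t)"
  have m: "?m \<in> Hom (opp_ring A) Trm Trm" by (rule Hom_comp[OF right_module_Trm u_Hom iH])
  have "inj_on ?m (carrier Trm)"
  proof (rule inj_onI)
    fix s t assume st: "s \<in> carrier Trm" "t \<in> carrier Trm" "?m s = ?m t"
    then have "i (u s) = i (u t)" by simp
    then have "u s = u t"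
      using ibij Hom_closed[OF u_Hom] st(1,2) unfolding bij_betw_def by (meson inj_onD)
    then show "s = t" using uinj st(1,2) by (meson inj_onD)
  qed
  then have ms: "?m ` carrier Trm = carrier Trm"
    by (rule injective_endo_surj[OF right_module_Trm FT m])
  have "carrier (dual A KM) \<subseteq> u ` carrier Trm"
  proof
    fix f assume f: "f \<in> carrier (dual A KM)"
    then have "i f \<in> ?m ` carrier Trm" unfolding ms by (rule Hom_closed[OF iH])
    then obtain t where t: "t \<in> carrier Trm" "i f = i (u t)" by auto
    then have "f = u t" using ibij f Hom_closed[OF u_Hom t(1)] unfolding bij_betw_def by (meson inj_onD)
    then show "f \<in> u ` carrier Trm" using t(1) by blast
  qed
  then have "u ` carrier Trm = carrier (dual A KM)" using Hom_closed[OF u_Hom] by blast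
  then show ?thesis using uinj u_Hom by (simp add: module_iso_def bij_betw_def)
qed

end

section \<open>Matlis duality for modules of finite length\<close>

text \<open>Preimages under \<open>h\<close> are picked by \<open>inv_into\<close>. The kernel
  condition makes the value of \<open>z\<close> independent of the pick, which also yields
  linearity.\<close>

lemma factor_through_surj:
  assumes M: "right_module A M" and N: "right_module A N" and Y: "right_module A Y"
    and h: "h \<in> Hom A M N" "h ` carrier M = carrier N" and z: "z \<in> Hom A M Y"
    and ker: "\<And>x. x \<in> carrier M \<Longrightarrow> h x = \<zero>\<^bsub>N\<^esub> \<Longrightarrow> z x = \<zero>\<^bsub>Y\<^esub>"
  shows "\<exists>f\<in>Hom A N Y. \<forall>x\<in>carrier M. f (h x) = z x"
proof -
  interpret M: right_module A M by fact
  interpret N: right_module A N by fact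
  interpret Y: right_module A Y by fact
  have eq: "z x = z y" if xy: "x \<in> carrier M" "y \<in> carrier M" "h x = h y" for x y
  proof -
    have "h (x \<ominus>\<^bsub>M\<^esub> y) = \<zero>\<^bsub>N\<^esub>"
      using Hom_diff[OF M N h(1) xy(1,2)] xy(3) Hom_closed[OF h(1) xy(2)] by (simp add: N.minus_eq_zero_iff)
    then have "z (x \<ominus>\<^bsub>M\<^esub> y) = \<zero>\<^bsub>Y\<^esub>" using ker xy by simp
    then show ?thesis
      using Hom_diff[OF M Y z xy(1,2)] Hom_closed[OF z] xy(1,2) by (simp add: Y.minus_eq_zero_iff)
  qed
  let ?f = "\<lambda>y\<in>carrier N. z (inv_into (carrier M) h y)"
  have f: "?f (h x) = z x" if x: "x \<in> carrier M" for x
  proof -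
    have "h x \<in> h ` carrier M" using x by blast
    then have "inv_into (carrier M) h (h x) \<in> carrier M" "h (inv_into (carrier M) h (h x)) = h x"
      by (rule inv_into_into, rule f_inv_into_f)
    then show ?thesis using eq[OF _ x] Hom_closed[OF h(1) x] by simp
  qed
  have surj: "\<exists>x\<in>carrier M. y = h x" if "y \<in> carrier N" for y using that h(2) by blast
  have "?f \<in> Hom A N Y"
  proof (rule HomI)
    fix y assume "y \<in> carrier N"
    then obtain x where x: "x \<in> carrier M" "y = h x" using surj by blast
    show "?f y \<in> carrier Y" using f[OF x(1)] Hom_closed[OF z x(1)] x(2) by simp
    {
      fix y' assume "y' \<in> carrier N"
      then obtain x' where x': "x' \<in> carrier M" "y' = h x'" using surj by blast
      show "?f (y \<oplus>\<^bsub>N\<^esub> y') = ?f y \<oplus>\<^bsub>Y\<^esub> ?f y'"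
        unfolding x(2) x'(2) Hom_add[OF h(1) x(1) x'(1), symmetric]
        using f x(1) x'(1) by (simp only: M.a_closed Hom_add[OF z])
    }
    {
      fix a assume "a \<in> carrier A"
      then show "?f (a \<odot>\<^bsub>N\<^esub> y) = a \<odot>\<^bsub>Y\<^esub> ?f y"
        unfolding x(2) using f x(1) by (simp only: M.smult_closed Hom_smult[OF z] Hom_smult[OF h(1), symmetric])
    }
  qed simp
  then show ?thesis using f by blast
qed

text \<open>\<open>injective\<close> only promises extensions on one type. Finite generation
  provides an injection of \<open>M\<close> into that type; the copy of \<open>M\<close> and the
  image of \<open>N\<close> in it are used there, and the extension is composed with the copying
  map.\<close>

lemma injective_extend:
  fixes M :: "('k, 'm, 'e) module_scheme"
  assumes J: "injective k J" and fg: "fg_module k M" and N: "submodule N k M"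
    and f: "f \<in> Hom k (M\<lparr>carrier := N\<rparr>) J"
  shows "\<exists>h\<in>Hom k M J. \<forall>x\<in>N. h x = f x"
proof -
  have M: "right_module k M" using fg by (rule fg_moduleD)
  interpret M: right_module k M by fact
  have NM: "N \<subseteq> carrier M" using N by (simp add: M.submodule_iff)
  obtain i :: "'m \<Rightarrow> (nat \<Rightarrow> 'k) set" where i: "inj_on i (carrier M)" using fg_module_small[OF fg] by blast
  define C where "C = copy_module i M"
  define c where "c = (\<lambda>x\<in>carrier M. i x)"
  have C: "right_module k C" and c: "c \<in> module_iso k M C"
    unfolding C_def c_def using copy_module[OF M i] by blast+
  have cH: "c \<in> Hom k M C" and cbij: "bij_betw c (carrier M) (carrier C)" using c by (simp_all add: module_iso_def)
  define t where "t = (\<lambda>y\<in>carrier C. inv_into (carrier M) c y)"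
  have "t \<in> module_iso k C M" unfolding t_def by (rule module_iso_inv[OF M C c])
  then have tH: "t \<in> Hom k C M" by (simp add: module_iso_def)
  have tc: "t (c x) = x" if "x \<in> carrier M" for x
    using bij_betw_inv_into_left[OF cbij that] Hom_closed[OF cH that] by (simp add: t_def)
  have cN: "submodule (c ` N) k C" by (rule Hom_image_submodule[OF M C cH N])
  define S where "S = C\<lparr>carrier := c ` N\<rparr>"
  have S: "right_module k S" unfolding S_def by (rule submodule_right_module[OF C cN])
  have inc: "(\<lambda>x\<in>c ` N. x) \<in> Hom k S C" unfolding S_def by (rule Hom_inclusion[OF C cN])
  have "(\<lambda>y\<in>c ` N. t y) \<in> Hom k S M" unfolding S_def by (rule Hom_restrict[OF C cN tH])
  moreover have "(\<lambda>y\<in>c ` N. t y) ` carrier S \<subseteq> N" using tc NM by (auto simp: S_def)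
  ultimately have tN: "(\<lambda>y\<in>c ` N. t y) \<in> Hom k S (M\<lparr>carrier := N\<rparr>)" by (rule Hom_into_submodule)
  let ?f = "\<lambda>y\<in>carrier S. f ((\<lambda>y\<in>c ` N. t y) y)"
  have fH: "?f \<in> Hom k S J" by (rule Hom_comp[OF S tN f])
  have inj: "inj_on (\<lambda>x\<in>c ` N. x) (carrier S)" by (simp add: S_def inj_on_def)
  have "\<exists>h\<in>Hom k C J. \<forall>x\<in>carrier S. h ((\<lambda>x\<in>c ` N. x) x) = ?f x"
    using J[unfolded injective_def, THEN conjunct2, rule_format, OF conjI[OF S conjI[OF C conjI[OF inc conjI[OF inj fH]]]]] .
  then obtain h where h: "h \<in> Hom k C J" "\<And>x. x \<in> carrier S \<Longrightarrow> h ((\<lambda>x\<in>c ` N. x) x) = ?f x" by blast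
  have "(\<lambda>x\<in>carrier M. h (c x)) x = f x" if x: "x \<in> N" for x
  proof -
    have xM: "x \<in> carrier M" using x NM by blast
    show ?thesis using h(2)[of "c x"] x xM tc[OF xM] by (simp add: S_def)
  qed
  moreover have "(\<lambda>x\<in>carrier M. h (c x)) \<in> Hom k M J" by (rule Hom_comp[OF M cH h(1)])
  ultimately show ?thesis by blast
qed

lemma smult_map_Hom:
  assumes "right_module A M" "x \<in> carrier M"
  shows "(\<lambda>c\<in>carrier (regular_module A). c \<odot>\<^bsub>M\<^esub> x) \<in> Hom A (regular_module A) M"
proof -
  interpret M: right_module A M by fact
  show ?thesis
    using assms(2) by (intro restrict_HomI right_module_regular M.R.ring_axioms) (auto simp: M.smult_l_distr M.smult_assoc)
qed

locale matlis =
  fixes k :: "('k, 's) ring_scheme" and J :: "('k, 'j, 'f) module_scheme"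
  assumes cring: "cring k" and artinian: "artinian k"
    and J: "injective_envelope k (quotient_module (regular_module k) (jacobson_radical k)) J"
begin

sublocale k: cring k by (rule cring)

lemma injective: "injective k J" using J by (simp add: injective_envelope_def)

lemma right_module_J: "right_module k J" using injective by (simp add: injective_def)

sublocale J: right_module k J by (rule right_module_J)

text \<open>The part of \<open>J\<close> killed by \<open>m\<close> is a copy of the residue field
  at \<open>m\<close>: by essentiality it comes from \<open>k / rad k\<close>, where exactly one
  factor belongs to \<open>m\<close>. The argument replaces the Chinese remainder theorem by a
  scalar \<open>a\<close> outside \<open>m\<close> that lies in all other maximal ideals;
  \<open>j\<close> is its image.\<close>

lemma socle_cyclic:
  assumes m: "maximalideal m k"
  shows "\<exists>j\<in>carrier J. j \<noteq> \<zero>\<^bsub>J\<^esub> \<and> (\<forall>\<mu>\<in>m. \<mu> \<odot>\<^bsub>J\<^esub> j = \<zero>\<^bsub>J\<^esub>) \<and>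
    (\<forall>y\<in>carrier J. (\<forall>\<mu>\<in>m. \<mu> \<odot>\<^bsub>J\<^esub> y = \<zero>\<^bsub>J\<^esub>) \<longrightarrow> (\<exists>c\<in>carrier k. y = c \<odot>\<^bsub>J\<^esub> j))"
proof -
  let ?R = "regular_module k"
  interpret R: right_module k ?R by (rule k.regular_right_module)
  let ?rad = "jacobson_radical k"
  have max_sub: "submodule n k ?R" if "maximalideal n k" for n by (rule k.maximalideal_submodule[OF that])
  have rad: "submodule ?rad k ?R"
    using max_sub unfolding k.regular_submodule_iff jacobson_radical_def by auto
  let ?S = "quotient_module ?R ?rad"
  obtain i where i: "i \<in> Hom k ?S J" "inj_on i (carrier ?S)"
    and ess: "\<And>N. submodule N k J \<Longrightarrow> N \<inter> i ` carrier ?S = {\<zero>\<^bsub>J\<^esub>} \<Longrightarrow> N = {\<zero>\<^bsub>J\<^esub>}"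
    using J unfolding injective_envelope_def by blast
  have S: "right_module k ?S" by (rule R.right_module_quotient[OF rad])
  let ?p = "\<lambda>x\<in>carrier ?R. ?rad +>\<^bsub>?R\<^esub> x"
  have p: "?p \<in> Hom k ?R ?S" by (rule R.quotient_Hom[OF rad])
  define q where "q = (\<lambda>x\<in>carrier ?R. i (?p x))"
  have q: "q \<in> Hom k ?R J" unfolding q_def by (rule Hom_comp[OF R.right_module_axioms p i(1)])
  have q_zero: "q a = \<zero>\<^bsub>J\<^esub> \<longleftrightarrow> a \<in> ?rad" if a: "a \<in> carrier k" for a
  proof -
    have aR: "a \<in> carrier ?R" using a by simp
    have "i s = \<zero>\<^bsub>J\<^esub> \<longleftrightarrow> s = \<zero>\<^bsub>?S\<^esub>" if "s \<in> carrier ?S" for s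
      using Hom_inj_on_iff[OF S right_module_J i(1), THEN iffD1, OF i(2), rule_format, OF that]
        Hom_zero[OF S right_module_J i(1)] by (intro iffI) simp_all
    from this[OF Hom_closed[OF p aR]] show ?thesis using R.quotient_zero_iff[OF rad aR] a by (simp add: q_def)
  qed
  have q_range: "i ` carrier ?S = q ` carrier k"
    unfolding R.quotient_simps(1)[OF rad] by (auto simp: q_def image_iff)
  have q_closed: "a \<in> carrier k \<Longrightarrow> q a \<in> carrier J" for a using Hom_closed[OF q] by simp
  have q_mult: "a \<in> carrier k \<Longrightarrow> c \<in> carrier k \<Longrightarrow> q (a \<otimes>\<^bsub>k\<^esub> c) = c \<odot>\<^bsub>J\<^esub> q a" for a c
    using Hom_smult[OF q, of c a] by simp
  have q_add: "a \<in> carrier k \<Longrightarrow> c \<in> carrier k \<Longrightarrow> q (a \<oplus>\<^bsub>k\<^esub> c) = q a \<oplus>\<^bsub>J\<^esub> q c" for a c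
    using Hom_add[OF q, of a c] by simp
  have mk: "\<mu> \<in> carrier k" if "\<mu> \<in> m" for \<mu> using that max_sub[OF m] unfolding k.regular_submodule_iff by blast
  \<comment> \<open>A minimal ideal \<open>I\<close> not inside \<open>m\<close> lies in every other
    maximal \<open>n\<close>: as \<open>m\<close> is prime, the product of \<open>a\<close> in
    \<open>I\<close> and \<open>b\<close> in \<open>n\<close>, both outside \<open>m\<close>, is
    outside \<open>m\<close>, so \<open>I \<inter> n\<close> is again not inside \<open>m\<close>
    and equals \<open>I\<close>.\<close>
  define P where "P I \<longleftrightarrow> submodule I k ?R \<and> \<not> I \<subseteq> m" for I
  have "P (carrier k)" unfolding P_def using R.carrier_submodule k.maximalideal_one[OF m] by auto
  moreover have "\<And>I. P I \<Longrightarrow> submodule I k ?R" by (simp add: P_def)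
  ultimately obtain I where I: "P I" and min: "\<forall>I'. P I' \<longrightarrow> \<not> I' \<subset> I"
    using k.artinian_minimal[OF artinian, of P] by blast
  then obtain a where a: "a \<in> I" "a \<notin> m" unfolding P_def by blast
  have sI: "submodule I k ?R" using I by (simp add: P_def)
  have ak: "a \<in> carrier k" using a(1) sI unfolding k.regular_submodule_iff by blast
  have other: "a \<in> n" if n: "maximalideal n k" "n \<noteq> m" for n
  proof -
    have nm: "\<not> n \<subseteq> m"
      using maximalideal.I_maximal[OF n(1)] m n(2) maximalideal.I_notcarr[OF m]
      unfolding maximalideal_def ideal_def additive_subgroup_def subgroup_def by auto
    then obtain b where b: "b \<in> n" "b \<notin> m" by blast
    have bk: "b \<in> carrier k" using b(1) max_sub[OF n(1)] unfolding k.regular_submodule_iff by blast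
    have "a \<otimes>\<^bsub>k\<^esub> b \<notin> m"
      using primeideal.I_prime[OF k.maximalideal_prime[OF m] ak bk] a(2) b(2) by blast
    moreover have "a \<otimes>\<^bsub>k\<^esub> b \<in> I" using a(1) bk sI unfolding k.regular_submodule_iff by blast
    moreover have "b \<otimes>\<^bsub>k\<^esub> a \<in> n" using b(1) ak max_sub[OF n(1)] unfolding k.regular_submodule_iff by blast
    then have "a \<otimes>\<^bsub>k\<^esub> b \<in> n" using k.m_comm[OF ak bk] by simp
    ultimately have "\<not> I \<inter> n \<subseteq> m" by blast
    moreover have "submodule (I \<inter> n) k ?R" by (rule R.submodule_Int[OF sI max_sub[OF n(1)]])
    ultimately have "P (I \<inter> n)" by (simp add: P_def)
    then have "I \<inter> n = I" using min by blast
    then show ?thesis using a(1) by blast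
  qed
  have a_rad: "a \<otimes>\<^bsub>k\<^esub> \<mu> \<in> ?rad" if mu: "\<mu> \<in> m" for \<mu>
  proof -
    have "a \<otimes>\<^bsub>k\<^esub> \<mu> \<in> n" if n: "maximalideal n k" for n
    proof (cases "n = m")
      case True
      have "\<mu> \<otimes>\<^bsub>k\<^esub> a \<in> m" using mu ak max_sub[OF m] unfolding k.regular_submodule_iff by blast
      then show ?thesis using True k.m_comm[OF ak mk[OF mu]] by simp
    next
      case False
      then show ?thesis using other[OF n False] mk[OF mu] max_sub[OF n] unfolding k.regular_submodule_iff by blast
    qed
    then show ?thesis using ak mk[OF mu] by (simp add: jacobson_radical_def)
  qed
  have "a \<notin> ?rad" using a(2) m by (auto simp: jacobson_radical_def)
  then have nz: "q a \<noteq> \<zero>\<^bsub>J\<^esub>" using q_zero[OF ak] by simp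
  have ann: "\<mu> \<odot>\<^bsub>J\<^esub> q a = \<zero>\<^bsub>J\<^esub>" if mu: "\<mu> \<in> m" for \<mu>
    using q_mult[OF ak mk[OF mu]] q_zero[of "a \<otimes>\<^bsub>k\<^esub> \<mu>"] a_rad[OF mu] ak mk[OF mu] by simp
  have gen: "\<exists>c\<in>carrier k. y = c \<odot>\<^bsub>J\<^esub> q a"
    if y: "y \<in> carrier J" and my: "\<And>\<mu>. \<mu> \<in> m \<Longrightarrow> \<mu> \<odot>\<^bsub>J\<^esub> y = \<zero>\<^bsub>J\<^esub>" for y
  proof (cases "y = \<zero>\<^bsub>J\<^esub>")
    case True
    then show ?thesis using q_closed[OF ak] by (intro bexI[of _ "\<zero>\<^bsub>k\<^esub>"]) simp_all
  next
    case False
    \<comment> \<open>By essentiality some nonzero multiple of \<open>y\<close>, by \<open>c\<close>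
      say, lies in the image of \<open>q\<close>. Since \<open>m\<close> kills \<open>y\<close>, the
      scalar \<open>c\<close> is outside \<open>m\<close> and can be inverted modulo
      \<open>m\<close>, so \<open>y\<close> itself is in the image of \<open>q\<close>.\<close>
    have "J.cyclic y \<inter> i ` carrier ?S \<noteq> {\<zero>\<^bsub>J\<^esub>}"
      using ess[OF J.submodule_cyclic[OF y]] J.mem_cyclic[OF y] False by blast
    moreover have "\<zero>\<^bsub>J\<^esub> \<in> J.cyclic y" using J.submodule_cyclic[OF y] by (simp add: J.submodule_iff)
    moreover have "\<zero>\<^bsub>J\<^esub> \<in> i ` carrier ?S"
      unfolding q_range using q_zero[OF k.zero_closed] rad
      by (metis image_eqI k.zero_closed k.regular_submodule_iff)
    ultimately obtain w where w: "w \<in> J.cyclic y" "w \<in> i ` carrier ?S" "w \<noteq> \<zero>\<^bsub>J\<^esub>" by blast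
    obtain c where c: "c \<in> carrier k" "w = c \<odot>\<^bsub>J\<^esub> y" using w(1) unfolding J.cyclic_def by blast
    obtain b where b: "b \<in> carrier k" "w = q b" using w(2) unfolding q_range by blast
    have "c \<notin> m" using my w(3) c(2) by blast
    then obtain d \<mu> where d: "d \<in> carrier k" "\<mu> \<in> m" "\<one>\<^bsub>k\<^esub> = \<mu> \<oplus>\<^bsub>k\<^esub> c \<otimes>\<^bsub>k\<^esub> d"
      using k.maximalideal_inverse[OF m c(1)] by blast
    have "y = (\<mu> \<oplus>\<^bsub>k\<^esub> c \<otimes>\<^bsub>k\<^esub> d) \<odot>\<^bsub>J\<^esub> y" using y by (simp flip: d(3))
    also have "\<dots> = d \<odot>\<^bsub>J\<^esub> w"
      using y my[OF d(2)] mk[OF d(2)] c d(1) by (simp add: J.smult_l_distr J.smult_assoc)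
    finally have yq: "y = q (b \<otimes>\<^bsub>k\<^esub> d)" using q_mult[OF b(1) d(1)] b(2) by simp
    let ?b = "b \<otimes>\<^bsub>k\<^esub> d"
    have bk: "?b \<in> carrier k" using b(1) d(1) by simp
    obtain d' \<mu>' where d': "d' \<in> carrier k" "\<mu>' \<in> m" "\<one>\<^bsub>k\<^esub> = \<mu>' \<oplus>\<^bsub>k\<^esub> a \<otimes>\<^bsub>k\<^esub> d'"
      using k.maximalideal_inverse[OF m ak a(2)] by blast
    \<comment> \<open>Modulo \<open>m\<close> the scalar \<open>?b\<close> is a multiple of
      \<open>a\<close>; the remainder contributes \<open>\<mu>'\<close> acting on \<open>y\<close>,
      which is zero.\<close>
    have "?b = ?b \<otimes>\<^bsub>k\<^esub> (\<mu>' \<oplus>\<^bsub>k\<^esub> a \<otimes>\<^bsub>k\<^esub> d')" using bk by (simp flip: d'(3))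
    also have "\<dots> = ?b \<otimes>\<^bsub>k\<^esub> \<mu>' \<oplus>\<^bsub>k\<^esub> a \<otimes>\<^bsub>k\<^esub> (?b \<otimes>\<^bsub>k\<^esub> d')"
      using b(1) d(1) mk[OF d'(2)] ak d'(1) by (simp add: k.r_distr k.m_ac)
    finally have "q ?b = q (?b \<otimes>\<^bsub>k\<^esub> \<mu>' \<oplus>\<^bsub>k\<^esub> a \<otimes>\<^bsub>k\<^esub> (?b \<otimes>\<^bsub>k\<^esub> d'))" by (rule arg_cong)
    also have "\<dots> = q (?b \<otimes>\<^bsub>k\<^esub> \<mu>') \<oplus>\<^bsub>J\<^esub> q (a \<otimes>\<^bsub>k\<^esub> (?b \<otimes>\<^bsub>k\<^esub> d'))"
      using bk mk[OF d'(2)] ak d'(1) by (intro q_add) simp_all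
    also have "q (?b \<otimes>\<^bsub>k\<^esub> \<mu>') = \<zero>\<^bsub>J\<^esub>"
      using q_mult[OF bk mk[OF d'(2)]] my[OF d'(2)] yq by simp
    also have "q (a \<otimes>\<^bsub>k\<^esub> (?b \<otimes>\<^bsub>k\<^esub> d')) = (?b \<otimes>\<^bsub>k\<^esub> d') \<odot>\<^bsub>J\<^esub> q a"
      using bk d'(1) by (intro q_mult ak) simp
    finally have "q ?b = (?b \<otimes>\<^bsub>k\<^esub> d') \<odot>\<^bsub>J\<^esub> q a" using bk d'(1) q_closed[OF ak] by simp
    then show ?thesis using yq bk d'(1) by (intro bexI[of _ "?b \<otimes>\<^bsub>k\<^esub> d'"]) simp_all
  qed
  show ?thesis using nz ann gen q_closed[OF ak] by (intro bexI[of _ "q a"]) simp_all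
qed

text \<open>The annihilator of \<open>x\<close> lies in a maximal ideal \<open>m\<close>, so the
  cyclic module of \<open>x\<close> maps to \<open>J\<close> with \<open>x\<close> going to a
  nonzero element killed by \<open>m\<close>; injectivity of \<open>J\<close> extends this map to
  \<open>M\<close>.\<close>

lemma separating:
  assumes fg: "fg_module k M" and x: "x \<in> carrier M" "x \<noteq> \<zero>\<^bsub>M\<^esub>"
  shows "\<exists>h\<in>Hom k M J. h x \<noteq> \<zero>\<^bsub>J\<^esub>"
proof -
  have M: "right_module k M" using fg by (rule fg_moduleD)
  interpret M: right_module k M by fact
  let ?R = "regular_module k"
  have R: "right_module k ?R" by (rule k.regular_right_module)
  let ?s = "\<lambda>c\<in>carrier ?R. c \<odot>\<^bsub>M\<^esub> x"
  have s: "?s \<in> Hom k ?R M" by (rule smult_map_Hom[OF M x(1)])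
  have ann: "submodule (a_kernel ?R M ?s) k ?R" by (rule Hom_kernel_submodule[OF R M s])
  have "\<one>\<^bsub>k\<^esub> \<notin> a_kernel ?R M ?s" using x by (simp add: a_kernel_eq)
  then obtain m where m: "maximalideal m k" "a_kernel ?R M ?s \<subseteq> m"
    using k.maximalideal_exists[OF ann] by blast
  obtain j where j: "j \<in> carrier J" "j \<noteq> \<zero>\<^bsub>J\<^esub>" "\<forall>\<mu>\<in>m. \<mu> \<odot>\<^bsub>J\<^esub> j = \<zero>\<^bsub>J\<^esub>"
    using socle_cyclic[OF m(1)] by blast
  let ?C = "M\<lparr>carrier := M.cyclic x\<rparr>"
  have C: "submodule (M.cyclic x) k M" by (rule M.submodule_cyclic[OF x(1)])
  have CM: "right_module k ?C" by (rule submodule_right_module[OF M C])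
  have simg: "?s ` carrier ?R = M.cyclic x" by (simp add: M.cyclic_def)
  then have sC: "?s \<in> Hom k ?R ?C" by (intro Hom_into_submodule[OF s]) simp
  let ?z = "\<lambda>c\<in>carrier ?R. c \<odot>\<^bsub>J\<^esub> j"
  have z: "?z \<in> Hom k ?R J" by (rule smult_map_Hom[OF right_module_J j(1)])
  have "\<exists>f\<in>Hom k ?C J. \<forall>c\<in>carrier ?R. f (?s c) = ?z c"
  proof (rule factor_through_surj[OF R CM right_module_J sC _ z])
    show "?s ` carrier ?R = carrier ?C" using simg by simp
    fix c assume c: "c \<in> carrier ?R" "?s c = \<zero>\<^bsub>?C\<^esub>"
    then have "c \<in> m" using m(2) by (auto simp: a_kernel_eq)
    then show "?z c = \<zero>\<^bsub>J\<^esub>" using j(3) c(1) by simp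
  qed
  then obtain f where f: "f \<in> Hom k ?C J" "\<forall>c\<in>carrier ?R. f (?s c) = ?z c" by blast
  obtain h where h: "h \<in> Hom k M J" "\<forall>x\<in>M.cyclic x. h x = f x"
    using injective_extend[OF injective fg C f(1)] by blast
  have "h x = f x" using h(2) M.mem_cyclic[OF x(1)] by blast
  also have "\<dots> = j" using f(2)[rule_format, of "\<one>\<^bsub>k\<^esub>"] x(1) j(1) by simp
  finally show ?thesis using h(1) j(2) by blast
qed

text \<open>These are the \<open>k\<close>-linear maps from \<open>Hom\<^sub>k(M, J)\<close> to
  \<open>J\<close>, with scalars acting through the argument as in \<open>standard_dual\<close>.
  Values outside \<open>Hom k M J\<close> are left open, so that any formula can serve as
  \<open>F\<close>.\<close>

definition functional :: "('k, 'm, 'e) module_scheme \<Rightarrow> (('m \<Rightarrow> 'j) \<Rightarrow> 'j) \<Rightarrow> bool" where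
  "functional M F \<longleftrightarrow> (\<forall>h\<in>Hom k M J. F h \<in> carrier J) \<and>
    (\<forall>h\<in>Hom k M J. \<forall>h'\<in>Hom k M J. F (\<lambda>x\<in>carrier M. h x \<oplus>\<^bsub>J\<^esub> h' x) = F h \<oplus>\<^bsub>J\<^esub> F h') \<and>
    (\<forall>c\<in>carrier k. \<forall>h\<in>Hom k M J. F (\<lambda>x\<in>carrier M. h (c \<odot>\<^bsub>M\<^esub> x)) = c \<odot>\<^bsub>J\<^esub> F h)"

lemma functionalD:
  assumes "functional M F"
  shows "h \<in> Hom k M J \<Longrightarrow> F h \<in> carrier J"
    "h \<in> Hom k M J \<Longrightarrow> h' \<in> Hom k M J \<Longrightarrow> F (\<lambda>x\<in>carrier M. h x \<oplus>\<^bsub>J\<^esub> h' x) = F h \<oplus>\<^bsub>J\<^esub> F h'"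
    "c \<in> carrier k \<Longrightarrow> h \<in> Hom k M J \<Longrightarrow> F (\<lambda>x\<in>carrier M. h (c \<odot>\<^bsub>M\<^esub> x)) = c \<odot>\<^bsub>J\<^esub> F h"
  using assms by (simp_all add: functional_def)

lemma functional_zero:
  assumes M: "right_module k M" and F: "functional M F"
  shows "F (\<lambda>x\<in>carrier M. \<zero>\<^bsub>J\<^esub>) = \<zero>\<^bsub>J\<^esub>"
proof -
  let ?z = "\<lambda>x\<in>carrier M. \<zero>\<^bsub>J\<^esub>"
  have z: "?z \<in> Hom k M J" by (rule Hom_null[OF M right_module_J])
  have "(\<lambda>x\<in>carrier M. ?z x \<oplus>\<^bsub>J\<^esub> ?z x) = ?z" by (intro restrict_ext) simp
  then have "F ?z = F ?z \<oplus>\<^bsub>J\<^esub> F ?z" using functionalD(2)[OF F z z] by (simp only:)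
  then show ?thesis using functionalD(1)[OF F z] by (metis J.M.add.r_cancel_one')
qed

lemma Hom_scale:
  assumes M: "right_module k M" and c: "c \<in> carrier k" and h: "h \<in> Hom k M J"
  shows "(\<lambda>x\<in>carrier M. h (c \<odot>\<^bsub>M\<^esub> x)) \<in> Hom k M J"
proof -
  interpret M: right_module k M by fact
  show ?thesis
  proof (rule restrict_HomI[OF M])
    fix d x assume d: "d \<in> carrier k" and x: "x \<in> carrier M"
    have "c \<odot>\<^bsub>M\<^esub> (d \<odot>\<^bsub>M\<^esub> x) = d \<odot>\<^bsub>M\<^esub> (c \<odot>\<^bsub>M\<^esub> x)"
      using x c d k.m_comm[OF c d] by (simp flip: M.smult_assoc)
    then show "h (c \<odot>\<^bsub>M\<^esub> (d \<odot>\<^bsub>M\<^esub> x)) = d \<odot>\<^bsub>J\<^esub> h (c \<odot>\<^bsub>M\<^esub> x)"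
      using x c d by (simp add: Hom_smult[OF h])
  qed (use c Hom_closed[OF h] in \<open>auto simp: M.smult_r_distr Hom_add[OF h]\<close>)
qed

text \<open>Only surjectivity of the map from \<open>M\<close> to its double \<open>J\<close>-dual;
  injectivity is the content of \<open>separating\<close>.\<close>

definition bireflexive :: "('k, 'm, 'e) module_scheme \<Rightarrow> bool" where
  "bireflexive M \<longleftrightarrow> (\<forall>F. functional M F \<longrightarrow> (\<exists>x\<in>carrier M. \<forall>h\<in>Hom k M J. F h = h x))"

text \<open>Let \<open>M / N\<close> be simple. The values at \<open>x\<close> of the maps that vanish on \<open>N\<close> lie in the cyclic
  module \<open>{y. m y = 0}\<close>, where \<open>F\<close> acts as a scalar \<open>c\<close>. Subtracting evaluation at \<open>x c\<close> leaves a
  functional that depends only on restrictions to \<open>N\<close>.\<close>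

lemma bireflexive_extension:
  assumes fg: "fg_module k M" and N: "submodule N k M" and bN: "bireflexive (M\<lparr>carrier := N\<rparr>)"
    and m: "maximalideal m k" and x: "x \<in> carrier M" and mx: "\<And>\<mu>. \<mu> \<in> m \<Longrightarrow> \<mu> \<odot>\<^bsub>M\<^esub> x \<in> N"
    and gen: "N <+>\<^bsub>M\<^esub> right_module.cyclic k M x = carrier M"
  shows "bireflexive M"
  unfolding bireflexive_def
proof (intro allI impI)
  fix F assume F: "functional M F"
  have M: "right_module k M" using fg by (rule fg_moduleD)
  interpret M: right_module k M by fact
  let ?N = "M\<lparr>carrier := N\<rparr>"
  have NM: "N \<subseteq> carrier M" using N by (simp add: M.submodule_iff)
  have mk: "\<mu> \<in> carrier k" if "\<mu> \<in> m" for \<mu>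
    using that k.maximalideal_submodule[OF m] unfolding k.regular_submodule_iff by blast
  have det: "h = h'" if h: "h \<in> Hom k M J" "h' \<in> Hom k M J" "\<And>y. y \<in> N \<Longrightarrow> h y = h' y" "h x = h' x" for h h'
  proof (rule Hom_ext[OF h(1,2)])
    fix y assume "y \<in> carrier M"
    then obtain n c where nc: "n \<in> N" "c \<in> carrier k" "y = n \<oplus>\<^bsub>M\<^esub> c \<odot>\<^bsub>M\<^esub> x"
      unfolding gen[symmetric] M.mem_set_add M.cyclic_def by blast
    then have "n \<in> carrier M" "c \<odot>\<^bsub>M\<^esub> x \<in> carrier M" using NM x by auto
    then show "h y = h' y"
      using nc x h(3)[OF nc(1)] h(4) by (simp add: Hom_add[OF h(1)] Hom_add[OF h(2)] Hom_smult[OF h(1)] Hom_smult[OF h(2)])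
  qed
  have soc: "\<mu> \<odot>\<^bsub>J\<^esub> h x = \<zero>\<^bsub>J\<^esub>" if h: "h \<in> Hom k M J" "\<And>y. y \<in> N \<Longrightarrow> h y = \<zero>\<^bsub>J\<^esub>" and mu: "\<mu> \<in> m" for h \<mu>
    using h(2)[OF mx[OF mu]] Hom_smult[OF h(1) mk[OF mu] x] by simp
  obtain j where j: "j \<in> carrier J" and jm: "\<forall>\<mu>\<in>m. \<mu> \<odot>\<^bsub>J\<^esub> j = \<zero>\<^bsub>J\<^esub>"
    and jg: "\<forall>y\<in>carrier J. (\<forall>\<mu>\<in>m. \<mu> \<odot>\<^bsub>J\<^esub> y = \<zero>\<^bsub>J\<^esub>) \<longrightarrow> (\<exists>c\<in>carrier k. y = c \<odot>\<^bsub>J\<^esub> j)"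
    using socle_cyclic[OF m] by (elim bexE conjE)
  have "\<exists>x0\<in>carrier M. \<forall>h\<in>Hom k M J. (\<forall>y\<in>N. h y = \<zero>\<^bsub>J\<^esub>) \<longrightarrow> F h = h x0"
  proof (cases "\<exists>h1\<in>Hom k M J. (\<forall>y\<in>N. h1 y = \<zero>\<^bsub>J\<^esub>) \<and> h1 x \<noteq> \<zero>\<^bsub>J\<^esub>")
    case False
    have zz: "F h = h \<zero>\<^bsub>M\<^esub>" if h: "h \<in> Hom k M J" "\<forall>y\<in>N. h y = \<zero>\<^bsub>J\<^esub>" for h
    proof -
      have hx: "h x = \<zero>\<^bsub>J\<^esub>" using False h by blast
      have "h = (\<lambda>x\<in>carrier M. \<zero>\<^bsub>J\<^esub>)"
        by (rule det[OF h(1) Hom_null[OF M right_module_J]]) (use hx h(2) NM x in auto)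
      then show ?thesis using functional_zero[OF M F] Hom_zero[OF M right_module_J h(1)] by simp
    qed
    show ?thesis by (rule bexI[of _ "\<zero>\<^bsub>M\<^esub>"]) (use zz in auto)
  next
    case True
    then obtain h1 where h1: "h1 \<in> Hom k M J" "\<And>y. y \<in> N \<Longrightarrow> h1 y = \<zero>\<^bsub>J\<^esub>" "h1 x \<noteq> \<zero>\<^bsub>J\<^esub>" by blast
    have h1x: "h1 x \<in> carrier J" by (rule Hom_closed[OF h1(1) x])
    obtain c1 where c1: "c1 \<in> carrier k" "h1 x = c1 \<odot>\<^bsub>J\<^esub> j"
      using jg[rule_format, OF h1x soc[OF h1(1,2)]] by blast
    \<comment> \<open>As a nonzero multiple of the generator \<open>j\<close>, the value
      \<open>h1 x\<close> generates the same module, because \<open>c1\<close> is invertible modulo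
      \<open>m\<close>.\<close>
    have "c1 \<notin> m" using jm c1(2) h1(3) by metis
    then obtain d \<mu> where d: "d \<in> carrier k" "\<mu> \<in> m" "\<one>\<^bsub>k\<^esub> = \<mu> \<oplus>\<^bsub>k\<^esub> c1 \<otimes>\<^bsub>k\<^esub> d"
      using k.maximalideal_inverse[OF m c1(1)] by blast
    have "j = (\<mu> \<oplus>\<^bsub>k\<^esub> c1 \<otimes>\<^bsub>k\<^esub> d) \<odot>\<^bsub>J\<^esub> j" using j by (simp flip: d(3))
    also have "\<dots> = d \<odot>\<^bsub>J\<^esub> h1 x"
      using j jm[rule_format, OF d(2)] mk[OF d(2)] c1 d(1) by (simp add: J.smult_l_distr J.smult_assoc)
    finally have jd: "j = d \<odot>\<^bsub>J\<^esub> h1 x" .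
    have gen1: "\<exists>c\<in>carrier k. y = c \<odot>\<^bsub>J\<^esub> h1 x" if y: "y \<in> carrier J" "\<And>\<mu>. \<mu> \<in> m \<Longrightarrow> \<mu> \<odot>\<^bsub>J\<^esub> y = \<zero>\<^bsub>J\<^esub>" for y
    proof -
      obtain c where c: "c \<in> carrier k" "y = c \<odot>\<^bsub>J\<^esub> j" using jg[rule_format, OF y] by blast
      then have "y = (d \<otimes>\<^bsub>k\<^esub> c) \<odot>\<^bsub>J\<^esub> h1 x" using jd d(1) h1x by (simp add: J.smult_assoc)
      then show ?thesis using c(1) d(1) by blast
    qed
    have Fh1: "F h1 \<in> carrier J" by (rule functionalD(1)[OF F h1(1)])
    \<comment> \<open>The multiple of \<open>h1\<close> by \<open>\<mu>\<close> vanishes on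
      \<open>N\<close> and at \<open>x\<close>, so it is the zero map and \<open>F\<close> sends it
      to zero. Hence \<open>F h1\<close> is a multiple of \<open>h1 x\<close>, and the factor
      \<open>c0\<close> determines \<open>F\<close> on all maps that vanish on
      \<open>N\<close>.\<close>
    have "\<mu> \<odot>\<^bsub>J\<^esub> F h1 = \<zero>\<^bsub>J\<^esub>" if mu: "\<mu> \<in> m" for \<mu>
    proof -
      have "(\<lambda>x\<in>carrier M. h1 (\<mu> \<odot>\<^bsub>M\<^esub> x)) = (\<lambda>x\<in>carrier M. \<zero>\<^bsub>J\<^esub>)"
      proof (rule det[OF Hom_scale[OF M mk[OF mu] h1(1)] Hom_null[OF M right_module_J]])
        fix y assume y: "y \<in> N"
        then have "y \<in> carrier M" "\<mu> \<odot>\<^bsub>M\<^esub> y \<in> N" using NM N mk[OF mu] by (auto simp: M.submodule_iff)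
        then show "(\<lambda>x\<in>carrier M. h1 (\<mu> \<odot>\<^bsub>M\<^esub> x)) y = (\<lambda>x\<in>carrier M. \<zero>\<^bsub>J\<^esub>) y" using h1(2) by simp
      next
        show "(\<lambda>x\<in>carrier M. h1 (\<mu> \<odot>\<^bsub>M\<^esub> x)) x = (\<lambda>x\<in>carrier M. \<zero>\<^bsub>J\<^esub>) x" using x h1(2)[OF mx[OF mu]] by simp
      qed
      then show ?thesis using functionalD(3)[OF F mk[OF mu] h1(1)] functional_zero[OF M F] by simp
    qed
    then obtain c0 where c0: "c0 \<in> carrier k" "F h1 = c0 \<odot>\<^bsub>J\<^esub> h1 x" using gen1[OF Fh1] by blast
    have "F h = h (c0 \<odot>\<^bsub>M\<^esub> x)" if h: "h \<in> Hom k M J" "\<forall>y\<in>N. h y = \<zero>\<^bsub>J\<^esub>" for h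
    proof -
      obtain c where c: "c \<in> carrier k" "h x = c \<odot>\<^bsub>J\<^esub> h1 x"
        using gen1[OF Hom_closed[OF h(1) x]] soc[OF h(1)] h(2) by blast
      have "h = (\<lambda>x\<in>carrier M. h1 (c \<odot>\<^bsub>M\<^esub> x))"
      proof (rule det[OF h(1) Hom_scale[OF M c(1) h1(1)]])
        fix y assume y: "y \<in> N"
        then have "y \<in> carrier M" "c \<odot>\<^bsub>M\<^esub> y \<in> N" using NM N c(1) by (auto simp: M.submodule_iff)
        then show "h y = (\<lambda>x\<in>carrier M. h1 (c \<odot>\<^bsub>M\<^esub> x)) y" using h1(2) h(2) y by simp
      next
        show "h x = (\<lambda>x\<in>carrier M. h1 (c \<odot>\<^bsub>M\<^esub> x)) x" using x c Hom_smult[OF h1(1) c(1) x] by simp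
      qed
      then have "F h = c \<odot>\<^bsub>J\<^esub> (c0 \<odot>\<^bsub>J\<^esub> h1 x)" using functionalD(3)[OF F c(1) h1(1)] c0(2) by simp
      also have "\<dots> = c0 \<odot>\<^bsub>J\<^esub> (c \<odot>\<^bsub>J\<^esub> h1 x)"
        using h1x c(1) c0(1) k.m_comm[OF c(1) c0(1)] by (simp flip: J.smult_assoc)
      also have "\<dots> = h (c0 \<odot>\<^bsub>M\<^esub> x)" using Hom_smult[OF h(1) c0(1) x] c(2) by simp
      finally show ?thesis .
    qed
    then show ?thesis using c0(1) x by (intro bexI[of _ "c0 \<odot>\<^bsub>M\<^esub> x"]) auto
  qed
  then obtain x0 where x0: "x0 \<in> carrier M" "\<And>h. h \<in> Hom k M J \<Longrightarrow> (\<And>y. y \<in> N \<Longrightarrow> h y = \<zero>\<^bsub>J\<^esub>) \<Longrightarrow> F h = h x0" by blast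
  define F2 where "F2 h = F h \<ominus>\<^bsub>J\<^esub> h x0" for h
  have cl: "F h \<in> carrier J" "h x0 \<in> carrier J" if "h \<in> Hom k M J" for h
    using functionalD(1)[OF F that] Hom_closed[OF that x0(1)] by auto
  have F2_closed: "F2 h \<in> carrier J" if "h \<in> Hom k M J" for h using cl that by (simp add: F2_def)
  have F2_add: "F2 (\<lambda>x\<in>carrier M. h x \<oplus>\<^bsub>J\<^esub> h' x) = F2 h \<oplus>\<^bsub>J\<^esub> F2 h'" if h: "h \<in> Hom k M J" "h' \<in> Hom k M J" for h h'
    using functionalD(2)[OF F h] x0(1) cl[OF h(1)] cl[OF h(2)]
    by (simp add: F2_def a_minus_def J.M.minus_add J.M.a_ac)
  have F2_scale: "F2 (\<lambda>x\<in>carrier M. h (c \<odot>\<^bsub>M\<^esub> x)) = c \<odot>\<^bsub>J\<^esub> F2 h" if h: "h \<in> Hom k M J" "c \<in> carrier k" for h c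
    using functionalD(3)[OF F h(2,1)] x0(1) cl[OF h(1)] h(2)
    by (simp add: F2_def a_minus_def J.smult_r_distr J.smult_r_minus Hom_smult[OF h(1)])
  have F2_cong: "F2 h = F2 h'" if h: "h \<in> Hom k M J" "h' \<in> Hom k M J" "\<And>y. y \<in> N \<Longrightarrow> h y = h' y" for h h'
  proof -
    let ?d = "\<lambda>x\<in>carrier M. h x \<ominus>\<^bsub>J\<^esub> h' x"
    have d: "?d \<in> Hom k M J" by (rule Hom_sub[OF M right_module_J h(1,2)])
    have "?d y = \<zero>\<^bsub>J\<^esub>" if "y \<in> N" for y
      using that NM h(3)[OF that] J.minus_eq_zero_iff Hom_closed[OF h(2), of y] by auto
    then have "F ?d = ?d x0" by (rule x0(2)[OF d])
    moreover have "?d x0 \<in> carrier J" using cl d by blast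
    ultimately have Fd: "F2 ?d = \<zero>\<^bsub>J\<^esub>" by (simp only: F2_def J.minus_eq_zero_iff)
    have "h = (\<lambda>x\<in>carrier M. h' x \<oplus>\<^bsub>J\<^esub> ?d x)"
    proof (rule Hom_ext[OF h(1) Hom_plus[OF M right_module_J h(2) d]])
      fix y assume y: "y \<in> carrier M"
      then show "h y = (\<lambda>x\<in>carrier M. h' x \<oplus>\<^bsub>J\<^esub> ?d x) y"
        using Hom_closed[OF h(1) y] Hom_closed[OF h(2) y] J.M.a_lcomm[of "h' y" "h y" "\<ominus>\<^bsub>J\<^esub> h' y"]
          by (simp add: a_minus_def J.M.r_neg)
    qed
    then have "F2 h = F2 h' \<oplus>\<^bsub>J\<^esub> F2 ?d" using F2_add[OF h(2) d] by (simp only:)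
    then show ?thesis using Fd F2_closed[OF h(2)] by simp
  qed
  have N': "right_module k ?N" by (rule submodule_right_module[OF M N])
  \<comment> \<open>The chosen extensions need not be additive in \<open>f\<close>; by
    \<open>F2_cong\<close> the choice does not affect the value of \<open>F2\<close>.\<close>
  define E where "E f = (SOME h. h \<in> Hom k M J \<and> (\<forall>y\<in>N. h y = f y))" for f
  have E: "E f \<in> Hom k M J" "y \<in> N \<Longrightarrow> E f y = f y" if f: "f \<in> Hom k ?N J" for f y
  proof -
    have "\<exists>h. h \<in> Hom k M J \<and> (\<forall>y\<in>N. h y = f y)" using injective_extend[OF injective fg N f] by blast
    then have "E f \<in> Hom k M J \<and> (\<forall>y\<in>N. E f y = f y)" unfolding E_def by (rule someI_ex)
    then show "E f \<in> Hom k M J" "y \<in> N \<Longrightarrow> E f y = f y" by blast+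
  qed
  have "functional ?N (\<lambda>f. F2 (E f))"
    unfolding functional_def
  proof (intro conjI ballI)
    fix f assume f: "f \<in> Hom k ?N J"
    show "F2 (E f) \<in> carrier J" by (rule F2_closed[OF E(1)[OF f]])
    {
      fix f' assume f': "f' \<in> Hom k ?N J"
      have "F2 (E (\<lambda>x\<in>carrier ?N. f x \<oplus>\<^bsub>J\<^esub> f' x)) = F2 (\<lambda>x\<in>carrier M. E f x \<oplus>\<^bsub>J\<^esub> E f' x)"
      proof (rule F2_cong)
        note s = Hom_plus[OF N' right_module_J f f']
        show "E (\<lambda>x\<in>carrier ?N. f x \<oplus>\<^bsub>J\<^esub> f' x) \<in> Hom k M J" by (rule E(1)[OF s])
        show "(\<lambda>x\<in>carrier M. E f x \<oplus>\<^bsub>J\<^esub> E f' x) \<in> Hom k M J" by (rule Hom_plus[OF M right_module_J E(1)[OF f] E(1)[OF f']])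
        fix y assume y: "y \<in> N"
        show "E (\<lambda>x\<in>carrier ?N. f x \<oplus>\<^bsub>J\<^esub> f' x) y = (\<lambda>x\<in>carrier M. E f x \<oplus>\<^bsub>J\<^esub> E f' x) y"
          using E(2)[OF s y] E(2)[OF f y] E(2)[OF f' y] y subsetD[OF NM y] by simp
      qed
      then show "F2 (E (\<lambda>x\<in>carrier ?N. f x \<oplus>\<^bsub>J\<^esub> f' x)) = F2 (E f) \<oplus>\<^bsub>J\<^esub> F2 (E f')"
        using F2_add[OF E(1)[OF f] E(1)[OF f']] by simp
    }
  next
    fix c f assume c: "c \<in> carrier k" and f: "f \<in> Hom k ?N J"
    have "F2 (E (\<lambda>x\<in>carrier ?N. f (c \<odot>\<^bsub>?N\<^esub> x))) = F2 (\<lambda>x\<in>carrier M. E f (c \<odot>\<^bsub>M\<^esub> x))"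
    proof (rule F2_cong)
      note s = Hom_scale[OF N' c f]
      show "E (\<lambda>x\<in>carrier ?N. f (c \<odot>\<^bsub>?N\<^esub> x)) \<in> Hom k M J" by (rule E(1)[OF s])
      show "(\<lambda>x\<in>carrier M. E f (c \<odot>\<^bsub>M\<^esub> x)) \<in> Hom k M J" by (rule Hom_scale[OF M c E(1)[OF f]])
      fix y assume y: "y \<in> N"
      have "c \<odot>\<^bsub>M\<^esub> y \<in> N" using y c N by (simp add: M.submodule_iff)
      then show "E (\<lambda>x\<in>carrier ?N. f (c \<odot>\<^bsub>?N\<^esub> x)) y = (\<lambda>x\<in>carrier M. E f (c \<odot>\<^bsub>M\<^esub> x)) y"
        using E(2)[OF s y] E(2)[OF f] y subsetD[OF NM y] by simp
    qed
    then show "F2 (E (\<lambda>x\<in>carrier ?N. f (c \<odot>\<^bsub>?N\<^esub> x))) = c \<odot>\<^bsub>J\<^esub> F2 (E f)"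
      using F2_scale[OF E(1)[OF f] c] by simp
  qed
  then obtain n where n: "n \<in> N" "\<And>f. f \<in> Hom k ?N J \<Longrightarrow> F2 (E f) = f n"
    using bN unfolding bireflexive_def by auto
  have nM: "n \<in> carrier M" using n(1) NM by blast
  have "F h = h (n \<oplus>\<^bsub>M\<^esub> x0)" if h: "h \<in> Hom k M J" for h
  proof -
    have r: "(\<lambda>x\<in>N. h x) \<in> Hom k ?N J" by (rule Hom_restrict[OF M N h])
    have "F2 h = F2 (E (\<lambda>x\<in>N. h x))" by (rule F2_cong[OF h E(1)[OF r]]) (simp add: E(2)[OF r])
    also have "\<dots> = h n" using n(2)[OF r] n(1) by simp
    finally have "F h \<ominus>\<^bsub>J\<^esub> h x0 = h n" by (simp add: F2_def)
    then have "h n \<oplus>\<^bsub>J\<^esub> h x0 = (F h \<ominus>\<^bsub>J\<^esub> h x0) \<oplus>\<^bsub>J\<^esub> h x0" by simp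
    also have "\<dots> = F h" using cl[OF h] by (simp add: a_minus_def J.M.a_assoc J.M.l_neg)
    finally show ?thesis using Hom_add[OF h nM x0(1)] by simp
  qed
  then show "\<exists>x\<in>carrier M. \<forall>h\<in>Hom k M J. F h = h x"
    using nM x0(1) by (intro bexI[of _ "n \<oplus>\<^bsub>M\<^esub> x0"]) auto
qed

text \<open>This climbs a composition series: a maximal bireflexive submodule \<open>N\<close> that
  is not \<open>M\<close> would have a minimal \<open>U\<close> above it, and
  \<open>bireflexive_extension\<close> applies to \<open>U\<close> because \<open>U / N\<close> is
  simple.\<close>

lemma fg_bireflexive:
  assumes fg: "fg_module k M" shows "bireflexive M"
proof -
  have M: "right_module k M" using fg by (rule fg_moduleD)
  interpret M: right_module k M by fact
  have FM: "finite_length k M" by (rule fg_finite_length[OF k.artinian_finite_length[OF artinian] fg])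
  define P where "P N \<longleftrightarrow> submodule N k M \<and> bireflexive (M\<lparr>carrier := N\<rparr>)" for N
  have Psub: "\<And>N. P N \<Longrightarrow> submodule N k M" by (simp add: P_def)
  have "bireflexive (M\<lparr>carrier := {\<zero>\<^bsub>M\<^esub>}\<rparr>)"
    unfolding bireflexive_def
  proof (intro allI impI bexI ballI)
    let ?Z = "M\<lparr>carrier := {\<zero>\<^bsub>M\<^esub>}\<rparr>"
    have Z: "right_module k ?Z" by (rule submodule_right_module[OF M M.zero_submodule])
    fix F h assume F: "functional ?Z F" and h: "h \<in> Hom k ?Z J"
    have hz: "h \<zero>\<^bsub>M\<^esub> = \<zero>\<^bsub>J\<^esub>" using Hom_zero[OF Z right_module_J h] by simp
    have "h = (\<lambda>x\<in>carrier ?Z. \<zero>\<^bsub>J\<^esub>)" by (rule Hom_ext[OF h Hom_null[OF Z right_module_J]]) (simp add: hz)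
    then show "F h = h \<zero>\<^bsub>M\<^esub>" using functional_zero[OF Z F] hz by simp
  qed simp
  then have "P {\<zero>\<^bsub>M\<^esub>}" unfolding P_def using M.zero_submodule by blast
  then obtain N where PN: "P N" and max: "\<forall>N'. P N' \<longrightarrow> \<not> N \<subset> N'"
    using finite_length_maximal[OF M FM _ Psub] by blast
  have N: "submodule N k M" and bN: "bireflexive (M\<lparr>carrier := N\<rparr>)" using PN by (simp_all add: P_def)
  have NM: "N \<subseteq> carrier M" using N by (simp add: M.submodule_iff)
  have "N = carrier M"
  proof (rule ccontr)
    assume neq: "N \<noteq> carrier M"
    define Q where "Q U \<longleftrightarrow> submodule U k M \<and> N \<subset> U" for U
    have "Q (carrier M)" unfolding Q_def using M.carrier_submodule NM neq by blast
    moreover have "\<And>U. Q U \<Longrightarrow> submodule U k M" by (simp add: Q_def)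
    ultimately obtain U where QU: "Q U" and min: "\<forall>U'. Q U' \<longrightarrow> \<not> U' \<subset> U"
      using finite_length_minimal[OF FM, of Q] by blast
    have U: "submodule U k M" and NU: "N \<subset> U" using QU by (simp_all add: Q_def)
    have step: "N <+>\<^bsub>M\<^esub> M.cyclic y = U" if y: "y \<in> U" "y \<notin> N" for y
    proof -
      have yM: "y \<in> carrier M" using y(1) U by (auto simp: M.submodule_iff)
      note sc = M.submodule_cyclic[OF yM]
      have "N <+>\<^bsub>M\<^esub> M.cyclic y \<subseteq> U"
        by (rule M.set_add_least[OF U _ M.cyclic_least[OF U y(1)]]) (use NU in blast)
      moreover have "N \<subset> N <+>\<^bsub>M\<^esub> M.cyclic y"
        using M.set_add_upper[OF N sc] M.mem_cyclic[OF yM] y(2) by blast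
      then have "Q (N <+>\<^bsub>M\<^esub> M.cyclic y)" unfolding Q_def using M.submodule_add[OF N sc] by blast
      ultimately show ?thesis using min by blast
    qed
    obtain x where x: "x \<in> U" "x \<notin> N" using NU by blast
    have xM: "x \<in> carrier M" using x(1) U by (auto simp: M.submodule_iff)
    let ?R = "regular_module k"
    have R: "right_module k ?R" by (rule k.regular_right_module)
    \<comment> \<open>The annihilator of \<open>x\<close> modulo \<open>N\<close>, maximal because
      each element of \<open>U\<close> outside \<open>N\<close> generates \<open>U\<close> together
      with \<open>N\<close>.\<close>
    define m where "m = {c \<in> carrier ?R. (\<lambda>c\<in>carrier ?R. c \<odot>\<^bsub>M\<^esub> x) c \<in> N}"
    have m_iff: "c \<in> m \<longleftrightarrow> c \<in> carrier k \<and> c \<odot>\<^bsub>M\<^esub> x \<in> N" for c by (auto simp: m_def)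
    have sm: "submodule m k ?R" unfolding m_def by (rule Hom_vimage_submodule[OF R M smult_map_Hom[OF M xM] N])
    have m: "maximalideal m k"
    proof (rule maximalidealI)
      show "ideal m k" using sm k.ideal_iff_submodule by blast
      show "carrier k \<noteq> m" using m_iff[of "\<one>\<^bsub>k\<^esub>"] x(2) xM by auto
      fix I assume I: "ideal I k" "m \<subseteq> I" "I \<subseteq> carrier k"
      have sI: "submodule I k ?R" using I(1) k.ideal_iff_submodule by blast
      show "I = m \<or> I = carrier k"
      proof (cases "I = m")
        case False
        then obtain c where c: "c \<in> I" "c \<notin> m" using I(2) by blast
        have ck: "c \<in> carrier k" using c(1) I(3) by blast
        have "c \<odot>\<^bsub>M\<^esub> x \<in> U" "c \<odot>\<^bsub>M\<^esub> x \<notin> N" using x(1) U ck c(2) m_iff by (auto simp: M.submodule_iff)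
        then have "x \<in> N <+>\<^bsub>M\<^esub> M.cyclic (c \<odot>\<^bsub>M\<^esub> x)" using step x(1) by blast
        then obtain n d where nd: "n \<in> N" "d \<in> carrier k" "x = n \<oplus>\<^bsub>M\<^esub> d \<odot>\<^bsub>M\<^esub> (c \<odot>\<^bsub>M\<^esub> x)"
          unfolding M.mem_set_add M.cyclic_def by blast
        \<comment> \<open>The expression for \<open>x\<close> says that this scalar carries
          \<open>x\<close> to \<open>n\<close> in \<open>N\<close>. So it belongs to
          \<open>m\<close>, hence to \<open>I\<close>, and with \<open>c\<close> in \<open>I\<close>
          also \<open>\<one>\<close> does.\<close>
        let ?e = "\<one>\<^bsub>k\<^esub> \<ominus>\<^bsub>k\<^esub> c \<otimes>\<^bsub>k\<^esub> d"
        have ek: "?e \<in> carrier k" using ck nd(2) by simp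
        have nM: "n \<in> carrier M" using nd(1) NM by blast
        let ?w = "d \<odot>\<^bsub>M\<^esub> (c \<odot>\<^bsub>M\<^esub> x)"
        have wM: "?w \<in> carrier M" using nd(2) ck xM by simp
        have "?e \<odot>\<^bsub>M\<^esub> x = x \<ominus>\<^bsub>M\<^esub> ?w"
          using ck nd(2) xM by (simp add: a_minus_def M.smult_l_distr M.smult_l_minus M.smult_assoc)
        also have "\<dots> = (n \<oplus>\<^bsub>M\<^esub> ?w) \<ominus>\<^bsub>M\<^esub> ?w" using nd(3) by simp
        also have "\<dots> = n" using nM wM by (simp add: a_minus_def M.M.a_assoc M.M.r_neg)
        finally have "?e \<in> m" using ek nd(1) m_iff by simp
        then have "?e \<in> I" using I(2) by blast
        moreover have "c \<otimes>\<^bsub>k\<^esub> d \<in> I" using c(1) nd(2) sI unfolding k.regular_submodule_iff by blast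
        ultimately have "?e \<oplus>\<^bsub>k\<^esub> c \<otimes>\<^bsub>k\<^esub> d \<in> I" using sI unfolding k.regular_submodule_iff by blast
        moreover have "?e \<oplus>\<^bsub>k\<^esub> c \<otimes>\<^bsub>k\<^esub> d = \<one>\<^bsub>k\<^esub>" using ck nd(2) by (simp add: a_minus_def k.a_assoc k.l_neg)
        ultimately show ?thesis using ideal.one_imp_carrier[OF I(1)] by simp
      qed simp
    qed
    let ?U = "M\<lparr>carrier := U\<rparr>"
    have U': "right_module k ?U" by (rule submodule_right_module[OF M U])
    have "bireflexive ?U"
    proof (rule bireflexive_extension)
      show "fg_module k ?U" by (rule finite_length_fg[OF M FM U])
      show "submodule N k ?U" using submodule_trans_iff[OF M U] N NU by blast
      show "bireflexive (?U\<lparr>carrier := N\<rparr>)" using bN by simp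
      show "maximalideal m k" by (rule m)
      show "x \<in> carrier ?U" using x(1) by simp
      show "\<mu> \<odot>\<^bsub>?U\<^esub> x \<in> N" if "\<mu> \<in> m" for \<mu> using that m_iff by simp
      have "right_module.cyclic k ?U x = M.cyclic x"
        by (simp add: right_module.cyclic_def[OF U'] M.cyclic_def)
      then show "N <+>\<^bsub>?U\<^esub> right_module.cyclic k ?U x = carrier ?U"
        using step[OF x] by (simp add: set_add_def')
    qed
    then have "P U" using U by (simp add: P_def)
    then show False using max NU by blast
  qed
  then show ?thesis using bN by simp
qed

end

section \<open>The theorem\<close>

lemma standard_dual_simps [simp]:
  "carrier (standard_dual k \<phi> J M) = Hom k (restrict_scalars \<phi> M) J"
  "add (standard_dual k \<phi> J M) = (\<lambda>f g. \<lambda>x\<in>carrier M. f x \<oplus>\<^bsub>J\<^esub> g x)"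
  "smult (standard_dual k \<phi> J M) = (\<lambda>a f. \<lambda>x\<in>carrier M. f (a \<odot>\<^bsub>M\<^esub> x))"
  by (simp_all add: standard_dual_def)

text \<open>\<open>h\<close> stays \<open>k\<close>-linear after the action of \<open>a\<close>
  because \<open>\<phi> c\<close> commutes with \<open>a\<close>.\<close>

lemma standard_dual_smult_closed:
  assumes B: "artin_algebra k \<phi> B" and T: "right_module B T"
    and a: "a \<in> carrier B" and h: "h \<in> Hom k (restrict_scalars \<phi> T) J"
  shows "(\<lambda>x\<in>carrier T. h (a \<odot>\<^bsub>T\<^esub> x)) \<in> Hom k (restrict_scalars \<phi> T) J"
proof -
  interpret T: right_module B T by fact
  have kT: "right_module k (restrict_scalars \<phi> T)" by (rule restrict_scalars_right_module[OF B T])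
  have "(\<lambda>x\<in>carrier (restrict_scalars \<phi> T). h (a \<odot>\<^bsub>T\<^esub> x)) \<in> Hom k (restrict_scalars \<phi> T) J"
  proof (rule restrict_HomI[OF kT])
    fix x assume "x \<in> carrier (restrict_scalars \<phi> T)"
    then have x: "x \<in> carrier T" by simp
    then have ax: "a \<odot>\<^bsub>T\<^esub> x \<in> carrier T" using a by simp
    show "h (a \<odot>\<^bsub>T\<^esub> x) \<in> carrier J" using Hom_closed[OF h] ax by simp
    {
      fix y assume "y \<in> carrier (restrict_scalars \<phi> T)"
      then show "h (a \<odot>\<^bsub>T\<^esub> (x \<oplus>\<^bsub>restrict_scalars \<phi> T\<^esub> y)) = h (a \<odot>\<^bsub>T\<^esub> x) \<oplus>\<^bsub>J\<^esub> h (a \<odot>\<^bsub>T\<^esub> y)"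
        using Hom_add[OF h, of "a \<odot>\<^bsub>T\<^esub> x" "a \<odot>\<^bsub>T\<^esub> y"] x a by (simp add: T.smult_r_distr)
    }
    {
      fix c assume c: "c \<in> carrier k"
      note pc = artin_algebraD(4)[OF B c]
      have "a \<odot>\<^bsub>T\<^esub> (\<phi> c \<odot>\<^bsub>T\<^esub> x) = \<phi> c \<odot>\<^bsub>T\<^esub> (a \<odot>\<^bsub>T\<^esub> x)"
        using artin_algebraD(8)[OF B c a] x a pc by (simp flip: T.smult_assoc)
      then show "h (a \<odot>\<^bsub>T\<^esub> (c \<odot>\<^bsub>restrict_scalars \<phi> T\<^esub> x)) = c \<odot>\<^bsub>J\<^esub> h (a \<odot>\<^bsub>T\<^esub> x)"
        using Hom_smult[OF h c, of "a \<odot>\<^bsub>T\<^esub> x"] ax by simp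
    }
  qed
  then show ?thesis by simp
qed

text \<open>The isomorphism is composition with the inverse of \<open>l\<close>.
  \<open>Hom C\<close> looks only at the carrier of \<open>C\<close>, which allows \<open>C\<close>
  to be \<open>A\<close> while \<open>B\<close> is \<open>opp_ring A\<close>.\<close>

lemma standard_dual_iso:
  assumes B: "artin_algebra k \<phi> B" and T: "right_module B T" and U: "right_module B U" and J: "right_module k J"
    and l: "l \<in> module_iso B T U" and C: "carrier C = carrier B"
  shows "isomorphic C (standard_dual k \<phi> J T) (standard_dual k \<phi> J U)"
proof -
  interpret T: right_module B T by fact
  interpret U: right_module B U by fact
  have lH: "l \<in> Hom B T U" and lbij: "bij_betw l (carrier T) (carrier U)" using l by (simp_all add: module_iso_def)
  define i where "i = (\<lambda>y\<in>carrier U. inv_into (carrier T) l y)"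
  have "i \<in> module_iso B U T" unfolding i_def by (rule module_iso_inv[OF T U l])
  then have iH: "i \<in> Hom B U T" by (simp add: module_iso_def)
  have il: "i (l t) = t" if "t \<in> carrier T" for t
    using bij_betw_inv_into_left[OF lbij that] Hom_closed[OF lH that] by (simp add: i_def)
  have li: "l (i y) = y" if "y \<in> carrier U" for y
    using bij_betw_inv_into_right[OF lbij that] that by (simp add: i_def)
  have kT: "right_module k (restrict_scalars \<phi> T)" and kU: "right_module k (restrict_scalars \<phi> U)"
    using restrict_scalars_right_module[OF B] T U by blast+
  have pre: "(\<lambda>y\<in>carrier U. h (i y)) \<in> Hom k (restrict_scalars \<phi> U) J" if "h \<in> Hom k (restrict_scalars \<phi> T) J" for h
    using Hom_comp[OF kU restrict_scalars_Hom[OF B iH] that] by simp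
  have post: "(\<lambda>t\<in>carrier T. h (l t)) \<in> Hom k (restrict_scalars \<phi> T) J" if "h \<in> Hom k (restrict_scalars \<phi> U) J" for h
    using Hom_comp[OF kT restrict_scalars_Hom[OF B lH] that] by simp
  let ?D = "Hom k (restrict_scalars \<phi> T) J"
  let ?E = "Hom k (restrict_scalars \<phi> U) J"
  let ?Th = "\<lambda>h\<in>?D. \<lambda>y\<in>carrier U. h (i y)"
  have plus: "(\<lambda>x\<in>carrier T. h x \<oplus>\<^bsub>J\<^esub> h' x) \<in> ?D" if "h \<in> ?D" "h' \<in> ?D" for h h'
    using Hom_plus[OF kT J that] by simp
  have iU: "i y \<in> carrier T" if "y \<in> carrier U" for y using Hom_closed[OF iH that] .
  have "bij_betw ?Th ?D ?E"
  proof (rule bij_betw_byWitness[where f' = "\<lambda>h. \<lambda>t\<in>carrier T. h (l t)"])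
    show "\<forall>h\<in>?D. (\<lambda>t\<in>carrier T. ?Th h (l t)) = h"
    proof
      fix h assume h: "h \<in> ?D"
      have "h \<in> extensional (carrier T)" using Hom_extensional[OF h] by simp
      then show "(\<lambda>t\<in>carrier T. ?Th h (l t)) = h"
        using h il Hom_closed[OF lH] by (intro extensionalityI[OF restrict_extensional]) simp_all
    qed
    show "\<forall>h\<in>?E. ?Th (\<lambda>t\<in>carrier T. h (l t)) = h"
    proof
      fix h assume h: "h \<in> ?E"
      have "h \<in> extensional (carrier U)" using Hom_extensional[OF h] by simp
      moreover have "?Th (\<lambda>t\<in>carrier T. h (l t)) = (\<lambda>y\<in>carrier U. (\<lambda>t\<in>carrier T. h (l t)) (i y))"
        by (rule restrict_apply'[OF post[OF h]])
      ultimately show "?Th (\<lambda>t\<in>carrier T. h (l t)) = h"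
        using li iU by (intro extensionalityI[of _ "carrier U"]) simp_all
    qed
    show "?Th ` ?D \<subseteq> ?E" using pre by auto
    show "(\<lambda>h. \<lambda>t\<in>carrier T. h (l t)) ` ?E \<subseteq> ?D" using post by blast
  qed
  moreover have "?Th \<in> Hom C (standard_dual k \<phi> J T) (standard_dual k \<phi> J U)"
  proof (rule HomI)
    fix h assume "h \<in> carrier (standard_dual k \<phi> J T)"
    then have h: "h \<in> ?D" by simp
    show "?Th h \<in> carrier (standard_dual k \<phi> J U)" using pre[OF h] h by simp
    {
      fix h' assume "h' \<in> carrier (standard_dual k \<phi> J T)"
      then have h': "h' \<in> ?D" by simp
      show "?Th (h \<oplus>\<^bsub>standard_dual k \<phi> J T\<^esub> h') = ?Th h \<oplus>\<^bsub>standard_dual k \<phi> J U\<^esub> ?Th h'"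
        using plus[OF h h'] h h' iU by (simp cong: restrict_cong)
    }
    {
      fix a assume "a \<in> carrier C"
      then have a: "a \<in> carrier B" using C by simp
      have "h (a \<odot>\<^bsub>T\<^esub> i y) = h (i (a \<odot>\<^bsub>U\<^esub> y))" if "y \<in> carrier U" for y
        using Hom_smult[OF iH a that] by simp
      then show "?Th (a \<odot>\<^bsub>standard_dual k \<phi> J T\<^esub> h) = a \<odot>\<^bsub>standard_dual k \<phi> J U\<^esub> ?Th h"
        using standard_dual_smult_closed[OF B T a h] h iU a by (simp cong: restrict_cong)
    }
  qed simp
  ultimately have "?Th \<in> module_iso C (standard_dual k \<phi> J T) (standard_dual k \<phi> J U)"
    by (simp add: module_iso_def)
  then show ?thesis unfolding isomorphic_def by blast
qed

lemma (in matlis) separating_eq: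
  assumes fg: "fg_module k M" and xy: "x \<in> carrier M" "y \<in> carrier M"
    and eq: "\<And>h. h \<in> Hom k M J \<Longrightarrow> h x = h y"
  shows "x = y"
proof (rule ccontr)
    assume "x \<noteq> y"
    have M: "right_module k M" using fg by (rule fg_moduleD)
    interpret M: right_module k M by fact
    have "x \<ominus>\<^bsub>M\<^esub> y \<in> carrier M" "x \<ominus>\<^bsub>M\<^esub> y \<noteq> \<zero>\<^bsub>M\<^esub>" using xy \<open>x \<noteq> y\<close> by (simp_all add: M.minus_eq_zero_iff)
    then obtain h where h: "h \<in> Hom k M J" "h (x \<ominus>\<^bsub>M\<^esub> y) \<noteq> \<zero>\<^bsub>J\<^esub>" using separating[OF fg] by blast
    have "h (x \<ominus>\<^bsub>M\<^esub> y) = h x \<ominus>\<^bsub>J\<^esub> h y" by (rule Hom_diff[OF M right_module_J h(1) xy])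
    also have "\<dots> = \<zero>\<^bsub>J\<^esub>" using eq[OF h(1)] Hom_closed[OF h(1) xy(1)] Hom_closed[OF h(1) xy(2)] by (simp add: J.minus_eq_zero_iff)
    finally show False using h(2) by simp
  qed

text \<open>If \<open>\<theta>\<close> is composition with the inverse of some \<open>l\<close>,
  then \<open>\<theta> h (l t) = h t\<close> for all \<open>h\<close>. This relation is taken as the
  graph of \<open>l\<close>: \<open>fg_bireflexive\<close> makes it total on both sides,
  \<open>separating_eq\<close> makes it single-valued on both sides, and it is stable under sums and
  scalars.\<close>

lemma (in matlis) iso_of_standard_dual_iso:
  assumes B: "artin_algebra k \<phi> B" and T: "right_module B T" and U: "right_module B U"
    and fT: "fg_module k (restrict_scalars \<phi> T)" and fU: "fg_module k (restrict_scalars \<phi> U)"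
    and th: "\<theta> \<in> module_iso C (standard_dual k \<phi> J T) (standard_dual k \<phi> J U)" and C: "carrier C = carrier B"
  shows "\<exists>l. l \<in> module_iso B T U"
proof -
  interpret T: right_module B T by fact
  interpret U: right_module B U by fact
  let ?T = "restrict_scalars \<phi> T" and ?U = "restrict_scalars \<phi> U"
  have kT: "right_module k ?T" by (rule restrict_scalars_right_module[OF B T])
  have thH: "\<theta> \<in> Hom C (standard_dual k \<phi> J T) (standard_dual k \<phi> J U)"
    and thb: "bij_betw \<theta> (Hom k ?T J) (Hom k ?U J)" using th by (simp_all add: module_iso_def)
  have th_closed: "\<theta> h \<in> Hom k ?U J" if "h \<in> Hom k ?T J" for h using Hom_closed[OF thH] that by simp
  have th_surj: "\<exists>h\<in>Hom k ?T J. H = \<theta> h" if "H \<in> Hom k ?U J" for H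
    using thb that unfolding bij_betw_def by blast
  have th_add: "\<theta> (\<lambda>x\<in>carrier T. h x \<oplus>\<^bsub>J\<^esub> h' x) = (\<lambda>x\<in>carrier U. \<theta> h x \<oplus>\<^bsub>J\<^esub> \<theta> h' x)"
    if "h \<in> Hom k ?T J" "h' \<in> Hom k ?T J" for h h' using Hom_add[OF thH] that by simp
  have th_smult: "\<theta> (\<lambda>x\<in>carrier T. h (a \<odot>\<^bsub>T\<^esub> x)) = (\<lambda>x\<in>carrier U. \<theta> h (a \<odot>\<^bsub>U\<^esub> x))"
    if "h \<in> Hom k ?T J" "a \<in> carrier B" for h a using Hom_smult[OF thH] that C by simp
  define rel where "rel t f \<longleftrightarrow> t \<in> carrier T \<and> f \<in> carrier U \<and> (\<forall>h\<in>Hom k ?T J. \<theta> h f = h t)" for t f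
  have right_total: "\<exists>t. rel t f" if f: "f \<in> carrier U" for f
  proof -
    have "functional ?T (\<lambda>h. \<theta> h f)"
      unfolding functional_def
    proof (intro conjI ballI)
      fix h assume h: "h \<in> Hom k ?T J"
      show "\<theta> h f \<in> carrier J" using Hom_closed[OF th_closed[OF h]] f by simp
      show "\<theta> (\<lambda>x\<in>carrier ?T. h x \<oplus>\<^bsub>J\<^esub> h' x) f = \<theta> h f \<oplus>\<^bsub>J\<^esub> \<theta> h' f" if "h' \<in> Hom k ?T J" for h'
        using th_add[OF h that] f by simp
    next
      fix c h assume c: "c \<in> carrier k" and h: "h \<in> Hom k ?T J"
      \<comment> \<open>The \<open>k\<close>-linearity of \<open>\<theta>\<close> is its linearity
        at the element \<open>\<phi> c\<close> of \<open>B\<close>.\<close>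
      show "\<theta> (\<lambda>x\<in>carrier ?T. h (c \<odot>\<^bsub>?T\<^esub> x)) f = c \<odot>\<^bsub>J\<^esub> \<theta> h f"
        using th_smult[OF h artin_algebraD(4)[OF B c]] f Hom_smult[OF th_closed[OF h] c, of f] by simp
    qed
    then obtain t where "t \<in> carrier ?T" "\<forall>h\<in>Hom k ?T J. \<theta> h f = h t"
      using fg_bireflexive[OF fT] unfolding bireflexive_def by blast
    then have "rel t f" using f by (simp add: rel_def)
    then show ?thesis ..
  qed
  have left_total: "\<exists>f. rel t f" if t: "t \<in> carrier T" for t
  proof -
    \<comment> \<open>For totality on this side the inverse of \<open>\<theta>\<close> turns
      evaluation at \<open>t\<close> into a functional on the dual of \<open>U\<close>.\<close>
    let ?i = "inv_into (Hom k ?T J) \<theta>"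
    have i: "?i (\<theta> h) = h" if "h \<in> Hom k ?T J" for h by (rule bij_betw_inv_into_left[OF thb that])
    have "functional ?U (\<lambda>H. ?i H t)"
      unfolding functional_def
    proof (intro conjI ballI)
      fix H assume "H \<in> Hom k ?U J"
      then obtain h where h: "h \<in> Hom k ?T J" "H = \<theta> h" using th_surj by blast
      show "?i H t \<in> carrier J" using i[OF h(1)] h(2) Hom_closed[OF h(1)] t by simp
      {
        fix H' assume "H' \<in> Hom k ?U J"
        then obtain h' where h': "h' \<in> Hom k ?T J" "H' = \<theta> h'" using th_surj by blast
        have s: "(\<lambda>x\<in>carrier T. h x \<oplus>\<^bsub>J\<^esub> h' x) \<in> Hom k ?T J"
          using Hom_plus[OF kT right_module_J h(1) h'(1)] by simp
        have "(\<lambda>x\<in>carrier ?U. H x \<oplus>\<^bsub>J\<^esub> H' x) = \<theta> (\<lambda>x\<in>carrier T. h x \<oplus>\<^bsub>J\<^esub> h' x)"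
          using th_add[OF h(1) h'(1)] h(2) h'(2) by simp
        then show "?i (\<lambda>x\<in>carrier ?U. H x \<oplus>\<^bsub>J\<^esub> H' x) t = ?i H t \<oplus>\<^bsub>J\<^esub> ?i H' t"
          using i[OF s] i[OF h(1)] i[OF h'(1)] h(2) h'(2) t by simp
      }
    next
      fix c H assume c: "c \<in> carrier k" and "H \<in> Hom k ?U J"
      then obtain h where h: "h \<in> Hom k ?T J" "H = \<theta> h" using th_surj by blast
      have s: "(\<lambda>x\<in>carrier T. h (\<phi> c \<odot>\<^bsub>T\<^esub> x)) \<in> Hom k ?T J"
        by (rule standard_dual_smult_closed[OF B T artin_algebraD(4)[OF B c] h(1)])
      have "(\<lambda>x\<in>carrier ?U. H (c \<odot>\<^bsub>?U\<^esub> x)) = \<theta> (\<lambda>x\<in>carrier T. h (\<phi> c \<odot>\<^bsub>T\<^esub> x))"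
        using th_smult[OF h(1) artin_algebraD(4)[OF B c]] h(2) by simp
      then show "?i (\<lambda>x\<in>carrier ?U. H (c \<odot>\<^bsub>?U\<^esub> x)) t = c \<odot>\<^bsub>J\<^esub> ?i H t"
        using i[OF s] i[OF h(1)] h(2) t Hom_smult[OF h(1) c, of t] by simp
    qed
    then obtain f where f: "f \<in> carrier ?U" "\<forall>H\<in>Hom k ?U J. ?i H t = H f"
      using fg_bireflexive[OF fU] unfolding bireflexive_def by blast
    have "\<theta> h f = h t" if "h \<in> Hom k ?T J" for h using f(2) th_closed[OF that] i[OF that] by metis
    then have "rel t f" using f(1) t by (simp add: rel_def)
    then show ?thesis ..
  qed
  have right_unique: "f = f'" if "rel t f" "rel t f'" for t f f'
  proof (rule separating_eq[OF fU])
    show "f \<in> carrier ?U" "f' \<in> carrier ?U" using that by (simp_all add: rel_def)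
    fix H assume "H \<in> Hom k ?U J"
    then obtain h where "h \<in> Hom k ?T J" "H = \<theta> h" using th_surj by blast
    then show "H f = H f'" using that by (simp add: rel_def)
  qed
  have left_unique: "t = t'" if "rel t f" "rel t' f" for t t' f
  proof (rule separating_eq[OF fT])
    show "t \<in> carrier ?T" "t' \<in> carrier ?T" using that by (simp_all add: rel_def)
    fix h assume h: "h \<in> Hom k ?T J"
    have "\<theta> h f = h t" "\<theta> h f = h t'" using that h unfolding rel_def by blast+
    then show "h t = h t'" by (rule trans[OF sym])
  qed
  define l where "l = (\<lambda>t\<in>carrier T. SOME f. rel t f)"
  have rel_l: "rel t (l t)" if "t \<in> carrier T" for t
    using someI_ex[OF left_total[OF that]] that by (simp add: l_def)
  have l_eq: "l t = f" if "rel t f" for t f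
    using right_unique[OF rel_l that] that by (simp add: rel_def)
  have lH: "l \<in> Hom B T U"
  proof (rule HomI)
    fix t assume t: "t \<in> carrier T"
    have lt: "l t \<in> carrier U" and lh: "\<And>h. h \<in> Hom k ?T J \<Longrightarrow> \<theta> h (l t) = h t"
      using rel_l[OF t] by (auto simp: rel_def)
    show "l t \<in> carrier U" by (rule lt)
    {
      fix t' assume t': "t' \<in> carrier T"
      have lt': "l t' \<in> carrier U" and lh': "\<And>h. h \<in> Hom k ?T J \<Longrightarrow> \<theta> h (l t') = h t'"
        using rel_l[OF t'] by (auto simp: rel_def)
      have "\<theta> h (l t \<oplus>\<^bsub>U\<^esub> l t') = h (t \<oplus>\<^bsub>T\<^esub> t')" if h: "h \<in> Hom k ?T J" for h
        using Hom_add[OF th_closed[OF h], of "l t" "l t'"] Hom_add[OF h, of t t'] lt lt' t t' lh[OF h] lh'[OF h] by simp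
      then have "rel (t \<oplus>\<^bsub>T\<^esub> t') (l t \<oplus>\<^bsub>U\<^esub> l t')" using t t' lt lt' by (simp add: rel_def)
      then show "l (t \<oplus>\<^bsub>T\<^esub> t') = l t \<oplus>\<^bsub>U\<^esub> l t'" by (rule l_eq)
    }
    {
      fix a assume a: "a \<in> carrier B"
      have "\<theta> h (a \<odot>\<^bsub>U\<^esub> l t) = h (a \<odot>\<^bsub>T\<^esub> t)" if h: "h \<in> Hom k ?T J" for h
      proof -
        note s = standard_dual_smult_closed[OF B T a h]
        have "\<theta> h (a \<odot>\<^bsub>U\<^esub> l t) = \<theta> (\<lambda>x\<in>carrier T. h (a \<odot>\<^bsub>T\<^esub> x)) (l t)"
          using th_smult[OF h a] lt by simp
        also have "\<dots> = h (a \<odot>\<^bsub>T\<^esub> t)" using lh[OF s] t by simp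
        finally show ?thesis .
      qed
      then have "rel (a \<odot>\<^bsub>T\<^esub> t) (a \<odot>\<^bsub>U\<^esub> l t)" using t lt a by (simp add: rel_def)
      then show "l (a \<odot>\<^bsub>T\<^esub> t) = a \<odot>\<^bsub>U\<^esub> l t" by (rule l_eq)
    }
  qed (simp add: l_def)
  moreover have "inj_on l (carrier T)"
    using left_unique rel_l by (intro inj_onI) metis
  moreover have "l ` carrier T = carrier U"
  proof
    show "l ` carrier T \<subseteq> carrier U" using Hom_closed[OF lH] by blast
    show "carrier U \<subseteq> l ` carrier T"
    proof
      fix f assume "f \<in> carrier U"
      then obtain t where t: "rel t f" using right_total by blast
      then have "t \<in> carrier T" by (simp add: rel_def)
      then show "f \<in> l ` carrier T" using l_eq[OF t] by blast
    qed
  qed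
  ultimately have "l \<in> module_iso B T U" by (simp add: module_iso_def bij_betw_def)
  then show ?thesis by blast
qed

section \<open>Ext in degrees 1 and 2 read off a presentation, and the proof of the theorem\<close>

lemma projective_resolution_presentation:
  assumes "projective_resolution A X P d e"
  shows "presentation A (P (Suc 0)) (P 0) (d 0)"
  using projective_resolutionD[OF assms] by (simp add: presentation_def)

text \<open>By exactness \<open>K\<close> is the image of the next differential, so the cocycle
  condition is vanishing on \<open>K\<close>, and the coboundaries are literally
  \<open>im\<close>.\<close>

lemma resolution_vanishing_iff:
  assumes P: "projective_resolution A X P d e"
  shows "cocycles A P d (regular_module A) (Suc 0) \<subseteq> coboundaries A P d (regular_module A) (Suc 0)
    \<longleftrightarrow> presentation.vanishing A (P (Suc 0)) (P 0) (d 0)"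
proof -
  interpret presentation A "P (Suc 0)" "P 0" "d 0" by (rule projective_resolution_presentation[OF P])
  note p = projective_resolutionD[OF P]
  have K: "K = d (Suc 0) ` carrier (P (Suc (Suc 0)))"
    using p(7)[of _ 0] Hom_closed[OF p(3)[of "Suc 0"]] unfolding K_def a_kernel_eq by blast
  have im: "im = coboundaries A P d (regular_module A) (Suc 0)"
    unfolding im_def dual_map_def by (simp cong: image_cong)
  show ?thesis unfolding vanishing_def im cocycles_def K by auto
qed

text \<open>By exactness a 2-cocycle vanishes on the kernel of the map onto \<open>K\<close>, so it
  is a functional on \<open>K\<close> composed with that map. It is a coboundary exactly when the
  functional extends from \<open>K\<close> to \<open>P (Suc 0)\<close>.\<close>

lemma resolution_extending_iff:
  assumes P: "projective_resolution A X P d e"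
  shows "cocycles A P d (regular_module A) (Suc (Suc 0)) \<subseteq> coboundaries A P d (regular_module A) (Suc (Suc 0))
    \<longleftrightarrow> presentation.extending A (P (Suc 0)) (P 0) (d 0)"
proof -
  interpret presentation A "P (Suc 0)" "P 0" "d 0" by (rule projective_resolution_presentation[OF P])
  note p = projective_resolutionD[OF P]
  let ?d1 = "d (Suc 0)" and ?d2 = "d (Suc (Suc 0))"
  let ?P2 = "P (Suc (Suc 0))" and ?R = "regular_module A"
  have R: "right_module A ?R" by (rule right_module_regular[OF ring_A])
  have K: "K = ?d1 ` carrier ?P2"
    using p(7)[of _ 0] Hom_closed[OF p(3)[of "Suc 0"]] unfolding K_def a_kernel_eq by blast
  have d1: "?d1 \<in> Hom A ?P2 KM" unfolding KM_def using p(3)[of "Suc 0"] K by (intro Hom_into_submodule) simp_all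
  show ?thesis
  proof
    assume sub: "cocycles A P d ?R (Suc (Suc 0)) \<subseteq> coboundaries A P d ?R (Suc (Suc 0))"
    show extending
      unfolding extending_def
    proof
      fix f assume f: "f \<in> Hom A KM ?R"
      let ?z = "\<lambda>x\<in>carrier ?P2. f (?d1 x)"
      have z: "?z \<in> Hom A ?P2 ?R" by (rule Hom_comp[OF p(2) d1 f])
      have "?z (?d2 x) = \<zero>\<^bsub>?R\<^esub>" if x: "x \<in> carrier (P (Suc (Suc (Suc 0))))" for x
        using projective_resolution_square[OF P x] Hom_closed[OF p(3) x] Hom_zero[OF right_module_KM R f] by simp
      then have "?z \<in> cocycles A P d ?R (Suc (Suc 0))" using z by (simp add: cocycles_def)
      then have "?z \<in> coboundaries A P d ?R (Suc (Suc 0))" using sub by blast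
      then obtain w where w: "w \<in> Hom A (P (Suc 0)) ?R" "?z = (\<lambda>x\<in>carrier ?P2. w (?d1 x))" by auto
      have "w y = f y" if "y \<in> K" for y
      proof -
        obtain x where x: "x \<in> carrier ?P2" "y = ?d1 x" using \<open>y \<in> K\<close> K by blast
        show ?thesis using fun_cong[OF w(2), of x] x by simp
      qed
      then show "\<exists>\<phi>\<in>Hom A (P (Suc 0)) ?R. \<forall>x\<in>K. \<phi> x = f x" using w(1) by blast
    qed
  next
    assume ext: extending
    show "cocycles A P d ?R (Suc (Suc 0)) \<subseteq> coboundaries A P d ?R (Suc (Suc 0))"
    proof
      fix z assume "z \<in> cocycles A P d ?R (Suc (Suc 0))"
      then have z: "z \<in> Hom A ?P2 ?R" "\<And>x. x \<in> carrier (P (Suc (Suc (Suc 0)))) \<Longrightarrow> z (?d2 x) = \<zero>\<^bsub>?R\<^esub>"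
        by (auto simp: cocycles_def)
      have "\<exists>f\<in>Hom A KM ?R. \<forall>x\<in>carrier ?P2. f (?d1 x) = z x"
      proof (rule factor_through_surj[OF p(2) right_module_KM R d1 _ z(1)])
        show "?d1 ` carrier ?P2 = carrier KM" using K by simp
        fix x assume x: "x \<in> carrier ?P2" "?d1 x = \<zero>\<^bsub>KM\<^esub>"
        then have "x \<in> ?d2 ` carrier (P (Suc (Suc (Suc 0))))" using p(7)[OF x(1)] by simp
        then show "z x = \<zero>\<^bsub>?R\<^esub>" using z(2) by blast
      qed
      then obtain f where f: "f \<in> Hom A KM ?R" "\<And>x. x \<in> carrier ?P2 \<Longrightarrow> f (?d1 x) = z x" by blast
      obtain w where w: "w \<in> Hom A (P (Suc 0)) ?R" "\<And>y. y \<in> K \<Longrightarrow> w y = f y"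
        using ext f(1) unfolding extending_def by blast
      have "z = (\<lambda>x\<in>carrier ?P2. w (?d1 x))"
      proof (rule Hom_ext[OF z(1) Hom_comp[OF p(2) p(3) w(1)]])
        fix x assume x: "x \<in> carrier ?P2"
        then have "?d1 x \<in> K" using K by blast
        then show "z x = (\<lambda>x\<in>carrier ?P2. w (?d1 x)) x" using w(2) f(2)[OF x] x by simp
      qed
      then show "z \<in> coboundaries A P d ?R (Suc (Suc 0))" using w(1) by auto
    qed
  qed
qed

theorem theorem2p1:
  fixes k :: "('k, 's) ring_scheme" and \<phi> :: "'k \<Rightarrow> 'a" and A :: "('a, 'r) ring_scheme"
    and J :: "('k, 'j, 'f) module_scheme" and X :: "('a, 'x, 'e) module_scheme"
  assumes "artin_algebra k \<phi> A"
    and "injective_envelope k (quotient_module (regular_module k) (jacobson_radical k)) J"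
    and "fg_module A X"
    and "indecomposable A X"
    and "\<not> fg_projective A X"
  shows "(trivial_group (Ext A 1 X (regular_module A)) \<and>
          trivial_group (Ext A 2 X (regular_module A))
            \<longleftrightarrow> reflexive (opp_ring A) (AB_transpose A X)) \<and>
         (reflexive (opp_ring A) (AB_transpose A X) \<longleftrightarrow> tau_perfect k \<phi> J A X)"
proof -
  note AA = assms(1) and a = artin_algebraD[OF assms(1)]
  note AO = artin_algebra_opp[OF AA]
  have FA: "finite_length A (regular_module A)" by (rule artin_regular_finite_length[OF AA])
  have FO: "finite_length (opp_ring A) (regular_module (opp_ring A))" by (rule artin_regular_finite_length[OF AO])
  have X: "right_module A X" by (rule fg_moduleD[OF assms(3)])
  have R: "right_module A (regular_module A)" by (rule right_module_regular[OF a(2)])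
  define P where "P = (\<lambda>n. case n of 0 \<Rightarrow> fst (proj_cover A X)
    | Suc n \<Rightarrow> fst (proj_cover A ((syzygy A ^^ n) (syzygy A X))))"
  define d where "d = (\<lambda>n. snd (proj_cover A ((syzygy A ^^ n) (syzygy A X))))"
  have res: "projective_resolution A X P d (snd (proj_cover A X))"
    unfolding P_def d_def by (rule syzygy_resolution[OF FA assms(3)])
  interpret presentation A "P (Suc 0)" "P 0" "d 0" by (rule projective_resolution_presentation[OF res])
  interpret matlis k J using a(1,3) assms(2) by (simp add: matlis_def)
  \<comment> \<open>This is an equality and not just an isomorphism, as both sides are built from
    the same chosen covers; likewise for \<open>KM\<close> and the second syzygy.\<close>
  have T: "AB_transpose A X = Trm"
    unfolding Trm_def im_def by (simp add: AB_transpose_def P_def d_def Let_def case_prod_beta)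
  have KM: "syzygy A (syzygy A X) = KM"
    unfolding syzygy_eq[of A "syzygy A X"] KM_def K_def a_kernel_eq
    by (simp add: P_def d_def syzygy_eq[of A X])
  \<comment> \<open>The lemma on Ext counts from \<open>Suc n\<close>, so its instances at
    \<open>0\<close> and \<open>Suc 0\<close> give degrees 1 and 2.\<close>
  have ext: "trivial_group (Ext A 1 X (regular_module A)) \<longleftrightarrow> vanishing"
    "trivial_group (Ext A 2 X (regular_module A)) \<longleftrightarrow> extending"
    using trivial_Ext_iff[OF X R res, of 0] resolution_vanishing_iff[OF res]
      trivial_Ext_iff[OF X R res, of "Suc 0"] resolution_extending_iff[OF res]
    by (simp_all add: numeral_2_eq_2)
  \<comment> \<open>Finite generation of \<open>Trm\<close> and of the dual of \<open>KM\<close> is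
    what the duality over \<open>k\<close> consumes after restriction of scalars; for
    \<open>Trm\<close> it also yields the finite length required by
    \<open>iso_imp_u_iso\<close>.\<close>
  have "fg_module (opp_ring A) (dual A (P (Suc 0)))"
    using projective_dual_basis[OF P1] dual_basis_fg_dual[OF rP1] by blast
  then have fgT: "fg_module (opp_ring A) Trm"
  proof (rule fg_module_surj[OF _ right_module_Trm cls_Hom])
    show "(\<lambda>\<phi>\<in>carrier (dual A (P (Suc 0))). cls \<phi>) ` carrier (dual A (P (Suc 0))) = carrier Trm"
      by (simp add: carrier_Trm)
  qed
  have fgK: "fg_module A KM" unfolding KM[symmetric] by (intro fg_syzygy[OF FA] assms(3))
  have fgK': "fg_module (opp_ring A) (dual A KM)"
    by (rule finite_length_fg_module[OF right_module_KM_dual finite_length_dual[OF fgK FO]])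
  have "tau_perfect k \<phi> J A X \<longleftrightarrow> u \<in> module_iso (opp_ring A) Trm (dual A KM)"
  proof
    assume "tau_perfect k \<phi> J A X"
    then obtain th where "th \<in> module_iso A (standard_dual k \<phi> J Trm) (standard_dual k \<phi> J (dual A KM))"
      unfolding tau_perfect_def AR_translate_def nakayama_def T KM isomorphic_def by blast
    from iso_of_standard_dual_iso[OF AO right_module_Trm right_module_KM_dual
        restrict_scalars_fg[OF AO fgT] restrict_scalars_fg[OF AO fgK'] this]
    obtain l where "l \<in> module_iso (opp_ring A) Trm (dual A KM)" by auto
    then show "u \<in> module_iso (opp_ring A) Trm (dual A KM)"
      by (rule iso_imp_u_iso[OF fg_finite_length[OF FO fgT]])
  next
    assume "u \<in> module_iso (opp_ring A) Trm (dual A KM)"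
    then show "tau_perfect k \<phi> J A X"
      unfolding tau_perfect_def AR_translate_def nakayama_def T KM
      by (rule standard_dual_iso[OF AO right_module_Trm right_module_KM_dual right_module_J]) simp
  qed
  then show ?thesis
    unfolding T ext using reflexive_iff u_iso_iff by blast
qed

end
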